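(* \textsc{Colored Path Deletion} is W[2]-hard when parameterized by $k$, even when restricted to instances with $c=3$ in which the input graph is non-cascading and has $n^{\mathcal{O}(1)}$ induced $c$-colored $P_\ell$s, and such that all induced $c$-colored $P_\ell$s of the input graph can be enumerated in polynomial time.
   Context: A $c$-colored graph is a simple graph $G=(V,E)$ with $E=E_1\sqcup\dots\sqcup E_c$ (non-empty color classes); $n=|V|$. A path is $c$-colored if its edges have exactly $c$ distinct colors; $P_\ell$ is a path on $\ell$ vertices. \textsc{Colored Path Deletion}: given a $c$-colored graph $G$ and integers $c,\ell,k$, decide whether there is a set $S$ of at most $k$ edges such that $G-S$ contains no induced $c$-colored $P_\ell$. An edge is a conflict edge if it lies in some induced $c$-colored $P_\ell$ of $G$; let $X$ be the set of conflict edges. $G$ is non-cascading if every subgraph of $G$ that is a $c$-colored $P_\ell$ but is not induced in $G$ is also not an induced subgraph of $G-X'$ for any $X'\subseteq X$. *)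

theory Defs
  imports Main
begin

section \<open>Machine model\<close>

text \<open>
  Computations are while-programs on binary trees (S-expressions over the single atom \<open>Leaf\<close>), in
  the style of N. D. Jones, \<^emph>\<open>Computability and Complexity\<close>. A program maps one tree to one tree;
  \<open>PCons P Q\<close> runs \<open>P\<close> and \<open>Q\<close> on the same input and pairs the results, \<open>PComp P Q\<close> runs \<open>P\<close> and
  then \<open>Q\<close>, and \<open>Leaf\<close> is the truth value false. Every step is charged at least the number of nodes
  of each tree it reads or writes, so a Turing machine working on bracket strings simulates a run of
  cost \<open>t\<close> in time polynomial in \<open>t\<close>; conversely, a Turing machine step is a fixed combination of
  these operations on a tree holding the state and the two tape halves. Polynomial time,
  fpt time and computability therefore have their usual meaning.
\<close>

datatype tree = Leaf | Node tree tree

fun tsize :: "tree \<Rightarrow> nat" where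
  "tsize Leaf = 1"
| "tsize (Node x y) = 1 + tsize x + tsize y"

fun thd :: "tree \<Rightarrow> tree" where
  "thd Leaf = Leaf"
| "thd (Node x y) = x"

fun ttl :: "tree \<Rightarrow> tree" where
  "ttl Leaf = Leaf"
| "ttl (Node x y) = y"

datatype prog =
    PId
  | PNil
  | PHd
  | PTl
  | PCons prog prog
  | PComp prog prog
  | PIf prog prog prog
  | PWhile prog prog

text \<open>\<open>run P x t y\<close>: on input \<open>x\<close>, the program \<open>P\<close> halts with output \<open>y\<close> at cost \<open>t\<close>.\<close>

inductive run :: "prog \<Rightarrow> tree \<Rightarrow> nat \<Rightarrow> tree \<Rightarrow> bool" where
  run_Id: "run PId x (tsize x) x"
| run_Nil: "run PNil x (tsize x) Leaf"
| run_Hd: "run PHd x (tsize x) (thd x)"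
| run_Tl: "run PTl x (tsize x) (ttl x)"
| run_Cons: "run P x t y \<Longrightarrow> run Q x u z \<Longrightarrow> run (PCons P Q) x (t + u + 1) (Node y z)"
| run_Comp: "run P x t y \<Longrightarrow> run Q y u z \<Longrightarrow> run (PComp P Q) x (t + u) z"
| run_If_true:
    "run B x t b \<Longrightarrow> b \<noteq> Leaf \<Longrightarrow> run P x u y \<Longrightarrow> run (PIf B P Q) x (t + u) y"
| run_If_false:
    "run B x t b \<Longrightarrow> b = Leaf \<Longrightarrow> run Q x u y \<Longrightarrow> run (PIf B P Q) x (t + u) y"
| run_While_true:
    "run B x t b \<Longrightarrow> b \<noteq> Leaf \<Longrightarrow> run P x u y \<Longrightarrow> run (PWhile B P) y v z \<Longrightarrow>
     run (PWhile B P) x (t + u + v) z"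
| run_While_false:
    "run B x t b \<Longrightarrow> b = Leaf \<Longrightarrow> run (PWhile B P) x (t + tsize x) x"

lemma tsize_pos: "1 \<le> tsize x"
  by (cases x) auto

lemma tsize_le_cost: "run P x t y \<Longrightarrow> tsize x \<le> t \<and> tsize y \<le> t"
proof (induction rule: run.induct)
  case (run_Nil x)
  then show ?case using tsize_pos[of x] by simp
next
  case (run_Hd x)
  then show ?case by (cases x) auto
next
  case (run_Tl x)
  then show ?case by (cases x) auto
qed auto

lemma run_deterministic:
  "run P x t y \<Longrightarrow> run P x u z \<Longrightarrow> t = u \<and> y = z"
proof (induction arbitrary: u z rule: run.induct)
  case run_Id
  then show ?case by (auto elim: run.cases)
next
  case run_Nil
  then show ?case by (auto elim: run.cases)
next
  case run_Hd
  then show ?case by (auto elim: run.cases)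
next
  case run_Tl
  then show ?case by (auto elim: run.cases)
next
  case run_Cons
  from run_Cons.prems show ?case by cases (use run_Cons.IH in blast)
next
  case run_Comp
  from run_Comp.prems show ?case by cases (use run_Comp.IH in blast)
next
  case run_If_true
  from run_If_true.prems show ?case by cases (use run_If_true.IH run_If_true.hyps in blast)+
next
  case run_If_false
  from run_If_false.prems show ?case by cases (use run_If_false.IH run_If_false.hyps in blast)+
next
  case run_While_true
  from run_While_true.prems show ?case
    by cases (use run_While_true.IH run_While_true.hyps in blast)+
next
  case run_While_false
  from run_While_false.prems show ?case
    by cases (use run_While_false.IH run_While_false.hyps in blast)+
qed

text \<open>Numbers are encoded in unary.\<close>

fun enc_nat :: "nat \<Rightarrow> tree" where
  "enc_nat 0 = Leaf"
| "enc_nat (Suc n) = Node Leaf (enc_nat n)"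

fun enc_list :: "('a \<Rightarrow> tree) \<Rightarrow> 'a list \<Rightarrow> tree" where
  "enc_list enc [] = Leaf"
| "enc_list enc (x # xs) = Node (enc x) (enc_list enc xs)"

definition computable :: "(nat \<Rightarrow> nat) \<Rightarrow> bool" where
  "computable f \<longleftrightarrow> (\<exists>P. \<forall>n. \<exists>t. run P (enc_nat n) t (enc_nat (f n)))"


section \<open>Parameterized problems and the W-hierarchy\<close>

text \<open>A parameterized problem is a set of pairs of an input and its parameter.\<close>

type_synonym pproblem = "(tree \<times> nat) set"

text \<open>
  \<open>fpt_reducible Q I L\<close>: a parameterized reduction from \<open>Q\<close> to the problem \<open>L\<close> restricted to the
  instances in \<open>I\<close>, that is, one all of whose outputs lie in \<open>I\<close>.
\<close>

definition fpt_reducible :: "pproblem \<Rightarrow> pproblem \<Rightarrow> pproblem \<Rightarrow> bool" where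
  "fpt_reducible Q I L \<longleftrightarrow>
     (\<exists>P f g a. computable f \<and> computable g \<and>
       (\<forall>x k. \<exists>t x' k'.
          run P (Node x (enc_nat k)) t (Node x' (enc_nat k')) \<and>
          t \<le> f k * tsize x ^ a \<and>
          k' \<le> g k \<and>
          (x', k') \<in> I \<and>
          ((x, k) \<in> Q \<longleftrightarrow> (x', k') \<in> L)))"

text \<open>
  Boolean circuits are given as the list of their nodes in a topological order; a node refers to its
  in-neighbours by their positions, and the last node is the output.
\<close>

datatype gate = GInput | GNot nat | GAnd "nat list" | GOr "nat list"

type_synonym circuit = "gate list"

fun in_nbrs :: "gate \<Rightarrow> nat list" where
  "in_nbrs GInput = []"
| "in_nbrs (GNot j) = [j]"
| "in_nbrs (GAnd js) = js"
| "in_nbrs (GOr js) = js"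

fun fan_in_ok :: "gate \<Rightarrow> bool" where
  "fan_in_ok (GAnd js) \<longleftrightarrow> 2 \<le> length js"
| "fan_in_ok (GOr js) \<longleftrightarrow> 2 \<le> length js"
| "fan_in_ok _ \<longleftrightarrow> True"

definition is_circuit :: "circuit \<Rightarrow> bool" where
  "is_circuit C \<longleftrightarrow> C \<noteq> [] \<and>
     (\<forall>i < length C. distinct (in_nbrs (C ! i)) \<and> set (in_nbrs (C ! i)) \<subseteq> {..<i} \<and>
        fan_in_ok (C ! i))"

definition circuit_inputs :: "circuit \<Rightarrow> nat set" where
  "circuit_inputs C = {i. i < length C \<and> C ! i = GInput}"

definition circuit_output :: "circuit \<Rightarrow> nat" where
  "circuit_output C = length C - 1"

fun gate_value :: "bool \<Rightarrow> (nat \<Rightarrow> bool) \<Rightarrow> gate \<Rightarrow> bool" where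
  "gate_value b v GInput \<longleftrightarrow> b"
| "gate_value b v (GNot j) \<longleftrightarrow> \<not> v j"
| "gate_value b v (GAnd js) \<longleftrightarrow> (\<forall>j\<in>set js. v j)"
| "gate_value b v (GOr js) \<longleftrightarrow> (\<exists>j\<in>set js. v j)"

text \<open>
  The set \<open>A\<close> is the set of input nodes assigned true. As the circuit is acyclic, the values of its
  nodes \<open>v\<close> are determined by \<open>A\<close>.
\<close>

definition circuit_satisfied :: "circuit \<Rightarrow> nat set \<Rightarrow> bool" where
  "circuit_satisfied C A \<longleftrightarrow>
     (\<exists>v. (\<forall>i < length C. v i = gate_value (i \<in> A) v (C ! i)) \<and> v (circuit_output C))"

definition circuit_paths :: "circuit \<Rightarrow> nat list set" where
  "circuit_paths C =
     {p. p \<noteq> [] \<and> set p \<subseteq> {..<length C} \<and> hd p \<in> circuit_inputs C \<and> last p = circuit_output C \<and>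
         (\<forall>i. Suc i < length p \<longrightarrow> p ! i \<in> set (in_nbrs (C ! (p ! Suc i))))}"

definition depth :: "circuit \<Rightarrow> nat" where
  "depth C = Max ((\<lambda>p. length p - 1) ` circuit_paths C)"

definition large :: "gate \<Rightarrow> bool" where
  "large g \<longleftrightarrow> 2 < length (in_nbrs g)"

definition weft :: "circuit \<Rightarrow> nat" where
  "weft C = Max ((\<lambda>p. length (filter (\<lambda>i. large (C ! i)) p)) ` circuit_paths C)"

fun enc_gate :: "gate \<Rightarrow> tree" where
  "enc_gate GInput = Node (enc_nat 0) Leaf"
| "enc_gate (GNot j) = Node (enc_nat 1) (enc_nat j)"
| "enc_gate (GAnd js) = Node (enc_nat 2) (enc_list enc_nat js)"
| "enc_gate (GOr js) = Node (enc_nat 3) (enc_list enc_nat js)"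

text \<open>Weighted circuit satisfiability for circuits of weft at most \<open>w\<close> and depth at most \<open>d\<close>.\<close>

definition WCS_instances :: "nat \<Rightarrow> nat \<Rightarrow> pproblem" where
  "WCS_instances w d =
     {(enc_list enc_gate C, k) | C k. is_circuit C \<and> weft C \<le> w \<and> depth C \<le> d}"

definition WCS :: pproblem where
  "WCS =
     {(enc_list enc_gate C, k) | C k. is_circuit C \<and>
        (\<exists>A \<subseteq> circuit_inputs C. card A = k \<and> circuit_satisfied C A)}"

definition W_class :: "nat \<Rightarrow> pproblem set" where
  "W_class w = {Q. \<exists>d. fpt_reducible Q (WCS_instances w d) WCS}"

text \<open>The problem \<open>L\<close> is W[\<open>w\<close>]-hard even when restricted to the instances in \<open>I\<close>.\<close>

definition W_hard_on :: "nat \<Rightarrow> pproblem \<Rightarrow> pproblem \<Rightarrow> bool" where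
  "W_hard_on w I L \<longleftrightarrow> (\<forall>Q \<in> W_class w. fpt_reducible Q I L)"


section \<open>Colored graphs and Colored Path Deletion\<close>

record 'v cgraph =
  verts :: "'v set"
  edges :: "'v set set"
  color :: "'v set \<Rightarrow> nat"

text \<open>The color classes are the sets of edges of color \<open>i\<close> for \<open>1 \<le> i \<le> c\<close>; all are non-empty.\<close>

definition colored_graph :: "nat \<Rightarrow> 'v cgraph \<Rightarrow> bool" where
  "colored_graph c G \<longleftrightarrow>
     finite (verts G) \<and>
     (\<forall>e \<in> edges G. e \<subseteq> verts G \<and> card e = 2) \<and>
     color G ` edges G = {1..c}"

definition delete_edges :: "'v cgraph \<Rightarrow> 'v set set \<Rightarrow> 'v cgraph" where
  "delete_edges G S = G\<lparr>edges := edges G - S\<rparr>"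

text \<open>A subgraph is a pair of a vertex set and an edge set.\<close>

type_synonym 'v subgraph = "'v set \<times> 'v set set"

definition path_edges :: "'v list \<Rightarrow> 'v set set" where
  "path_edges p = {{p ! i, p ! Suc i} | i. Suc i < length p}"

definition path_graph :: "'v list \<Rightarrow> 'v subgraph" where
  "path_graph p = (set p, path_edges p)"

text \<open>The subgraphs of \<open>G\<close> that are \<open>c\<close>-colored paths on \<open>l\<close> vertices.\<close>

definition colored_paths :: "'v cgraph \<Rightarrow> nat \<Rightarrow> nat \<Rightarrow> 'v subgraph set" where
  "colored_paths G c l =
     {path_graph p | p. distinct p \<and> length p = l \<and> set p \<subseteq> verts G \<and> path_edges p \<subseteq> edges G \<and>
        card (color G ` path_edges p) = c}"

definition induced_in :: "'v cgraph \<Rightarrow> 'v subgraph \<Rightarrow> bool" where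
  "induced_in G H \<longleftrightarrow> fst H \<subseteq> verts G \<and> snd H = {e \<in> edges G. e \<subseteq> fst H}"

definition induced_colored_paths :: "'v cgraph \<Rightarrow> nat \<Rightarrow> nat \<Rightarrow> 'v subgraph set" where
  "induced_colored_paths G c l = {H \<in> colored_paths G c l. induced_in G H}"

definition conflict_edges :: "'v cgraph \<Rightarrow> nat \<Rightarrow> nat \<Rightarrow> 'v set set" where
  "conflict_edges G c l = (\<Union>H \<in> induced_colored_paths G c l. snd H)"

definition non_cascading :: "'v cgraph \<Rightarrow> nat \<Rightarrow> nat \<Rightarrow> bool" where
  "non_cascading G c l \<longleftrightarrow>
     (\<forall>H \<in> colored_paths G c l. \<not> induced_in G H \<longrightarrow>
        (\<forall>X' \<subseteq> conflict_edges G c l. \<not> induced_in (delete_edges G X') H))"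

definition path_deletion_solvable :: "'v cgraph \<Rightarrow> nat \<Rightarrow> nat \<Rightarrow> nat \<Rightarrow> bool" where
  "path_deletion_solvable G c l k \<longleftrightarrow>
     (\<exists>S \<subseteq> edges G. card S \<le> k \<and> induced_colored_paths (delete_edges G S) c l = {})"

text \<open>
  The tree \<open>x\<close> encodes \<open>G\<close>, \<open>c\<close> and \<open>l\<close> if it consists of the number \<open>n\<close> of vertices, a repetition-free
  list of the edges with their colors, in any order and orientation, and the numbers \<open>c\<close> and \<open>l\<close>.
\<close>

definition enc_edge :: "nat \<times> nat \<times> nat \<Rightarrow> tree" where
  "enc_edge = (\<lambda>(u, v, i). Node (enc_nat u) (Node (enc_nat v) (enc_nat i)))"

definition encodes :: "tree \<Rightarrow> nat cgraph \<Rightarrow> nat \<Rightarrow> nat \<Rightarrow> bool" where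
  "encodes x G c l \<longleftrightarrow>
     (\<exists>n es.
        x = Node (enc_nat n) (Node (enc_list enc_edge es) (Node (enc_nat c) (enc_nat l))) \<and>
        verts G = {..<n} \<and>
        distinct (map (\<lambda>(u, v, i). {u, v}) es) \<and>
        edges G = (\<lambda>(u, v, i). {u, v}) ` set es \<and>
        (\<forall>(u, v, i) \<in> set es. color G {u, v} = i))"

type_synonym cpd_instance = "nat cgraph \<times> nat \<times> nat \<times> nat"

definition CPD_encodings :: "cpd_instance set \<Rightarrow> pproblem" where
  "CPD_encodings R = {(x, k). \<exists>G c l. (G, c, l, k) \<in> R \<and> encodes x G c l}"

definition CPD :: pproblem where
  "CPD = CPD_encodings {(G, c, l, k). colored_graph c G \<and> path_deletion_solvable G c l k}"

text \<open>
  One polynomial-time program lists, on every encoding of an instance in \<open>R\<close>, all induced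
  \<open>c\<close>-colored paths on \<open>l\<close> vertices of the input graph without repetition, each as a vertex sequence.
\<close>

definition paths_enumerable_in_poly_time :: "cpd_instance set \<Rightarrow> bool" where
  "paths_enumerable_in_poly_time R \<longleftrightarrow>
     (\<exists>P a b. \<forall>(G, c, l, k) \<in> R. \<forall>x. encodes x G c l \<longrightarrow>
        (\<exists>t ps. run P x t (enc_list (enc_list enc_nat) ps) \<and>
           t \<le> b * tsize x ^ a \<and>
           distinct (map path_graph ps) \<and>
           path_graph ` set ps = induced_colored_paths G c l \<and>
           (\<forall>p \<in> set ps. distinct p)))"

end

theory Submission
  imports Defs
begin

text \<open>
  Unfolding a circuit of constant depth and weft two gives, in polynomial time, an OR of ANDs of DNFs
  whose terms have constant width: gates of fan-in two multiply out, and every large gate on a path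
  uses up one of the two unbounded levels. A choice of \<open>k\<close> true inputs is coded by its
  \<open>k + 1\<close> gaps, so that a literal of either sign is witnessed by one gap and a term of width \<open>w\<close> by a
  \<open>w\<close>-tuple of gaps. Choosing a disjunct and, consistently, a value for each of the \<open>(k + 1)\<^sup>w\<close> tuples of
  gap numbers is a hitting set problem with parameter \<open>(k + 1)\<^sup>w\<close>.

  A hitting set instance becomes a graph with one path per set, all paths having the same length and
  sharing one edge per element. Private vertices of different paths are completely joined; no
  long induced path can then leave its row, neither before nor after the deletion of conflict edges.
\<close>

section \<open>Polynomial-time functions\<close>

text \<open>The obstacle is that a row of a hitting set instance is a bare disjunction of elements:
  it can express neither that an input is false, nor that several literals hold together, nor that
  two choices agree. The first two are why the elements are tuples of gaps rather than inputs. For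
  the third, the budget equals the number of tuples of gap numbers, and each of these must receive
  an element, so each receives exactly one. That \<open>e\<close> is not chosen is then said
  positively: an element incompatible with \<open>e\<close> is chosen in its place. Every element
  names its disjunct, so the outermost OR is settled by consistency, and the demands of the other
  disjuncts are met for free. Two dangers remain on the graph side. A solution might delete private
  edges; each row is therefore repeated more often than the budget allows deletions. An induced path
  might cross rows; the chords would leave it at most four private vertices, while its length of at
  least fifteen enforces five. All exponents depend only on the depth, a constant, so the passage
  from circuits to graphs is polynomial in input and parameter together.\<close>

definition poly_bounded :: "(nat \<Rightarrow> nat) \<Rightarrow> bool" where
  "poly_bounded h \<longleftrightarrow> (\<exists>c. \<forall>s. h s \<le> (s + 2) ^ c)"

named_theorems pb_intros

text \<open>The base \<open>s + 2\<close> is at least 2 even for \<open>s = 0\<close>, so a constant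
  is absorbed by the exponent alone and no separate coefficient has to be carried along.\<close>

lemma pb_const [pb_intros]: "poly_bounded (\<lambda>s. b)"
proof -
  have "b \<le> (s + 2) ^ b" for s
  proof -
    have "b \<le> 2 ^ b" by (simp add: less_imp_le)
    also have "\<dots> \<le> (s + 2) ^ b" by (intro power_mono) auto
    finally show ?thesis .
  qed
  then show ?thesis unfolding poly_bounded_def by blast
qed

lemma pb_id [pb_intros]: "poly_bounded (\<lambda>s. s)"
  unfolding poly_bounded_def by (rule exI[of _ 1]) simp

lemma pb_mult [pb_intros]:
  assumes "poly_bounded f" "poly_bounded g"
  shows "poly_bounded (\<lambda>s. f s * g s)"
proof -
  obtain c d where "\<And>s. f s \<le> (s + 2) ^ c" "\<And>s. g s \<le> (s + 2) ^ d"
    using assms unfolding poly_bounded_def by blast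
  then have "f s * g s \<le> (s + 2) ^ (c + d)" for s
    unfolding power_add by (intro mult_mono) auto
  then show ?thesis unfolding poly_bounded_def by blast
qed

lemma pb_mono:
  assumes "poly_bounded g" "\<And>s. f s \<le> g s"
  shows "poly_bounded f"
  using assms unfolding poly_bounded_def by (meson order_trans)

text \<open>By \<open>f s + g s \<le> (f s + 1) * (g s + 1)\<close> sums reduce to products; only
  the increment by one needs an argument, and doubling a power of \<open>s + 2\<close> costs one
  more in the exponent.\<close>

lemma pb_add [pb_intros]:
  assumes "poly_bounded f" "poly_bounded g"
  shows "poly_bounded (\<lambda>s. f s + g s)"
proof (rule pb_mono)
  have "poly_bounded (\<lambda>s. f s + 1)" if f: "poly_bounded f" for f
  proof -
    obtain c where c: "\<And>s. f s \<le> (s + 2) ^ c" using f unfolding poly_bounded_def by blast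
    have "f s + 1 \<le> (s + 2) ^ Suc c" for s
    proof -
      have "f s + 1 \<le> (s + 2) ^ c + (s + 2) ^ c"
        using c[of s] by (intro add_mono) auto
      also have "\<dots> \<le> (s + 2) ^ Suc c" by simp
      finally show ?thesis .
    qed
    then show ?thesis unfolding poly_bounded_def by blast
  qed
  then show "poly_bounded (\<lambda>s. (f s + 1) * (g s + 1))"
    using assms by (intro pb_mult)
qed simp

lemma pb_power [pb_intros]: "poly_bounded f \<Longrightarrow> poly_bounded (\<lambda>s. f s ^ n)"
  by (induction n) (auto intro: pb_intros)

section \<open>Encoding of values by trees\<close>

class enc =
  fixes enc :: "'a \<Rightarrow> tree"
  assumes enc_inject: "enc x = enc y \<Longrightarrow> x = y"

lemma enc_nat_inject: "enc_nat m = enc_nat n \<Longrightarrow> m = n"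
proof (induction m arbitrary: n)
  case 0
  then show ?case by (cases n) auto
next
  case (Suc m)
  then show ?case by (cases n) auto
qed

lemma enc_list_inject:
  assumes "\<And>x y. e x = e y \<Longrightarrow> x = y"
  shows "enc_list e xs = enc_list e ys \<Longrightarrow> xs = ys"
proof (induction xs arbitrary: ys)
  case Nil
  then show ?case by (cases ys) auto
next
  case (Cons x xs)
  then show ?case using assms by (cases ys) auto
qed

instantiation unit :: enc
begin
definition "enc (x :: unit) = Leaf"
instance by standard simp
end

instantiation bool :: enc
begin
definition "enc b = (if b then Node Leaf Leaf else Leaf)"
instance by standard (simp add: enc_bool_def split: if_splits)
end

instantiation nat :: enc
begin
definition "enc = enc_nat"
instance by standard (simp add: enc_nat_def enc_nat_inject)
end

instantiation prod :: (enc, enc) enc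
begin
definition "enc p = Node (enc (fst p)) (enc (snd p))"
instance by standard (auto simp: enc_prod_def prod_eq_iff dest: enc_inject)
end

instantiation list :: (enc) enc
begin
definition "enc xs = enc_list enc xs"
instance by standard (simp add: enc_list_def enc_list_inject[OF enc_inject])
end

instantiation gate :: enc
begin
definition "enc = enc_gate"
instance
proof
  fix g h :: gate
  have "enc_list enc_nat xs = enc_list enc_nat ys \<Longrightarrow> xs = ys" for xs ys
    by (rule enc_list_inject[OF enc_nat_inject])
  then show "enc g = enc h \<Longrightarrow> g = h"
    by (cases g; cases h) (auto simp: enc_gate_def numeral_eq_Suc dest: enc_nat_inject)
qed
end

lemma enc_simps [simp]:
  "enc () = Leaf"
  "enc True = Node Leaf Leaf"
  "enc False = Leaf"
  "enc (0 :: nat) = Leaf"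
  "enc (Suc n) = Node Leaf (enc n)"
  "enc (a, b) = Node (enc a) (enc b)"
  "enc [] = Leaf"
  "enc (x # xs) = Node (enc x) (enc xs)"
  by (simp_all add: enc_unit_def enc_bool_def enc_nat_def enc_prod_def enc_list_def)

lemma enc_nat_eq: "enc_nat = enc"
  by (simp add: enc_nat_def)

lemma enc_gate_eq: "enc_gate = enc"
  by (simp add: enc_gate_def)

lemma enc_list_eq: "enc_list enc = enc"
  by (rule ext) (simp add: enc_list_def)

lemma enc_edge_eq: "enc_edge = enc"
  by (auto simp: enc_edge_def enc_nat_def)

lemma tsize_mem: "x \<in> set xs \<Longrightarrow> tsize (enc x) \<le> tsize (enc xs)"
  by (induction xs) auto

lemma length_le_tsize: "length xs \<le> tsize (enc xs)"
  by (induction xs) auto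

text \<open>Complexity becomes a property of functions on encodable types, so that later
  constructions are ordinary functions and \<open>intro pt_intros\<close> replaces writing programs.
  A function of several arguments is taken as a function of a tuple; in the rules for binders, such
  as \<open>pt_map\<close>, the first component is the environment.\<close>

definition polytime :: "('a::enc \<Rightarrow> 'b::enc) \<Rightarrow> bool" where
  "polytime f \<longleftrightarrow>
     (\<exists>P h. poly_bounded h \<and> (\<forall>x. \<exists>t. run P (enc x) t (enc (f x)) \<and> t \<le> h (tsize (enc x))))"

lemma polytimeI:
  assumes "\<And>x. \<exists>t. run P (enc x) t (enc (f x)) \<and> t \<le> h (tsize (enc x))" "poly_bounded h"
  shows "polytime f"
  using assms unfolding polytime_def by blast

lemma polytime_run:
  assumes "polytime f"
  shows "\<exists>P c. \<forall>x. \<exists>t. run P (enc x) t (enc (f x)) \<and> t \<le> (tsize (enc x) + 2) ^ c"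
  using assms unfolding polytime_def poly_bounded_def by (meson order_trans)

lemma polytime_size:
  assumes "polytime f"
  shows "\<exists>c. \<forall>x. tsize (enc (f x)) \<le> (tsize (enc x) + 2) ^ c"
  using polytime_run[OF assms] by (meson tsize_le_cost order_trans)

named_theorems pt_intros

lemma pt_recode:
  assumes "polytime f" "\<And>x. enc (g x) = enc (f x)"
  shows "polytime g"
  using assms unfolding polytime_def by simp

lemma pt_id [pt_intros]: "polytime (\<lambda>x. x)"
  by (rule polytimeI[where P = PId and h = "\<lambda>s. s"]) (auto intro: run_Id pb_intros)

lemma pt_comp:
  assumes "polytime f" "polytime g"
  shows "polytime (\<lambda>x. f (g x))"
proof -
  obtain P c where P: "\<And>x. \<exists>t. run P (enc x) t (enc (f x)) \<and> t \<le> (tsize (enc x) + 2) ^ c"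
    using polytime_run[OF assms(1)] by blast
  obtain Q d where Q: "\<And>x. \<exists>t. run Q (enc x) t (enc (g x)) \<and> t \<le> (tsize (enc x) + 2) ^ d"
    using polytime_run[OF assms(2)] by blast
  show ?thesis
  proof (rule polytimeI)
    fix x
    obtain t where t: "run Q (enc x) t (enc (g x))" "t \<le> (tsize (enc x) + 2) ^ d"
      using Q by blast
    obtain u where u: "run P (enc (g x)) u (enc (f (g x)))" "u \<le> (tsize (enc (g x)) + 2) ^ c"
      using P by blast
    have "u \<le> ((tsize (enc x) + 2) ^ d + 2) ^ c"
      using u(2) t tsize_le_cost[OF t(1)] by (meson add_mono order_refl order_trans power_mono zero_le)
    then show "\<exists>t. run (PComp Q P) (enc x) t (enc (f (g x))) \<and>
        t \<le> (tsize (enc x) + 2) ^ d + ((tsize (enc x) + 2) ^ d + 2) ^ c"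
      using run_Comp[OF t(1) u(1)] t(2) by (meson add_mono)
  qed (intro pb_intros)
qed

lemma pt_Node:
  assumes "polytime a" "polytime b" "\<And>x. enc (f x) = Node (enc (a x)) (enc (b x))"
  shows "polytime f"
proof -
  obtain P c where P: "\<And>x. \<exists>t. run P (enc x) t (enc (a x)) \<and> t \<le> (tsize (enc x) + 2) ^ c"
    using polytime_run[OF assms(1)] by blast
  obtain Q d where Q: "\<And>x. \<exists>t. run Q (enc x) t (enc (b x)) \<and> t \<le> (tsize (enc x) + 2) ^ d"
    using polytime_run[OF assms(2)] by blast
  show ?thesis
  proof (rule polytimeI)
    fix x
    show "\<exists>t. run (PCons P Q) (enc x) t (enc (f x)) \<and>
        t \<le> (tsize (enc x) + 2) ^ c + (tsize (enc x) + 2) ^ d + 1"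
      unfolding assms(3) using P[of x] Q[of x] by (meson add_mono order_refl run_Cons)
  qed (intro pb_intros)
qed

lemma pt_Leaf:
  assumes "\<And>x. enc (f x) = Leaf"
  shows "polytime f"
  by (rule polytimeI[where P = PNil and h = "\<lambda>s. s"]) (auto simp: assms intro: run_Nil pb_intros)

lemma pt_Pair [pt_intros]: "polytime a \<Longrightarrow> polytime b \<Longrightarrow> polytime (\<lambda>x. (a x, b x))"
  by (erule pt_Node) auto

lemma pt_Cons [pt_intros]: "polytime a \<Longrightarrow> polytime b \<Longrightarrow> polytime (\<lambda>x. a x # b x)"
  by (erule pt_Node) auto

lemma pt_Suc [pt_intros]: "polytime a \<Longrightarrow> polytime (\<lambda>x. Suc (a x))"
  by (rule pt_Node[where a = "\<lambda>x. ()"]) (auto intro: pt_Leaf)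

text \<open>The idle steps \<open>PId\<close> pad the cost to exactly this expression, so the
  induction runs with an equation instead of a bound.\<close>

lemma const_run: "\<exists>P. \<forall>x. run P x (tsize x * (2 * tsize y) + tsize y) y"
proof (induction y)
  case Leaf
  have "run (PComp PId (PComp PNil PNil)) x (tsize x + (tsize x + 1)) Leaf" for x
    using run_Comp[OF run_Id[of x] run_Comp[OF run_Nil[of x] run_Nil[of Leaf]]] by simp
  then show ?case by (intro exI[of _ "PComp PId (PComp PNil PNil)"]) (simp add: algebra_simps)
next
  case (Node y z)
  then obtain P Q where "\<And>x. run P x (tsize x * (2 * tsize y) + tsize y) y"
    "\<And>x. run Q x (tsize x * (2 * tsize z) + tsize z) z" by blast
  then have "run (PCons P Q) x (tsize x * (2 * tsize y) + tsize y + (tsize x * (2 * tsize z) + tsize z) + 1) (Node y z)" for x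
    by (intro run_Cons)
  then have "run (PComp PId (PComp PId (PCons P Q))) x (tsize x + (tsize x + (tsize x * (2 * tsize y) + tsize y + (tsize x * (2 * tsize z) + tsize z) + 1))) (Node y z)" for x
    using run_Comp[OF run_Id run_Comp[OF run_Id]] by blast
  then show ?case
    by (intro exI[of _ "PComp PId (PComp PId (PCons P Q))"]) (simp add: algebra_simps)
qed

lemma pt_const [pt_intros]: "polytime (\<lambda>x. y)"
proof -
  obtain P where "\<And>x. run P x (tsize x * (2 * tsize (enc y)) + tsize (enc y)) (enc y)"
    using const_run by blast
  then show ?thesis
    by (intro polytimeI[where P = P and h = "\<lambda>s. s * (2 * tsize (enc y)) + tsize (enc y)"]) (auto intro!: pb_intros)
qed

lemma pt_fst0: "polytime fst"
proof (rule polytimeI[where P = PHd and h = "\<lambda>s. s"])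
  fix x :: "'a \<times> 'b"
  show "\<exists>t. run PHd (enc x) t (enc (fst x)) \<and> t \<le> tsize (enc x)"
    using run_Hd[of "enc x"] by (cases x) auto
qed (intro pb_intros)

lemma pt_snd0: "polytime snd"
proof (rule polytimeI[where P = PTl and h = "\<lambda>s. s"])
  fix x :: "'a \<times> 'b"
  show "\<exists>t. run PTl (enc x) t (enc (snd x)) \<and> t \<le> tsize (enc x)"
    using run_Tl[of "enc x"] by (cases x) auto
qed (intro pb_intros)

lemmas pt_fst [pt_intros] = pt_comp[OF pt_fst0]
lemmas pt_snd [pt_intros] = pt_comp[OF pt_snd0]

lemma pt_tl0: "polytime tl"
proof (rule polytimeI[where P = PTl and h = "\<lambda>s. s"])
  fix x :: "'a list"
  show "\<exists>t. run PTl (enc x) t (enc (tl x)) \<and> t \<le> tsize (enc x)"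
    using run_Tl[of "enc x"] by (cases x) auto
qed (intro pb_intros)

lemmas pt_tl [pt_intros] = pt_comp[OF pt_tl0]

text \<open>The test looks at the tree and not at a boolean, so it also separates the empty list,
  whose tree is \<open>Leaf\<close>, from all other lists.\<close>

lemma pt_branch:
  assumes "polytime b" "polytime f" "polytime g"
    "\<And>x. enc (h x) = (if enc (b x) \<noteq> Leaf then enc (f x) else enc (g x))"
  shows "polytime h"
proof -
  obtain B c where B: "\<And>x. \<exists>t. run B (enc x) t (enc (b x)) \<and> t \<le> (tsize (enc x) + 2) ^ c"
    using polytime_run[OF assms(1)] by blast
  obtain P d where P: "\<And>x. \<exists>t. run P (enc x) t (enc (f x)) \<and> t \<le> (tsize (enc x) + 2) ^ d"
    using polytime_run[OF assms(2)] by blast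
  obtain Q e where Q: "\<And>x. \<exists>t. run Q (enc x) t (enc (g x)) \<and> t \<le> (tsize (enc x) + 2) ^ e"
    using polytime_run[OF assms(3)] by blast
  show ?thesis
  proof (rule polytimeI)
    fix x
    obtain t where t: "run B (enc x) t (enc (b x))" "t \<le> (tsize (enc x) + 2) ^ c" using B by blast
    obtain u where u: "run P (enc x) u (enc (f x))" "u \<le> (tsize (enc x) + 2) ^ d" using P by blast
    obtain v where v: "run Q (enc x) v (enc (g x))" "v \<le> (tsize (enc x) + 2) ^ e" using Q by blast
    show "\<exists>t. run (PIf B P Q) (enc x) t (enc (h x)) \<and>
        t \<le> (tsize (enc x) + 2) ^ c + (tsize (enc x) + 2) ^ d + (tsize (enc x) + 2) ^ e"
    proof (cases "enc (b x) = Leaf")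
      case True
      then show ?thesis using run_If_false[OF t(1) True v(1), of P] t v assms(4)[of x] by force
    next
      case False
      then show ?thesis using run_If_true[OF t(1) False u(1), of Q] t u assms(4)[of x] by force
    qed
  qed (intro pb_intros)
qed

lemma pt_if [pt_intros]:
  "polytime b \<Longrightarrow> polytime f \<Longrightarrow> polytime g \<Longrightarrow> polytime (\<lambda>x. if b x then f x else g x)"
  by (rule pt_branch[of b f g]) (auto simp: enc_bool_def)

lemma pt_case_prod [pt_intros]:
  assumes "polytime (\<lambda>x. f x (fst (e x)) (snd (e x)))"
  shows "polytime (\<lambda>x. case e x of (u, v) \<Rightarrow> f x u v)"
  using assms by (simp add: case_prod_beta)

text \<open>A non-empty list and the pair of its head and tail have the same tree, so pairing the
  input with the value of \<open>e\<close> already yields the argument of the second branch.\<close>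

lemma pt_case_list [pt_intros]:
  assumes e: "polytime e" and a: "polytime a"
    and b: "polytime (\<lambda>z. b (fst z) (fst (snd z)) (snd (snd z)))"
  shows "polytime (\<lambda>x. case e x of [] \<Rightarrow> a x | y # ys \<Rightarrow> b x y ys)"
proof -
  obtain E c where E: "\<And>x. \<exists>t. run E (enc x) t (enc (e x)) \<and> t \<le> (tsize (enc x) + 2) ^ c"
    using polytime_run[OF e] by blast
  obtain P d where P: "\<And>x. \<exists>t. run P (enc x) t (enc (a x)) \<and> t \<le> (tsize (enc x) + 2) ^ d"
    using polytime_run[OF a] by blast
  obtain Q f where Q: "\<And>x. \<exists>t. run Q (enc x) t (enc (b (fst x) (fst (snd x)) (snd (snd x))))
      \<and> t \<le> (tsize (enc x) + 2) ^ f"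
    using polytime_run[OF b] by blast
  show ?thesis
  proof (rule polytimeI)
    fix x
    obtain t where t: "run E (enc x) t (enc (e x))" "t \<le> (tsize (enc x) + 2) ^ c" using E by blast
    obtain u where u: "run P (enc x) u (enc (a x))" "u \<le> (tsize (enc x) + 2) ^ d" using P by blast
    let ?s = "tsize (enc x)"
    show "\<exists>t. run (PIf E (PComp (PCons PId E) Q) P) (enc x) t
           (enc (case e x of [] \<Rightarrow> a x | y # ys \<Rightarrow> b x y ys)) \<and>
        t \<le> (?s + 2) ^ c + (?s + 2) ^ d + (?s + (?s + 2) ^ c + 1 + (?s + (?s + 2) ^ c + 1 + 2) ^ f)"
    proof (cases "e x")
      case Nil
      then show ?thesis using run_If_false[OF t(1) _ u(1), of "PComp (PCons PId E) Q"] t u by force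
    next
      case (Cons y ys)
      obtain v where v: "run Q (Node (enc x) (enc (e x))) v (enc (b x y ys))"
        "v \<le> (tsize (Node (enc x) (enc (e x))) + 2) ^ f"
        using Q[of "(x, y, ys)"] Cons by auto
      have 1: "run (PComp (PCons PId E) Q) (enc x) (?s + t + 1 + v) (enc (b x y ys))"
        by (rule run_Comp[OF run_Cons[OF run_Id t(1)] v(1)])
      have "tsize (Node (enc x) (enc (e x))) + 2 \<le> ?s + (?s + 2) ^ c + 1 + 2"
        using tsize_le_cost[OF t(1)] t(2) by simp
      then have "v \<le> (?s + (?s + 2) ^ c + 1 + 2) ^ f"
        using v(2) power_mono order_trans by blast
      then show ?thesis using run_If_true[OF t(1) _ 1, of P] Cons t(2) by (force simp: add_ac)
    qed
  qed (intro pb_intros)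
qed

section \<open>Loops over lists\<close>

lemma run_Hd_Node: "run PHd (Node x y) (tsize (Node x y)) x"
  using run_Hd[of "Node x y"] by simp

lemma run_Tl_Node: "run PTl (Node x y) (tsize (Node x y)) y"
  using run_Tl[of "Node x y"] by simp

text \<open>The loop state is the tree of environment, remaining list and accumulator.
  \<open>S\<close> receives the environment, the head of the list and the accumulator, and returns
  the new accumulator.\<close>

definition fold_body :: "prog \<Rightarrow> prog" where
  "fold_body S = PCons PHd (PCons (PComp PTl (PComp PHd PTl))
     (PComp (PCons PHd (PCons (PComp PTl (PComp PHd PHd)) (PComp PTl PTl))) S))"

lemma fold_body_run:
  assumes "run S (Node e (Node y acc)) t r"
  shows "\<exists>u. run (fold_body S) (Node e (Node (Node y ys) acc)) u (Node e (Node ys r)) \<and>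
    u \<le> t + 10 * tsize (Node e (Node (Node y ys) acc)) + 4"
  unfolding fold_body_def
  apply (rule exI, rule conjI)
   apply (rule run_Cons run_Comp run_Hd_Node run_Tl_Node assms)+
  apply simp
  done

text \<open>\<open>M\<close> has to dominate the accumulator after every prefix of the list, not
  only the final one. Test and rearrangement cost at most \<open>12 * M + 4\<close> per round, the
  step itself at most \<open>(M + 2) ^ c\<close>; \<open>Suc\<close> accounts for the last test,
  which fails.\<close>

lemma fold_run:
  fixes f :: "'x::enc \<Rightarrow> 'y::enc \<Rightarrow> 'a::enc \<Rightarrow> 'a"
  assumes S: "\<And>z. \<exists>t. run S (enc z) t (enc (f (fst z) (fst (snd z)) (snd (snd z)))) \<and>
      t \<le> (tsize (enc z) + 2) ^ c"
    and M: "\<And>i. tsize (enc x) + tsize (enc ys) + tsize (enc (fold (f x) (take i ys) acc)) + 2 \<le> M"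
  shows "\<exists>t. run (PWhile (PComp PTl PHd) (fold_body S)) (enc (x, ys, acc)) t
      (enc (x, [] :: 'y list, fold (f x) ys acc)) \<and>
    t \<le> Suc (length ys) * (12 * M + 4 + (M + 2) ^ c)"
  using M
proof (induction ys arbitrary: acc)
  case Nil
  have "run (PWhile (PComp PTl PHd) (fold_body S)) (enc (x, [] :: 'y list, acc))
     (tsize (enc (x, [] :: 'y list, acc)) + tsize (enc ([] :: 'y list, acc)) + tsize (enc (x, [] :: 'y list, acc)))
     (enc (x, [] :: 'y list, acc))"
    using run_While_false[OF run_Comp[OF run_Tl_Node[of "enc x" "Node Leaf (enc acc)"] run_Hd_Node]]
    by simp
  then show ?case using Nil[of 0] by (intro exI conjI) auto
next
  case (Cons y ys)
  let ?s = "Node (enc x) (Node (Node (enc y) (enc ys)) (enc acc))"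
  have s: "tsize ?s \<le> M" using Cons.prems[of 0] by simp
  obtain t where t: "run S (Node (enc x) (Node (enc y) (enc acc))) t (enc (f x y acc))"
    "t \<le> (tsize (Node (enc x) (Node (enc y) (enc acc))) + 2) ^ c"
    using S[of "(x, y, acc)"] by auto
  have "tsize (Node (enc x) (Node (enc y) (enc acc))) + 2 \<le> M + 2" using s by simp
  then have tM: "t \<le> (M + 2) ^ c" using t(2) power_mono order_trans by blast
  obtain u where u: "run (fold_body S) ?s u (Node (enc x) (Node (enc ys) (enc (f x y acc))))"
    "u \<le> t + 10 * tsize ?s + 4"
    using fold_body_run[OF t(1)] by blast
  have "tsize (enc x) + tsize (enc ys) + tsize (enc (fold (f x) (take i ys) (f x y acc))) + 2 \<le> M" for i
    using Cons.prems[of "Suc i"] by simp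
  then obtain v where v: "run (PWhile (PComp PTl PHd) (fold_body S)) (enc (x, ys, f x y acc)) v
      (enc (x, [] :: 'y list, fold (f x) ys (f x y acc)))"
      "v \<le> Suc (length ys) * (12 * M + 4 + (M + 2) ^ c)"
    using Cons.IH by blast
  have c: "run (PComp PTl PHd) ?s (tsize ?s + tsize (Node (Node (enc y) (enc ys)) (enc acc))) (Node (enc y) (enc ys))"
    by (rule run_Comp[OF run_Tl_Node run_Hd_Node])
  have "run (PWhile (PComp PTl PHd) (fold_body S)) ?s
      (tsize ?s + tsize (Node (Node (enc y) (enc ys)) (enc acc)) + u + v)
      (enc (x, [] :: 'y list, fold (f x) ys (f x y acc)))"
    by (rule run_While_true[OF c _ u(1)]) (use v(1) in simp_all)
  moreover have "tsize ?s + tsize (Node (Node (enc y) (enc ys)) (enc acc)) + u + v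
     \<le> 12 * M + 4 + (M + 2) ^ c + Suc (length ys) * (12 * M + 4 + (M + 2) ^ c)"
  proof -
    have "tsize (Node (Node (enc y) (enc ys)) (enc acc)) \<le> tsize ?s" by simp
    then show ?thesis using s u(2) tM v(2) by linarith
  qed
  ultimately show ?case by (intro exI conjI) auto
qed

text \<open>
  The size hypothesis is needed because iterating a polynomial-time step can square the size of the
  accumulator each time.
\<close>

lemma pt_fold:
  fixes f :: "'x::enc \<Rightarrow> 'y::enc \<Rightarrow> 'a::enc \<Rightarrow> 'a"
  assumes e: "polytime e" and a: "polytime a"
    and f: "polytime (\<lambda>z. f (fst z) (fst (snd z)) (snd (snd z)))"
    and g: "poly_bounded g"
      "\<And>x i. tsize (enc (fold (f x) (take i (e x)) (a x))) \<le> g (tsize (enc x))"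
  shows "polytime (\<lambda>x. fold (f x) (e x) (a x))"
proof -
  obtain c where c: "\<And>x. tsize (enc (e x)) \<le> (tsize (enc x) + 2) ^ c"
    using polytime_size[OF e] by blast
  obtain S d where S: "\<And>z. \<exists>t. run S (enc z) t (enc (f (fst z) (fst (snd z)) (snd (snd z)))) \<and>
      t \<le> (tsize (enc z) + 2) ^ d"
    using polytime_run[OF f] by blast
  obtain A q where A: "\<And>x. \<exists>t. run A (enc x) t (enc (x, e x, a x)) \<and> t \<le> (tsize (enc x) + 2) ^ q"
    using polytime_run[OF pt_Pair[OF pt_id pt_Pair[OF e a]]] by blast
  let ?W = "PWhile (PComp PTl PHd) (fold_body S)"
  let ?M = "\<lambda>s. s + (s + 2) ^ c + g s + 2"
  let ?h = "\<lambda>s. ((s + 2) ^ c + 1) * (12 * ?M s + 4 + (?M s + 2) ^ d)"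
  show ?thesis
  proof (rule polytimeI)
    fix x :: 'x
    let ?s = "tsize (enc x)"
    obtain t where t: "run A (enc x) t (enc (x, e x, a x))" "t \<le> (?s + 2) ^ q" using A by blast
    have "?s + tsize (enc (e x)) + tsize (enc (fold (f x) (take i (e x)) (a x))) + 2 \<le> ?M ?s" for i
      using c g(2) by (intro add_mono) auto
    then obtain u where u: "run ?W (enc (x, e x, a x)) u (enc (x, [] :: 'y list, fold (f x) (e x) (a x)))"
      "u \<le> Suc (length (e x)) * (12 * ?M ?s + 4 + (?M ?s + 2) ^ d)"
      using fold_run[where f = f, OF S] by blast
    have "Suc (length (e x)) \<le> (?s + 2) ^ c + 1"
      using c[of x] length_le_tsize[of "e x"] by simp
    then have hs: "u \<le> ?h ?s" using u(2) mult_le_mono1 order_trans by blast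
    have final: "run (PComp A (PComp ?W (PComp PTl PTl))) (enc x)
      (t + (u + (tsize (enc (x, [] :: 'y list, fold (f x) (e x) (a x))) +
         tsize (enc ([] :: 'y list, fold (f x) (e x) (a x)))))) (enc (fold (f x) (e x) (a x)))"
      using run_Comp[OF t(1) run_Comp[OF u(1)]] run_Comp[OF run_Tl_Node run_Tl_Node] by fastforce
    have "tsize (enc (x, [] :: 'y list, fold (f x) (e x) (a x))) \<le> u"
      using tsize_le_cost[OF u(1)] by blast
    moreover have "tsize (enc ([] :: 'y list, fold (f x) (e x) (a x))) \<le> tsize (enc (x, [] :: 'y list, fold (f x) (e x) (a x)))"
      by simp
    ultimately have "t + (u + (tsize (enc (x, [] :: 'y list, fold (f x) (e x) (a x))) +
         tsize (enc ([] :: 'y list, fold (f x) (e x) (a x))))) \<le> (?s + 2) ^ q + 3 * ?h ?s"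
      using t(2) hs by linarith
    then show "\<exists>t. run (PComp A (PComp ?W (PComp PTl PTl))) (enc x) t (enc (fold (f x) (e x) (a x))) \<and>
        t \<le> (?s + 2) ^ q + 3 * ?h ?s"
      using final by blast
  qed (intro pb_intros g(1))
qed

text \<open>If the growth in one step is bounded in terms of environment and list element alone, the
  increments add up to a polynomial. This covers most loops.\<close>

lemma pt_fold_additive:
  fixes f :: "'x::enc \<Rightarrow> 'y::enc \<Rightarrow> 'a::enc \<Rightarrow> 'a"
  assumes e: "polytime e" and a: "polytime a"
    and f: "polytime (\<lambda>z. f (fst z) (fst (snd z)) (snd (snd z)))"
    and g: "\<And>x y acc. tsize (enc (f x y acc)) \<le> tsize (enc acc) + (tsize (enc (x, y)) + 2) ^ g"
  shows "polytime (\<lambda>x. fold (f x) (e x) (a x))"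
proof -
  obtain c where c: "\<And>x. tsize (enc (e x)) \<le> (tsize (enc x) + 2) ^ c"
    using polytime_size[OF e] by blast
  obtain d where d: "\<And>x. tsize (enc (a x)) \<le> (tsize (enc x) + 2) ^ d"
    using polytime_size[OF a] by blast
  have 1: "tsize (enc (fold (f x) ys acc)) \<le> tsize (enc acc) + length ys * (tsize (enc x) + Z + 3) ^ g"
    if "\<And>y. y \<in> set ys \<Longrightarrow> tsize (enc y) \<le> Z" for x ys acc Z
    using that
  proof (induction ys arbitrary: acc)
    case (Cons y ys)
    have "tsize (enc (f x y acc)) \<le> tsize (enc acc) + (tsize (enc x) + Z + 3) ^ g"
    proof (rule order_trans[OF g])
      have "tsize (enc (x, y)) + 2 \<le> tsize (enc x) + Z + 3" using Cons.prems[of y] by simp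
      then show "tsize (enc acc) + (tsize (enc (x, y)) + 2) ^ g \<le> tsize (enc acc) + (tsize (enc x) + Z + 3) ^ g"
        using power_mono by (metis add_left_mono zero_le)
    qed
    then show ?case using Cons.IH[of "f x y acc"] Cons.prems by fastforce
  qed simp
  let ?g = "\<lambda>s. (s + 2) ^ d + (s + 2) ^ c * (s + (s + 2) ^ c + 3) ^ g"
  show ?thesis
  proof (rule pt_fold[OF e a f])
    fix x i
    have "tsize (enc y) \<le> (tsize (enc x) + 2) ^ c" if "y \<in> set (take i (e x))" for y
      using tsize_mem[of y "e x"] set_take_subset[of i "e x"] that c[of x] by fastforce
    then have "tsize (enc (fold (f x) (take i (e x)) (a x))) \<le>
      tsize (enc (a x)) + length (take i (e x)) * (tsize (enc x) + (tsize (enc x) + 2) ^ c + 3) ^ g"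
      by (rule 1)
    also have "\<dots> \<le> ?g (tsize (enc x))"
      using d[of x] c[of x] length_le_tsize[of "e x"] by (intro add_mono mult_mono) auto
    finally show "tsize (enc (fold (f x) (take i (e x)) (a x))) \<le> ?g (tsize (enc x))" .
  qed (intro pb_intros)
qed

section \<open>List operations and unary arithmetic\<close>

lemma pt_nat_to_units: "polytime e \<Longrightarrow> polytime (\<lambda>x. replicate (e x) ())"
proof (erule pt_recode)
  fix x
  have "enc (replicate n ()) = enc n" for n by (induction n) auto
  then show "enc (replicate (e x) ()) = enc (e x)" .
qed

text \<open>A number and the list of that many units have the same tree, so passing between them is
  free; sums, products, differences and comparisons below are computed on such lists.\<close>

lemma pt_units_to_nat:
  fixes e :: "'x::enc \<Rightarrow> unit list"
  assumes "polytime e"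
  shows "polytime (\<lambda>x. length (e x))"
  using assms
proof (rule pt_recode)
  fix x
  have "enc (length us) = enc us" for us :: "unit list" by (induction us) auto
  then show "enc (length (e x)) = enc (e x)" .
qed

lemma tsize_enc_append: "tsize (enc (xs @ ys)) + 1 = tsize (enc xs) + tsize (enc ys)"
  by (induction xs) auto

lemma pt_rev_append:
  assumes "polytime a" "polytime b"
  shows "polytime (\<lambda>x. rev (a x) @ b x)"
proof -
  have "polytime (\<lambda>x. fold Cons (a x) (b x))"
  proof (rule pt_fold_additive[where f = "\<lambda>x. Cons" and g = 1])
    show "polytime (\<lambda>z. fst (snd z) # snd (snd z))" by (intro pt_intros)
  qed (auto intro: assms)
  then show ?thesis by (simp add: fold_Cons_rev)
qed

lemma pt_rev [pt_intros]: "polytime a \<Longrightarrow> polytime (\<lambda>x. rev (a x))"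
  using pt_rev_append[OF _ pt_const, of a "[]"] by simp

lemma pt_append [pt_intros]: "polytime a \<Longrightarrow> polytime b \<Longrightarrow> polytime (\<lambda>x. a x @ b x)"
  using pt_rev_append[OF pt_rev] by fastforce

text \<open>The accumulator holds the output in reverse and grows in each step by the new piece
  only. \<open>map\<close>, \<open>filter\<close> and the bounded quantifiers are derived from this
  rule.\<close>

lemma pt_concat_map [pt_intros]:
  assumes e: "polytime e" and f: "polytime (\<lambda>z. f (fst z) (snd z))"
  shows "polytime (\<lambda>x. concat (map (f x) (e x)))"
proof -
  obtain c where c: "\<And>z. tsize (enc (f (fst z) (snd z))) \<le> (tsize (enc z) + 2) ^ c"
    using polytime_size[OF f] by blast
  have "polytime (\<lambda>x. fold (\<lambda>y acc. rev (f x y) @ acc) (e x) [])"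
  proof (rule pt_fold_additive[where f = "\<lambda>x y acc. rev (f x y) @ acc" and g = c])
    show "polytime (\<lambda>z. rev (f (fst z) (fst (snd z))) @ snd (snd z))"
      by (intro pt_intros pt_comp[OF f, of "\<lambda>z. (fst z, fst (snd z))", simplified])
    have "tsize (enc (rev xs)) = tsize (enc xs)" for xs :: "'c list"
    proof (induction xs)
      case (Cons x xs)
      then show ?case using tsize_enc_append[of "rev xs" "[x]"] by simp
    qed simp
    then show "tsize (enc (rev (f x y) @ acc)) \<le> tsize (enc acc) + (tsize (enc (x, y)) + 2) ^ c" for x y acc
      using tsize_enc_append[of "rev (f x y)" acc] c[of "(x, y)"] by simp
  qed (auto intro: e pt_intros)
  moreover have "fold (\<lambda>y acc. rev (f x y) @ acc) ys acc = rev (concat (map (f x) ys)) @ acc" for x ys acc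
    by (induction ys arbitrary: acc) auto
  ultimately have "polytime (\<lambda>x. rev (concat (map (f x) (e x))))" by simp
  from pt_rev[OF this] show ?thesis by (simp only: rev_rev_ident)
qed

lemma pt_concat [pt_intros]: "polytime e \<Longrightarrow> polytime (\<lambda>x. concat (e x))"
  using pt_concat_map[where f = "\<lambda>x y. y" and e = e] by (simp add: pt_snd pt_id)

lemma pt_map [pt_intros]:
  assumes "polytime e" "polytime (\<lambda>z. f (fst z) (snd z))"
  shows "polytime (\<lambda>x. map (f x) (e x))"
  using pt_concat_map[OF assms(1), where f = "\<lambda>x y. [f x y]"] assms(2)
  by (simp add: pt_Cons pt_const)

lemma pt_filter [pt_intros]:
  assumes "polytime e" "polytime (\<lambda>z. p (fst z) (snd z))"
  shows "polytime (\<lambda>x. filter (p x) (e x))"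
proof -
  have "polytime (\<lambda>x. concat (map (\<lambda>y. if p x y then [y] else []) (e x)))"
    by (intro pt_intros assms)
  moreover have "concat (map (\<lambda>y. if p x y then [y] else []) ys) = filter (p x) ys" for x ys
    by (induction ys) auto
  ultimately show ?thesis by simp
qed

lemma pt_null: "polytime e \<Longrightarrow> polytime (\<lambda>x. e x = [])"
  by (rule pt_branch[of e "\<lambda>x. False" "\<lambda>x. True"]) (auto intro: pt_const simp: neq_Nil_conv enc_bool_def)

lemma pt_not [pt_intros]: "polytime b \<Longrightarrow> polytime (\<lambda>x. \<not> b x)"
  by (rule pt_branch[of b "\<lambda>x. False" "\<lambda>x. True"]) (auto intro: pt_const simp: enc_bool_def)

lemma pt_conj [pt_intros]: "polytime a \<Longrightarrow> polytime b \<Longrightarrow> polytime (\<lambda>x. a x \<and> b x)"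
  by (rule pt_branch[of a b "\<lambda>x. False"]) (auto intro: pt_const simp: enc_bool_def)

lemma pt_disj [pt_intros]: "polytime a \<Longrightarrow> polytime b \<Longrightarrow> polytime (\<lambda>x. a x \<or> b x)"
  by (rule pt_branch[of a "\<lambda>x. True" b]) (auto intro: pt_const simp: enc_bool_def)

lemma pt_imp [pt_intros]: "polytime a \<Longrightarrow> polytime b \<Longrightarrow> polytime (\<lambda>x. a x \<longrightarrow> b x)"
  by (rule pt_branch[of a b "\<lambda>x. True"]) (auto intro: pt_const simp: enc_bool_def)

lemma pt_bex [pt_intros]:
  assumes "polytime e" "polytime (\<lambda>z. p (fst z) (snd z))"
  shows "polytime (\<lambda>x. \<exists>y \<in> set (e x). p x y)"
proof -
  have "polytime (\<lambda>x. \<not> filter (p x) (e x) = [])"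
    by (intro pt_intros pt_null assms)
  then show ?thesis by (simp add: filter_empty_conv)
qed

lemma pt_ball [pt_intros]:
  assumes "polytime e" "polytime (\<lambda>z. p (fst z) (snd z))"
  shows "polytime (\<lambda>x. \<forall>y \<in> set (e x). p x y)"
proof -
  have "polytime (\<lambda>x. \<not> (\<exists>y \<in> set (e x). \<not> p x y))"
    by (intro pt_intros assms)
  then show ?thesis by simp
qed

lemma pt_length [pt_intros]:
  assumes "polytime e"
  shows "polytime (\<lambda>x. length (e x))"
proof -
  have "polytime (\<lambda>x. length (map (\<lambda>y. ()) (e x)))"
    by (intro pt_units_to_nat pt_intros assms)
  then show ?thesis by simp
qed

lemma pt_add [pt_intros]:
  assumes "polytime a" "polytime b"
  shows "polytime (\<lambda>x. a x + b x :: nat)"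
proof -
  have "polytime (\<lambda>x. length (replicate (a x) () @ replicate (b x) ()))"
    by (intro pt_intros pt_nat_to_units assms)
  then show ?thesis by simp
qed

lemma pt_mult [pt_intros]:
  assumes "polytime a" "polytime b"
  shows "polytime (\<lambda>x. a x * b x :: nat)"
proof -
  have "polytime (\<lambda>x. length (concat (map (\<lambda>u. replicate (b x) ()) (replicate (a x) ()))))"
    by (intro pt_intros pt_nat_to_units assms(1) pt_comp[OF assms(2)])
  then show ?thesis by (simp add: length_concat sum_list_replicate)
qed

lemma pt_power [pt_intros]: "polytime a \<Longrightarrow> polytime (\<lambda>x. a x ^ n :: nat)"
  by (induction n) (auto intro: pt_intros)

lemma pt_drop [pt_intros]:
  assumes a: "polytime a" and e: "polytime e"
  shows "polytime (\<lambda>x. drop (a x) (e x))"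
proof -
  have "polytime (\<lambda>x. fold (\<lambda>_ ys. tl ys) (replicate (a x) ()) (e x))"
  proof (rule pt_fold_additive[where f = "\<lambda>_ _ ys. tl ys" and g = 0])
    show "tsize (enc (tl ys)) \<le> tsize (enc ys) + (tsize (enc (x, y)) + 2) ^ 0" for x y and ys :: "'b list"
      by (cases ys) auto
    show "polytime (\<lambda>z. tl (snd (snd z)))" by (intro pt_intros)
  qed (auto intro: pt_nat_to_units a e)
  moreover have "fold (\<lambda>_ ys. tl ys) (replicate n ()) ys = drop n ys" for n and ys :: "'b list"
    by (induction n arbitrary: ys) (auto simp: drop_Suc)
  ultimately show ?thesis by simp
qed

lemma pt_diff [pt_intros]:
  assumes "polytime a" "polytime b"
  shows "polytime (\<lambda>x. a x - b x :: nat)"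
proof -
  have "polytime (\<lambda>x. length (drop (b x) (replicate (a x) ())))"
    by (intro pt_intros pt_nat_to_units assms)
  then show ?thesis by simp
qed

lemma pt_le [pt_intros]:
  assumes "polytime a" "polytime b"
  shows "polytime (\<lambda>x. (a x :: nat) \<le> b x)"
proof -
  have "polytime (\<lambda>x. replicate (a x - b x) () = [])"
    by (intro pt_intros pt_null pt_nat_to_units assms)
  then show ?thesis by simp
qed

lemma pt_less [pt_intros]:
  assumes "polytime a" "polytime b"
  shows "polytime (\<lambda>x. (a x :: nat) < b x)"
  unfolding less_eq_Suc_le by (intro pt_intros assms)

lemma pt_eq_nat [pt_intros]:
  assumes "polytime a" "polytime b"
  shows "polytime (\<lambda>x. (a x :: nat) = b x)"
  unfolding eq_iff by (intro pt_intros assms)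

lemma pt_eq_nat_list [pt_intros]:
  assumes a: "polytime a" and b: "polytime b"
  shows "polytime (\<lambda>x. (a x :: nat list) = b x)"
proof -
  define f :: "nat \<Rightarrow> nat list \<times> bool \<Rightarrow> nat list \<times> bool" where
    "f y s = (tl (fst s), snd s \<and> (case fst s of [] \<Rightarrow> False | z # zs \<Rightarrow> z = y))" for y s
  have "polytime (\<lambda>x. fold f (a x) (b x, True))"
  proof (rule pt_fold_additive[where f = "\<lambda>_. f" and g = 1])
    show "polytime (\<lambda>z. f (fst (snd z)) (snd (snd z)))"
      unfolding f_def by (intro pt_intros)
    show "tsize (enc (f y s)) \<le> tsize (enc s) + (tsize (enc (x, y)) + 2) ^ 1" for x :: 'a and y s
      by (cases s; cases "fst s") (auto simp: f_def enc_bool_def)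
  qed (auto intro: pt_intros a b)
  then have "polytime (\<lambda>x. snd (fold f (a x) (b x, True)) \<and> fst (fold f (a x) (b x, True)) = [])"
    by (intro pt_intros pt_null)
  moreover have "snd (fold f xs (ys, ok)) \<and> fst (fold f xs (ys, ok)) = [] \<longleftrightarrow> ok \<and> xs = ys" for xs ys ok
  proof (induction xs arbitrary: ys ok)
    case (Cons x xs)
    then show ?case by (cases ys) (auto simp: f_def)
  qed auto
  ultimately show ?thesis by simp
qed

lemma enc_nat_size: "tsize (enc (n :: nat)) = 2 * n + 1"
  by (induction n) auto

text \<open>Each step prepends the current counter, so its growth is not bounded in terms of the
  list element, which is a mere unit; the size of the accumulator is bounded through its closed form
  instead.\<close>

lemma pt_upt0 [pt_intros]:
  assumes a: "polytime a"
  shows "polytime (\<lambda>x. [0..<a x])"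
proof -
  obtain c where c: "\<And>x. tsize (enc (a x)) \<le> (tsize (enc x) + 2) ^ c"
    using polytime_size[OF a] by blast
  define f :: "unit \<Rightarrow> nat \<times> nat list \<Rightarrow> nat \<times> nat list" where
    "f u s = (Suc (fst s), fst s # snd s)" for u s
  have f: "(f () ^^ n) (0, []) = (n, rev [0..<n])" for n
    by (induction n) (auto simp: f_def)
  have size: "tsize (enc (rev [0..<n])) \<le> n * (2 * n + 2) + 1" for n
    by (induction n) (auto simp: enc_nat_size algebra_simps)
  let ?h = "\<lambda>s. (2 * s + 2) * (s + 1) + 2 :: nat"
  have "polytime (\<lambda>x. fold f (replicate (a x) ()) (0, []))"
  proof (rule pt_fold[where f = "\<lambda>_. f" and g = "\<lambda>s. ?h ((s + 2) ^ c)"])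
    show "polytime (\<lambda>z. f (fst (snd z)) (snd (snd z)))"
      unfolding f_def by (intro pt_intros)
    fix x i
    let ?m = "min i (a x)"
    have "tsize (enc (fold f (take i (replicate (a x) ())) (0, []))) \<le> ?h ?m"
      using size[of ?m] by (simp add: f enc_nat_size algebra_simps)
    also have "?m \<le> (tsize (enc x) + 2) ^ c"
      using c[of x] by (simp add: enc_nat_size)
    then have "?h ?m \<le> ?h ((tsize (enc x) + 2) ^ c)"
      by (intro add_mono mult_mono) auto
    finally show "tsize (enc (fold f (take i (replicate (a x) ())) (0, []))) \<le> ?h ((tsize (enc x) + 2) ^ c)" .
  qed (intro pt_intros pb_intros pt_nat_to_units a)+
  then have "polytime (\<lambda>x. rev (snd (fold f (replicate (a x) ()) (0, []))))"
    by (intro pt_intros)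
  then show ?thesis by (simp add: f)
qed

lemma pt_divmod:
  assumes a: "polytime a" and b: "polytime b"
  shows "polytime (\<lambda>x. (a x div b x :: nat, a x mod b x))"
proof -
  \<comment> \<open>The pair is quotient and remainder of the number of steps so far. For
    \<open>d = 0\<close> the test never succeeds and the result is \<open>(0, n)\<close>, in
    accordance with division by zero.\<close>
  define f :: "nat \<Rightarrow> unit \<Rightarrow> nat \<times> nat \<Rightarrow> nat \<times> nat" where
    "f d u s = (if Suc (snd s) = d then (Suc (fst s), 0) else (fst s, Suc (snd s)))" for d u s
  have f: "(f d () ^^ n) (0, 0) = (n div d, n mod d)" for n d
    by (induction n) (auto simp: f_def div_Suc mod_Suc)
  have "polytime (\<lambda>x. fold (f (b x)) (replicate (a x) ()) (0, 0))"
  proof (rule pt_fold_additive[where f = "\<lambda>x. f (b x)" and g = 1])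
    show "polytime (\<lambda>z. f (b (fst z)) (fst (snd z)) (snd (snd z)))"
      unfolding f_def by (intro pt_intros pt_comp[OF b])
    show "tsize (enc (f (b x) u s)) \<le> tsize (enc s) + (tsize (enc (x, u)) + 2) ^ 1" for x :: 'a and u s
      by (cases s) (auto simp: f_def enc_nat_size)
  qed (auto intro: pt_intros pt_nat_to_units a)
  then show ?thesis by (simp add: f)
qed

lemma pt_div [pt_intros]: "polytime a \<Longrightarrow> polytime b \<Longrightarrow> polytime (\<lambda>x. a x div b x :: nat)"
  using pt_fst[OF pt_divmod] by fastforce

lemma pt_mod [pt_intros]: "polytime a \<Longrightarrow> polytime b \<Longrightarrow> polytime (\<lambda>x. a x mod b x :: nat)"
  using pt_snd[OF pt_divmod] by fastforce

text \<open>\<open>!\<close> is unspecified beyond the end of a list, so it has no known program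
  there; the default makes the access total.\<close>

definition nth_or :: "'a \<Rightarrow> 'a list \<Rightarrow> nat \<Rightarrow> 'a" where
  "nth_or d xs i = (case drop i xs of [] \<Rightarrow> d | y # ys \<Rightarrow> y)"

lemma nth_or: "nth_or d xs i = (if i < length xs then xs ! i else d)"
  by (auto simp: nth_or_def split: list.split dest: sym[of "drop _ _"] simp flip: hd_drop_conv_nth)

lemma pt_nth_or [pt_intros]:
  "polytime e \<Longrightarrow> polytime i \<Longrightarrow> polytime (\<lambda>x. nth_or d (e x) (i x))"
  unfolding nth_or_def by (intro pt_intros)

text \<open>Beyond its tag a gate carries a number or a list, hence one projection for each type.
  Where the test fails the result is \<open>Leaf\<close>, the tree of both defaults \<open>0\<close>
  and \<open>[]\<close>.\<close>

lemma pt_gate_tail: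
  assumes q: "polytime q" and r: "\<And>g. enc (r g) = (if q g then ttl (enc g) else Leaf)"
  shows "polytime (r :: gate \<Rightarrow> _)"
proof -
  obtain T c where T: "\<And>g. \<exists>t. run T (enc g) t (enc (q g)) \<and> t \<le> (tsize (enc g) + 2) ^ c"
    using polytime_run[OF q] by blast
  show ?thesis
  proof (rule polytimeI)
    fix g
    obtain t where t: "run T (enc g) t (enc (q g))" "t \<le> (tsize (enc g) + 2) ^ c" using T by blast
    show "\<exists>t. run (PIf T PTl PNil) (enc g) t (enc (r g)) \<and> t \<le> (tsize (enc g) + 2) ^ c + tsize (enc g)"
    proof (cases "q g")
      case True
      then show ?thesis using run_If_true[OF t(1) _ run_Tl] t(2) r[of g] by force
    next
      case False
      then show ?thesis using run_If_false[OF t(1) _ run_Nil] t(2) r[of g] by force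
    qed
  qed (intro pb_intros)
qed

lemma pt_case_gate [pt_intros]:
  assumes e: "polytime e" and a: "polytime a" and b: "polytime (\<lambda>z. b (fst z) (snd z))"
    and c: "polytime (\<lambda>z. c (fst z) (snd z))" and d: "polytime (\<lambda>z. d (fst z) (snd z))"
  shows "polytime (\<lambda>x. case e x of GInput \<Rightarrow> a x | GNot j \<Rightarrow> b x j | GAnd js \<Rightarrow> c x js | GOr js \<Rightarrow> d x js)"
proof -
  define tag :: "gate \<Rightarrow> nat" where
    "tag g = (case g of GInput \<Rightarrow> 0 | GNot _ \<Rightarrow> 1 | GAnd _ \<Rightarrow> 2 | GOr _ \<Rightarrow> 3)" for g
  define arg :: "gate \<Rightarrow> nat list" where "arg g = (case g of GAnd js \<Rightarrow> js | GOr js \<Rightarrow> js | _ \<Rightarrow> [])" for g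
  define neg :: "gate \<Rightarrow> nat" where "neg g = (case g of GNot j \<Rightarrow> j | _ \<Rightarrow> 0)" for g
  have tag: "polytime tag"
  proof (rule polytimeI[where P = PHd and h = "\<lambda>s. s"])
    show "\<exists>t. run PHd (enc g) t (enc (tag g)) \<and> t \<le> tsize (enc g)" for g
      using run_Hd[of "enc g"] by (cases g) (auto simp: tag_def enc_gate_def enc_nat_def)
  qed (intro pb_intros)
  have arg: "polytime arg"
    by (rule pt_gate_tail[where q = "\<lambda>g. 2 \<le> tag g"])
      (intro pt_intros tag, auto simp: arg_def tag_def enc_gate_def enc_nat_eq enc_list_eq split: gate.split)
  have neg: "polytime neg"
    by (rule pt_gate_tail[where q = "\<lambda>g. tag g = 1"])
      (intro pt_intros tag, auto simp: neg_def tag_def enc_gate_def enc_nat_def split: gate.split)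
  have "polytime (\<lambda>x. if tag (e x) = 0 then a x else if tag (e x) = 1 then b x (neg (e x))
    else if tag (e x) = 2 then c x (arg (e x)) else d x (arg (e x)))"
    by (intro pt_intros a pt_comp[OF tag e] pt_comp[OF arg e] pt_comp[OF neg e]
      pt_comp[OF b, of "\<lambda>x. (x, neg (e x))", simplified]
      pt_comp[OF c, of "\<lambda>x. (x, arg (e x))", simplified]
      pt_comp[OF d, of "\<lambda>x. (x, arg (e x))", simplified])
  moreover have "(if tag g = 0 then a x else if tag g = 1 then b x (neg g)
    else if tag g = 2 then c x (arg g) else d x (arg g)) =
    (case g of GInput \<Rightarrow> a x | GNot j \<Rightarrow> b x j | GAnd js \<Rightarrow> c x js | GOr js \<Rightarrow> d x js)" for g x
    by (auto simp: tag_def arg_def neg_def split: gate.split)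
  ultimately show ?thesis by simp
qed

section \<open>Composition of reductions\<close>

lemma computable_comp_polytime:
  assumes "computable f" "polytime h"
  shows "computable (\<lambda>n. h (f n))"
proof -
  obtain P where P: "\<And>n. \<exists>t. run P (enc_nat n) t (enc_nat (f n))"
    using assms(1) unfolding computable_def by blast
  obtain Q where Q: "\<And>n. \<exists>t. run Q (enc_nat n) t (enc_nat (h n))"
    using polytime_run[OF assms(2)] unfolding enc_nat_eq by blast
  have "\<exists>t. run (PComp P Q) (enc_nat n) t (enc_nat (h (f n)))" for n
    using P[of n] Q[of "f n"] by (meson run_Comp)
  then show ?thesis unfolding computable_def by blast
qed

text \<open>
  The output of the first reduction, parameter included, is no larger than its running time, so the
  second one may be polynomial in input and parameter together.
\<close>

lemma fpt_reducible_trans_polytime: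
  fixes r :: "'a::enc \<times> nat \<Rightarrow> 'b::enc \<times> nat"
  assumes Q: "fpt_reducible Q I L"
    and r: "polytime r" and h: "polytime h" "mono h"
    and I: "\<And>x k. (x, k) \<in> I \<Longrightarrow> \<exists>y. x = enc y \<and> snd (r (y, k)) \<le> h k \<and>
      (enc (fst (r (y, k))), snd (r (y, k))) \<in> J \<and>
      ((x, k) \<in> L \<longleftrightarrow> (enc (fst (r (y, k))), snd (r (y, k))) \<in> M)"
  shows "fpt_reducible Q J M"
proof -
  obtain P f g a where f: "computable f" and g: "computable g" and P: "\<And>x k. \<exists>t x' k'.
      run P (Node x (enc_nat k)) t (Node x' (enc_nat k')) \<and> t \<le> f k * tsize x ^ a \<and> k' \<le> g k \<and>
      (x', k') \<in> I \<and> ((x, k) \<in> Q \<longleftrightarrow> (x', k') \<in> L)"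
    using Q unfolding fpt_reducible_def by blast
  obtain R c where R: "\<And>z. \<exists>t. run R (enc z) t (enc (r z)) \<and> t \<le> (tsize (enc z) + 2) ^ c"
    using polytime_run[OF r] by blast
  have "\<exists>t x' k'. run (PComp P R) (Node x (enc_nat k)) t (Node x' (enc_nat k')) \<and>
      t \<le> (f k + 2) ^ (c + 1) * tsize x ^ (a * (c + 1)) \<and> k' \<le> h (g k) \<and>
      (x', k') \<in> J \<and> ((x, k) \<in> Q \<longleftrightarrow> (x', k') \<in> M)" for x k
  proof -
    obtain t x' k' where t: "run P (Node x (enc_nat k)) t (Node x' (enc_nat k'))"
      "t \<le> f k * tsize x ^ a" "k' \<le> g k" "(x', k') \<in> I" "(x, k) \<in> Q \<longleftrightarrow> (x', k') \<in> L"
      using P by blast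
    obtain y where y: "x' = enc y" "snd (r (y, k')) \<le> h k'"
      "(enc (fst (r (y, k'))), snd (r (y, k'))) \<in> J"
      "(x', k') \<in> L \<longleftrightarrow> (enc (fst (r (y, k'))), snd (r (y, k'))) \<in> M"
      using I[OF t(4)] by blast
    obtain u where u: "run R (enc (y, k')) u (enc (r (y, k')))" "u \<le> (tsize (enc (y, k')) + 2) ^ c"
      using R by blast
    have "run (PComp P R) (Node x (enc_nat k)) (t + u) (Node (enc (fst (r (y, k')))) (enc_nat (snd (r (y, k')))))"
      using run_Comp[OF t(1), of R u "enc (r (y, k'))"] u(1) y(1) by (simp add: enc_nat_eq enc_prod_def)
    moreover have "t + u \<le> (f k + 2) ^ (c + 1) * tsize x ^ (a * (c + 1))"
    proof -
      have "tsize (enc (y, k')) \<le> t" using tsize_le_cost[OF t(1)] y(1) by (simp add: enc_nat_eq)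
      then have "u \<le> (t + 2) ^ c" using u(2) by (meson add_le_mono1 order_trans power_mono zero_le)
      then have "t + u \<le> t * (t + 2) ^ c + 2 * (t + 2) ^ c" by (intro add_mono) auto
      also have "\<dots> = (t + 2) ^ (c + 1)" by (simp add: algebra_simps)
      also have "\<dots> \<le> ((f k + 2) * tsize x ^ a) ^ (c + 1)"
      proof (rule power_mono)
        have "1 \<le> tsize x ^ a" using tsize_pos[of x] by simp
        then show "t + 2 \<le> (f k + 2) * tsize x ^ a" using t(2) by (simp add: algebra_simps)
      qed simp
      finally show ?thesis by (simp only: power_mult_distrib power_mult)
    qed
    moreover have "snd (r (y, k')) \<le> h (g k)"
      using y(2) monoD[OF h(2) t(3)] by simp
    ultimately show ?thesis using y t(5) by blast
  qed
  moreover have "computable (\<lambda>k. (f k + 2) ^ (c + 1))"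
    by (rule computable_comp_polytime[OF f]) (intro pt_intros)
  moreover have "computable (\<lambda>k. h (g k))"
    by (rule computable_comp_polytime[OF g h(1)])
  ultimately show ?thesis
    unfolding fpt_reducible_def by (intro exI[of _ "PComp P R"] exI[of _ "\<lambda>k. (f k + 2) ^ (c + 1)"]
      exI[of _ "\<lambda>k. h (g k)"] exI[of _ "a * (c + 1)"]) blast
qed

section \<open>The graph of a 0-1 matrix\<close>

lemma path_edges_image: "path_edges p = (\<lambda>i. {p ! i, p ! Suc i}) ` {..<length p - 1}"
  unfolding path_edges_def by auto

lemma card_path_edges:
  assumes "distinct p"
  shows "card (path_edges p) = length p - 1"
proof -
  have "inj_on (\<lambda>i. {p ! i, p ! Suc i}) {..<length p - 1}"
  proof (rule inj_onI)
    fix i j assume ij: "i \<in> {..<length p - 1}" "j \<in> {..<length p - 1}"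
      and eq: "{p ! i, p ! Suc i} = {p ! j, p ! Suc j}"
    have "i = j \<or> i = Suc j" "Suc i = j \<or> i = j"
      using eq ij assms by (auto simp: doubleton_eq_iff nth_eq_iff_index_eq)
    then show "i = j" by auto
  qed
  then show ?thesis unfolding path_edges_image by (simp add: card_image)
qed

definition entry :: "bool list list \<Rightarrow> nat \<Rightarrow> nat \<Rightarrow> bool" where
  "entry M i u = nth_or False (nth_or [] M i) u"

text \<open>
  Column \<open>u\<close> is represented by the edge between \<open>3 * u\<close> and \<open>3 * u + 1\<close>. The path of a row visits the
  \<open>3 * N\<close> positions in order, using the shared edge of each column in which the row has a one and
  private vertices elsewhere.
\<close>

definition row_vertex :: "nat \<Rightarrow> bool list list \<Rightarrow> nat \<Rightarrow> nat \<Rightarrow> nat" where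
  "row_vertex N M i q =
     (if q mod 3 \<noteq> 2 \<and> entry M i (q div 3) then q else 3 * N * Suc i + q)"

definition row_path :: "nat \<Rightarrow> bool list list \<Rightarrow> nat \<Rightarrow> nat list" where
  "row_path N M i = map (row_vertex N M i) [0..<3 * N]"

text \<open>Vertices below \<open>3 * N\<close> are the shared ones; above, the quotient by
  \<open>3 * N\<close> is the row number plus one. Chords also reach the numbers in this range that
  no row path visits; these are vertices because an encodable graph has an initial segment of the
  numbers as vertex set.\<close>

definition chord :: "nat \<Rightarrow> nat \<Rightarrow> nat \<Rightarrow> nat \<Rightarrow> bool" where
  "chord N m x y \<longleftrightarrow> 3 * N \<le> x \<and> x < 3 * N * Suc m \<and> 3 * N \<le> y \<and> y < 3 * N * Suc m \<and>
     x div (3 * N) \<noteq> y div (3 * N)"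

text \<open>Colors depend on positions only, that is, on remainders modulo \<open>3 * N\<close>. The
  minimum makes the color independent of orientation; on a row edge it is the earlier position, so
  the colors run 1, 2, 3 periodically along every row path.\<close>

definition matrix_graph :: "nat \<Rightarrow> bool list list \<Rightarrow> nat cgraph" where
  "matrix_graph N M =
     \<lparr>verts = {..<3 * N * Suc (length M)},
      edges = (\<Union>i < length M. path_edges (row_path N M i)) \<union> {{x, y} | x y. chord N (length M) x y},
      color = (\<lambda>e. Min ((\<lambda>x. x mod (3 * N)) ` e) mod 3 + 1)\<rparr>"

text \<open>With five columns a path on \<open>3 * N\<close> vertices contains five disjoint triples
  of consecutive vertices, one more than the number of private vertices possible on an induced path
  through two rows. A row must exist for all three colors to occur.\<close>

locale large_matrix =
  fixes N :: nat and M :: "bool list list"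
  assumes N: "5 \<le> N" and M: "M \<noteq> []"
begin

abbreviation "L \<equiv> 3 * N"
abbreviation "m \<equiv> length M"
abbreviation "rv \<equiv> row_vertex N M"
abbreviation "G \<equiv> matrix_graph N M"

text \<open>Remainder and quotient by \<open>L\<close> recover where a vertex belongs: the remainder
  is its position, the quotient is 0 for a shared vertex and \<open>Suc i\<close> for a private
  vertex of row \<open>i\<close>. All arguments about rows read vertices in this way.\<close>

lemma rv_mod: "q < L \<Longrightarrow> rv i q mod L = q"
  by (auto simp: row_vertex_def simp del: mult_Suc_right)

lemma rv_div: "q < L \<Longrightarrow> rv i q div L = (if q mod 3 \<noteq> 2 \<and> entry M i (q div 3) then 0 else Suc i)"
  by (auto simp: row_vertex_def simp del: mult_Suc_right)

lemma rv_less: "q < L \<Longrightarrow> rv i q < L \<longleftrightarrow> q mod 3 \<noteq> 2 \<and> entry M i (q div 3)"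
  by (auto simp: row_vertex_def)

lemma rv_private: "q < L \<Longrightarrow> L \<le> rv i q \<Longrightarrow> rv i q div L = Suc i"
  using rv_div[of q i] rv_less[of q i] by auto

lemma rv_bound: "q < L \<Longrightarrow> i < m \<Longrightarrow> rv i q < L * Suc m"
proof -
  assume "q < L" "i < m"
  have "L * Suc i + q < L * Suc (Suc i)" using \<open>q < L\<close> by simp
  also have "\<dots> \<le> L * Suc m" using \<open>i < m\<close> by (intro mult_le_mono2) simp
  finally show ?thesis using \<open>q < L\<close> by (auto simp: row_vertex_def)
qed

lemma set_row_path: "set (row_path N M i) = rv i ` {..<L}"
  by (auto simp: row_path_def atLeast0LessThan)

lemma length_row_path: "length (row_path N M i) = L"
  by (simp add: row_path_def)

lemma row_path_eq: "x \<in> set (row_path N M i) \<Longrightarrow> x = rv i (x mod L)"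
  by (auto simp: set_row_path rv_mod)

lemma distinct_row_path: "distinct (row_path N M i)"
  unfolding row_path_def distinct_map
  by (auto intro!: inj_onI) (metis rv_mod)

lemma path_edges_row: "path_edges (row_path N M i) = {{rv i q, rv i (Suc q)} | q. Suc q < L}"
  unfolding path_edges_def length_row_path by (intro Collect_cong ex_cong1) (auto simp: row_path_def)

lemma row_edge_cases:
  assumes "{x, y} \<in> path_edges (row_path N M i)"
  obtains q where "Suc q < L" "x = rv i q" "y = rv i (Suc q)"
    | q where "Suc q < L" "y = rv i q" "x = rv i (Suc q)"
  using assms unfolding path_edges_row by (auto simp: doubleton_eq_iff)

lemma row_edge_in_path: "{x, y} \<in> path_edges (row_path N M i) \<Longrightarrow> x \<in> set (row_path N M i)"
  by (elim row_edge_cases) (auto simp: set_row_path)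

lemma edges_G: "edges G = (\<Union>i < m. path_edges (row_path N M i)) \<union> {{x, y} | x y. chord N m x y}"
  by (simp add: matrix_graph_def)

lemma verts_G: "verts G = {..<L * Suc m}"
  by (simp add: matrix_graph_def)

lemma row_path_verts: "i < m \<Longrightarrow> set (row_path N M i) \<subseteq> verts G"
  unfolding set_row_path verts_G using rv_bound by blast

lemma chord_sym: "chord N m x y \<Longrightarrow> chord N m y x"
  by (auto simp: chord_def)

lemma edge_cases:
  assumes "{x, y} \<in> edges G"
  obtains i where "i < m" "{x, y} \<in> path_edges (row_path N M i)" | "chord N m x y"
  using assms unfolding edges_G by (auto simp: doubleton_eq_iff dest: chord_sym)

lemma row_edge_ne: "Suc q < L \<Longrightarrow> rv i q \<noteq> rv i (Suc q)"
  using rv_mod[of q i] rv_mod[of "Suc q" i] by (metis Suc_lessD n_not_Suc_n)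

lemma color_row_edge: "Suc q < L \<Longrightarrow> color G {rv i q, rv i (Suc q)} = q mod 3 + 1"
  by (simp add: matrix_graph_def rv_mod)

lemma color_row: "color G ` path_edges (row_path N M i) = {1..3}"
proof
  show "color G ` path_edges (row_path N M i) \<subseteq> {1..3}"
    unfolding matrix_graph_def by (auto simp: Suc_le_eq)
  show "{1..3} \<subseteq> color G ` path_edges (row_path N M i)"
  proof
    fix c :: nat assume "c \<in> {1..3}"
    then have "c - 1 < 3" "Suc (c - 1) < L" "c = (c - 1) mod 3 + 1" using N by auto
    then have "{rv i (c - 1), rv i (Suc (c - 1))} \<in> path_edges (row_path N M i)"
      and "color G {rv i (c - 1), rv i (Suc (c - 1))} = c"
      unfolding path_edges_row using color_row_edge[of "c - 1" i] by auto
    then show "c \<in> color G ` path_edges (row_path N M i)" by (metis image_eqI)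
  qed
qed

lemma edge_wf: "e \<in> edges G \<Longrightarrow> e \<subseteq> verts G \<and> card e = 2"
proof -
  assume "e \<in> edges G"
  then consider i q where "i < m" "Suc q < L" "e = {rv i q, rv i (Suc q)}"
    | x y where "chord N m x y" "e = {x, y}"
    unfolding edges_G path_edges_row by blast
  then show ?thesis
  proof cases
    case 1
    then show ?thesis using rv_bound[of q i] rv_bound[of "Suc q" i] row_edge_ne[of q i] by (simp add: verts_G)
  next
    case 2
    then have "x \<noteq> y" by (auto simp: chord_def)
    then show ?thesis using 2 by (simp add: chord_def verts_G)
  qed
qed

lemma colored_graph: "colored_graph 3 G"
proof -
  have "color G ` edges G \<subseteq> {1..3}" by (auto simp: matrix_graph_def Suc_le_eq)
  moreover have "path_edges (row_path N M 0) \<subseteq> edges G" using M by (auto simp: edges_G)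
  then have "{1..3} \<subseteq> color G ` edges G" using color_row[of 0] by blast
  moreover have "finite (verts G)" by (simp add: verts_G)
  ultimately show ?thesis unfolding colored_graph_def using edge_wf by blast
qed

section \<open>The induced paths of the graph\<close>

definition partner :: "nat \<Rightarrow> nat" where
  "partner x = (if x mod 3 = 0 then Suc x else x - 1)"

text \<open>The third position of every column is private in every row, so the shared vertices span
  a matching: the only possible shared neighbour of a shared vertex is the other end of its column
  edge.\<close>

lemma shared_edge:
  assumes "{x, y} \<in> edges G" "x < L" "y < L"
  shows "x mod 3 \<noteq> 2" "y = partner x" "y div 3 = x div 3"
proof -
  obtain i q where q: "Suc q < L" "x = rv i q \<and> y = rv i (Suc q) \<or> y = rv i q \<and> x = rv i (Suc q)"
    using assms by (elim edge_cases row_edge_cases) (auto simp: chord_def)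
  then have "rv i q < L" "rv i (Suc q) < L" using assms by auto
  then have *: "q mod 3 \<noteq> 2" "Suc q mod 3 \<noteq> 2" "rv i q = q" "rv i (Suc q) = Suc q"
    using q(1) rv_less[of q i] rv_less[of "Suc q" i] by (auto simp: row_vertex_def)
  then have "q mod 3 = 0" by presburger
  then have "Suc q mod 3 = 1" "Suc q div 3 = q div 3" by presburger+
  then show "x mod 3 \<noteq> 2" "y = partner x" "y div 3 = x div 3"
    using q(2) * \<open>q mod 3 = 0\<close> by (auto simp: partner_def)
qed

text \<open>
  Among three consecutive vertices of an induced path one is private, and private vertices of two
  different rows are joined by chords, so a path through two rows would have at most four private
  vertices.
\<close>

lemma induced_path_is_row:
  assumes F: "F \<subseteq> edges G" "\<And>x y. chord N m x y \<Longrightarrow> {x, y} \<in> F"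
    and p: "distinct p" "length p = L" "set p \<subseteq> {..<L * Suc m}"
    and ind: "path_edges p = {e \<in> F. e \<subseteq> set p}"
  shows "\<exists>i < m. path_graph p = path_graph (row_path N M i)"
proof -
  have L: "15 \<le> L" using N by simp
  have step: "{p ! t, p ! Suc t} \<in> F" if "Suc t < L" for t
  proof -
    have "{p ! t, p ! Suc t} \<in> path_edges p" using that p(2) by (auto simp: path_edges_def)
    then show ?thesis using ind by blast
  qed
  have stepG: "{p ! t, p ! Suc t} \<in> edges G" "{p ! Suc t, p ! t} \<in> edges G" if "Suc t < L" for t
    using step[OF that] F(1) by (auto simp: insert_commute)
  have eq: "p ! s = p ! t \<longleftrightarrow> s = t" if "s < L" "t < L" for s t
    using that p by (simp add: nth_eq_iff_index_eq)
  \<comment> \<open>If all three were shared, both neighbours of the middle vertex would be its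
    \<open>partner\<close>.\<close>
  have three: "\<exists>s \<in> {t, Suc t, Suc (Suc t)}. L \<le> p ! s" if t: "Suc (Suc t) < L" for t
  proof (rule ccontr)
    assume "\<not> ?thesis"
    then have "p ! t < L" "p ! Suc t < L" "p ! Suc (Suc t) < L" by auto
    then have "p ! t = partner (p ! Suc t)" "p ! Suc (Suc t) = partner (p ! Suc t)"
      using shared_edge(2)[OF stepG(2)[of t]] shared_edge(2)[OF stepG(1)[of "Suc t"]] t by auto
    then show False using eq[of t "Suc (Suc t)"] t by auto
  qed
  have mem: "p ! t \<in> set p" if "t < L" for t using that p(2) by simp
  have same: "x div L = y div L" if x: "x \<in> set p" "L \<le> x" and y: "y \<in> set p" "L \<le> y" for x y
  proof (rule ccontr)
    assume ne: "x div L \<noteq> y div L"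
    define Nb where "Nb z = {w \<in> set p. {z, w} \<in> path_edges p}" for z
    have Nb: "card (Nb z) \<le> 2" if z: "z \<in> set p" for z
    proof -
      obtain t where t: "t < length p" "z = p ! t" using z by (metis in_set_conv_nth)
      have "Nb z \<subseteq> {p ! Suc t, p ! (t - 1)}"
      proof
        fix w assume "w \<in> Nb z"
        then obtain s where s: "Suc s < length p" "{z, w} = {p ! s, p ! Suc s}"
          unfolding Nb_def path_edges_def by blast
        then consider "p ! t = p ! s" "w = p ! Suc s" | "p ! t = p ! Suc s" "w = p ! s"
          using t(2) doubleton_eq_iff[of z w "p ! s" "p ! Suc s"] by metis
        then show "w \<in> {p ! Suc t, p ! (t - 1)}"
        proof cases
          case 1
          then have "t = s" using eq[of t s] t(1) s(1) p(2) by simp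
          then show ?thesis using 1 by simp
        next
          case 2
          then have "t = Suc s" using eq[of t "Suc s"] t(1) s(1) p(2) by simp
          then show ?thesis using 2 by simp
        qed
      qed
      then have "card (Nb z) \<le> card {p ! Suc t, p ! (t - 1)}" by (intro card_mono) auto
      also have "\<dots> \<le> 2" by (simp add: card_insert_if)
      finally show ?thesis .
    qed
    let ?Pr = "{z \<in> set p. L \<le> z}"
    \<comment> \<open>Every private vertex lies off the row of \<open>x\<close> or off that of
      \<open>y\<close>, hence is joined to one of the two by a chord; as the path is induced in
      \<open>F\<close>, this chord is one of its edges.\<close>
    have "?Pr \<subseteq> Nb x \<union> Nb y"
    proof
      fix z assume z: "z \<in> ?Pr"
      have adj: "z \<in> Nb w" if "w \<in> set p" "L \<le> w" "w div L \<noteq> z div L" for w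
      proof -
        have "w < L * Suc m" "z < L * Suc m" using that(1) z p(3) by blast+
        then have "chord N m w z" using that z unfolding chord_def by simp
        then have "{w, z} \<in> F" by (rule F(2))
        then show ?thesis using that(1) z ind unfolding Nb_def by blast
      qed
      show "z \<in> Nb x \<union> Nb y" using adj[of x] adj[of y] x y ne by (cases "x div L = z div L") auto
    qed
    then have "card ?Pr \<le> card (Nb x \<union> Nb y)" by (intro card_mono) (auto simp: Nb_def)
    also have "\<dots> \<le> 4" using card_Un_le[of "Nb x" "Nb y"] Nb[OF x(1)] Nb[OF y(1)] by linarith
    finally have le: "card ?Pr \<le> 4" .
    \<comment> \<open>One private vertex from each of five disjoint triples; this is where
      \<open>N\<close> must be at least five.\<close>
    have "\<exists>t. t div 3 = s \<and> t < L \<and> L \<le> p ! t" if s: "s < 5" for s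
    proof -
      obtain t where t: "t \<in> {3 * s, Suc (3 * s), Suc (Suc (3 * s))}" "L \<le> p ! t"
        using three[of "3 * s"] s L by auto
      moreover have "t div 3 = s" "t < L" using t(1) s L by auto
      ultimately show ?thesis by blast
    qed
    then obtain T where T: "\<And>s. s < 5 \<Longrightarrow> T s div 3 = s \<and> T s < L \<and> L \<le> p ! T s" by metis
    have "inj_on (\<lambda>s. p ! T s) {..<5::nat}"
      by (rule inj_onI) (metis T eq lessThan_iff)
    moreover have "(\<lambda>s. p ! T s) ` {..<5} \<subseteq> ?Pr" using T mem by auto
    ultimately have "card {..<5::nat} \<le> card ?Pr" by (intro card_inj_on_le[of "\<lambda>s. p ! T s"]) auto
    then show False using le by simp
  qed
  obtain w where w: "w \<in> set p" "L \<le> w" using three[of 0] mem[of 0] mem[of 1] mem[of 2] L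
    by (auto simp: numeral_2_eq_2)
  define i where "i = w div L - 1"
  have wi: "w div L = Suc i"
  proof -
    have "0 < w div L" using w L by (simp add: div_greater_zero_iff)
    then show ?thesis by (simp add: i_def)
  qed
  have im: "i < m"
  proof -
    have "w < L * Suc m" using w(1) p(3) by auto
    then have "w div L < Suc m" using L by (simp add: less_mult_imp_div_less mult.commute)
    then show ?thesis using wi by simp
  qed
  have cls: "z div L = Suc i" if "z \<in> set p" "L \<le> z" for z
    using same[OF that w] wi by simp
  have row: "\<exists>i' < m. {p ! t, p ! Suc t} \<in> path_edges (row_path N M i')" if t: "Suc t < L" for t
    using stepG(1)[OF t]
  proof (cases rule: edge_cases)
    case 2
    then show ?thesis using cls[of "p ! t"] cls[of "p ! Suc t"] mem t by (auto simp: chord_def)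
  qed blast
  \<comment> \<open>A private vertex belongs to one row only, so an edge at it lies entirely on row
    \<open>i\<close>.\<close>
  have row_i: "x \<in> set (row_path N M i) \<and> y \<in> set (row_path N M i)"
    if "{x, y} \<in> path_edges (row_path N M i')" "x \<in> set p" "L \<le> x" for x y i'
  proof -
    have "x div L = Suc i'" using that(1,3) by (elim row_edge_cases) (auto simp: rv_private)
    then have "i' = i" using cls[OF that(2,3)] by simp
    then show ?thesis using that(1) row_edge_in_path by (metis insert_commute)
  qed
  \<comment> \<open>Shared vertices off row \<open>i\<close> are still to be excluded; they could be
    joined by edges of other rows. Every path neighbour of such a vertex is again of this kind and
    equal to its \<open>partner\<close>, so it has at most one, and the path would end after two
    vertices.\<close>
  define bad where "bad x \<longleftrightarrow> x \<in> set p \<and> x < L \<and> x \<notin> set (row_path N M i)" for x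
  have bad: "bad y \<and> y = partner x" if x: "bad x" and y: "y \<in> set p"
    and e: "{x, y} \<in> path_edges (row_path N M i')" "i' < m" for x y i'
  proof -
    have yL: "y < L" using row_i[of y x i'] e y x by (cases "y < L") (auto simp: bad_def insert_commute)
    have "{x, y} \<in> edges G" using e by (auto simp: edges_G)
    from shared_edge[OF this _ yL] have *: "x mod 3 \<noteq> 2" "y = partner x" "y div 3 = x div 3"
      using x by (auto simp: bad_def)
    have "y \<notin> set (row_path N M i)"
    proof
      assume "y \<in> set (row_path N M i)"
      then have "y = rv i y" using row_path_eq[of y i] yL by simp
      then have "entry M i (y div 3)" using rv_less[OF yL, of i] yL by simp
      then have "rv i x = x" using * by (simp add: row_vertex_def)
      then show False using x by (force simp: bad_def set_row_path)
    qed
    then show ?thesis using * yL y by (simp add: bad_def)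
  qed
  have bad_next: "bad (p ! Suc t) \<and> p ! Suc t = partner (p ! t)" if "Suc t < L" "bad (p ! t)" for t
    using row[OF that(1)] bad[OF that(2)] mem that by auto
  have bad_prev: "bad (p ! t) \<and> p ! t = partner (p ! Suc t)" if "Suc t < L" "bad (p ! Suc t)" for t
    using row[OF that(1)] bad[OF that(2)] mem[of t] that by (metis Suc_lessD insert_commute)
  have inner: "\<not> bad (p ! Suc t)" if "Suc (Suc t) < L" for t
    using bad_next[of "Suc t"] bad_prev[of t] that eq[of t "Suc (Suc t)"] by auto
  have "\<not> bad (p ! t)" if t: "t < L" for t
  proof
    assume b: "bad (p ! t)"
    show False
    proof (cases t)
      case 0
      then show False using b bad_next[of 0] inner[of 0] L by auto
    next
      case (Suc s)
      then show False using b bad_prev[of s] inner[of s] inner[of "s - 1"] t L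
        by (cases s; cases "Suc (Suc s) < L") auto
    qed
  qed
  then have nbad: "\<not> bad x" if "x \<in> set p" for x
    using that p(2) by (metis in_set_conv_nth)
  have sub: "set p \<subseteq> set (row_path N M i)"
  proof
    fix x assume x: "x \<in> set p"
    show "x \<in> set (row_path N M i)"
    proof (cases "x < L")
      case True
      then show ?thesis using nbad[OF x] x by (simp add: bad_def)
    next
      case False
      obtain t where t: "t < L" "x = p ! t" using x p(2) by (metis in_set_conv_nth)
      have "\<exists>y i'. {x, y} \<in> path_edges (row_path N M i')"
      proof (cases "Suc t < L")
        case True
        then show ?thesis using row[OF True] t by blast
      next
        case False
        then obtain s where "t = Suc s" using t L by (cases t) auto
        then show ?thesis using row[of s] t by (metis insert_commute)
      qed
      then show ?thesis using row_i x False by (meson not_le)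
    qed
  qed
  have set_eq: "set p = set (row_path N M i)"
    using sub p distinct_row_path length_row_path
    by (intro card_subset_eq) (auto simp: distinct_card)
  \<comment> \<open>An edge of another row with both ends on row \<open>i\<close> occupies the same
    two consecutive positions there, so it is an edge of row \<open>i\<close> as well. Equality
    follows since both paths have \<open>L - 1\<close> edges.\<close>
  have "path_edges p \<subseteq> path_edges (row_path N M i)"
  proof
    fix e assume e: "e \<in> path_edges p"
    then obtain t where t: "Suc t < L" "e = {p ! t, p ! Suc t}" using p(2) by (auto simp: path_edges_def)
    obtain i' where "e \<in> path_edges (row_path N M i')" using row t by blast
    then obtain q where q: "Suc q < L" "e = {rv i' q, rv i' (Suc q)}" unfolding path_edges_row by blast
    then have "{rv i' q, rv i' (Suc q)} \<subseteq> set (row_path N M i)" using e ind set_eq by blast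
    then have "rv i' q = rv i q" "rv i' (Suc q) = rv i (Suc q)"
      using row_path_eq[of "rv i' q" i] row_path_eq[of "rv i' (Suc q)" i] q(1) by (auto simp: rv_mod)
    then show "e \<in> path_edges (row_path N M i)" unfolding path_edges_row using q by auto
  qed
  then have "path_edges p = path_edges (row_path N M i)"
    using card_path_edges[OF p(1)] card_path_edges[OF distinct_row_path[of i]] p(2) length_row_path
    by (intro card_subset_eq) (auto simp: path_edges_image)
  then show ?thesis using set_eq im by (auto simp: path_graph_def)
qed

text \<open>An edge between vertices of row \<open>i\<close> either comes from some row, and then
  its ends have consecutive positions and are consecutive on row \<open>i\<close>, or is a chord,
  which never joins two private vertices of one row.\<close>

lemma row_path_induced:
  assumes i: "i < m"
  shows "induced_in G (path_graph (row_path N M i))"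
proof -
  have "e \<in> path_edges (row_path N M i)" if e: "e \<in> edges G" "e \<subseteq> set (row_path N M i)" for e
  proof -
    obtain x y where xy: "e = {x, y}" using edge_wf[OF e(1)] by (auto simp: card_2_iff)
    have x: "x = rv i (x mod L)" and y: "y = rv i (y mod L)"
      using e(2) xy row_path_eq by auto
    from e(1)[unfolded xy] show ?thesis
    proof (cases rule: edge_cases)
      case (1 j)
      then obtain q where q: "Suc q < L" "{x, y} = {rv j q, rv j (Suc q)}" unfolding path_edges_row by blast
      then have "{x, y} = {rv i q, rv i (Suc q)}"
        using x y by (auto simp: doubleton_eq_iff rv_mod)
      then show ?thesis unfolding path_edges_row xy using q(1) by auto
    next
      case 2
      then have "x div L = Suc i" "y div L = Suc i"
        using rv_private[of "x mod L" i] rv_private[of "y mod L" i] x y N by (auto simp: chord_def)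
      then show ?thesis using 2 by (simp add: chord_def)
    qed
  qed
  moreover have "e \<in> edges G" "e \<subseteq> set (row_path N M i)" if "e \<in> path_edges (row_path N M i)" for e
    using i that by (auto simp: edges_G set_row_path path_edges_row)
  ultimately show ?thesis
    using row_path_verts[OF i] unfolding induced_in_def path_graph_def by auto
qed

lemma row_path_colored:
  assumes i: "i < m"
  shows "path_graph (row_path N M i) \<in> colored_paths G 3 L"
proof -
  have "path_edges (row_path N M i) \<subseteq> edges G" using i by (auto simp: edges_G)
  then show ?thesis
    unfolding colored_paths_def using distinct_row_path length_row_path color_row row_path_verts[OF i]
    by auto
qed

lemma row_edge_not_chord:
  assumes "{x, y} \<in> path_edges (row_path N M i)"
  shows "\<not> chord N m x y"
  using assms by (elim row_edge_cases) (auto simp: chord_def rv_private)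

text \<open>Two deletion sets are kept apart: the path is found in the graph without
  \<open>T\<close> and induced in the graph without \<open>S\<close>. With \<open>T\<close> empty
  this serves the non-cascading condition, with \<open>T = S\<close> the effect of a solution. What
  matters is that \<open>S\<close> spares the chords.\<close>

lemma induced_after_deletion:
  assumes S: "\<And>x y. chord N m x y \<Longrightarrow> {x, y} \<notin> S"
    and H: "H \<in> colored_paths (delete_edges G T) 3 L" "induced_in (delete_edges G S) H"
  shows "\<exists>i < m. H = path_graph (row_path N M i)"
proof -
  obtain p where p: "H = path_graph p" "distinct p" "length p = L" "set p \<subseteq> verts G"
    using H(1) unfolding colored_paths_def delete_edges_def by auto
  have "\<exists>i < m. path_graph p = path_graph (row_path N M i)"
  proof (rule induced_path_is_row)
    show "path_edges p = {e \<in> edges G - S. e \<subseteq> set p}"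
      using H(2) p(1) unfolding induced_in_def path_graph_def delete_edges_def by simp
    show "chord N m x y \<Longrightarrow> {x, y} \<in> edges G - S" for x y
      using S by (auto simp: edges_G)
  qed (use p verts_G in auto)
  then show ?thesis using p(1) by simp
qed

lemma delete_none: "delete_edges G {} = G"
  by (simp add: delete_edges_def)

lemma induced_colored_paths_G:
  "induced_colored_paths G 3 L = (\<lambda>i. path_graph (row_path N M i)) ` {..<m}"
proof -
  have "\<exists>i < m. H = path_graph (row_path N M i)" if "H \<in> induced_colored_paths G 3 L" for H
    using that induced_after_deletion[of "{}" H "{}"] by (simp add: induced_colored_paths_def delete_none)
  then show ?thesis
    using row_path_induced row_path_colored unfolding induced_colored_paths_def by blast
qed

text \<open>The conflict edges are the edges of the row paths, so deleting any of them keeps all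
  chords in place.\<close>

lemma chord_not_conflict: "chord N m x y \<Longrightarrow> {x, y} \<notin> conflict_edges G 3 L"
  unfolding conflict_edges_def induced_colored_paths_G
  by (auto simp: path_graph_def dest: row_edge_not_chord)

lemma non_cascading: "non_cascading G 3 L"
  unfolding non_cascading_def
proof (intro ballI impI allI notI)
  fix H X
  assume H: "H \<in> colored_paths G 3 L" "\<not> induced_in G H" "X \<subseteq> conflict_edges G 3 L"
    "induced_in (delete_edges G X) H"
  have "\<exists>i < m. H = path_graph (row_path N M i)"
    using H(1,3,4) chord_not_conflict by (intro induced_after_deletion[of X _ "{}"]) (auto simp: delete_none)
  then show False using H(2) row_path_induced by blast
qed

text \<open>Position 2 is private in every row, so even equal rows of the matrix have different
  paths. Hence listing one path per row causes no repetition.\<close>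

lemma inj_row_graph: "inj_on (\<lambda>i. path_graph (row_path N M i)) {..<m}"
proof (rule inj_onI)
  fix i j assume "path_graph (row_path N M i) = path_graph (row_path N M j)"
  then have "rv i 2 \<in> set (row_path N M j)" using N by (auto simp: path_graph_def set_row_path)
  then have "rv i 2 = rv j 2" using row_path_eq[of "rv i 2" j] rv_mod[of 2 i] N by simp
  then show "i = j" using N by (simp add: row_vertex_def)
qed

lemma card_induced: "card (induced_colored_paths G 3 L) \<le> card (verts G)"
proof -
  have "card (induced_colored_paths G 3 L) \<le> m"
    unfolding induced_colored_paths_G using card_image_le[of "{..<m}"] by simp
  also have "\<dots> \<le> L * Suc m" using N by (simp add: trans_le_add2)
  finally show ?thesis by (simp add: verts_G)
qed

section \<open>Deletion sets and hitting sets\<close>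

lemma row_edge_shared_or_private:
  assumes "e \<in> path_edges (row_path N M i)"
  shows "(\<exists>u < N. entry M i u \<and> e = {3 * u, 3 * u + 1}) \<or> (\<exists>x \<in> e. L \<le> x \<and> x div L = Suc i)"
proof -
  obtain q where q: "Suc q < L" "e = {rv i q, rv i (Suc q)}" using assms unfolding path_edges_row by blast
  show ?thesis
  proof (cases "rv i q < L \<and> rv i (Suc q) < L")
    case True
    then have *: "q mod 3 \<noteq> 2" "Suc q mod 3 \<noteq> 2" "entry M i (q div 3)" "rv i q = q" "rv i (Suc q) = Suc q"
      using q(1) rv_less[of q i] rv_less[of "Suc q" i] by (auto simp: row_vertex_def)
    then have "q mod 3 = 0" by presburger
    then have "q = 3 * (q div 3)" by auto
    then show ?thesis using * q by (metis Suc_eq_plus1 Suc_lessD mult_less_cancel1)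
  next
    case False
    then show ?thesis using q rv_private[of q i] rv_private[of "Suc q" i] by fastforce
  qed
qed

lemma shared_in_row:
  assumes "u < N" "entry M i u"
  shows "{3 * u, 3 * u + 1} \<in> path_edges (row_path N M i)"
proof -
  have "rv i (3 * u) = 3 * u" "rv i (Suc (3 * u)) = Suc (3 * u)"
    using assms by (auto simp: row_vertex_def Suc_times_mod_eq div_Suc)
  then show ?thesis unfolding path_edges_row using assms(1)
    by (auto intro!: exI[of _ "3 * u"])
qed

lemma solvable_hits_rows:
  assumes "path_deletion_solvable G 3 L k"
  shows "\<exists>S. finite S \<and> card S \<le> k \<and> (\<forall>i < m. S \<inter> path_edges (row_path N M i) \<noteq> {})"
proof -
  obtain S where S: "S \<subseteq> edges G" "card S \<le> k" "induced_colored_paths (delete_edges G S) 3 L = {}"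
    using assms unfolding path_deletion_solvable_def by blast
  have "finite (edges G)"
    by (rule finite_subset[of _ "Pow (verts G)"]) (use edge_wf in \<open>auto simp: verts_G\<close>)
  then have "finite S" using S(1) finite_subset by blast
  moreover have "S \<inter> path_edges (row_path N M i) \<noteq> {}" if i: "i < m" for i
  proof
    assume disj: "S \<inter> path_edges (row_path N M i) = {}"
    have "induced_in (delete_edges G S) (path_graph (row_path N M i))"
      using row_path_induced[OF i] disj unfolding induced_in_def delete_edges_def path_graph_def by auto
    moreover have "path_edges (row_path N M i) \<subseteq> edges G - S" using disj i by (auto simp: edges_G)
    then have "path_graph (row_path N M i) \<in> colored_paths (delete_edges G S) 3 L"
      unfolding colored_paths_def delete_edges_def
      using distinct_row_path length_row_path color_row row_path_verts[OF i] by auto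
    ultimately show False using S(3) unfolding induced_colored_paths_def by blast
  qed
  ultimately show ?thesis using S(2) by blast
qed

lemma solvableI:
  assumes H: "H \<subseteq> {..<N}" "card H \<le> k" "\<And>i. i < m \<Longrightarrow> \<exists>u \<in> H. entry M i u"
  shows "path_deletion_solvable G 3 L k"
proof -
  \<comment> \<open>A column without a one has no edge in the graph, hence the intersection.\<close>
  define S where "S = (\<lambda>u. {3 * u, 3 * u + 1}) ` H \<inter> edges G"
  have "finite H" using H(1) finite_subset by blast
  then have "card S \<le> card ((\<lambda>u. {3 * u, 3 * u + 1}) ` H)" unfolding S_def by (intro card_mono) auto
  also have "\<dots> \<le> k" using card_image_le[OF \<open>finite H\<close>] H(2) order_trans by blast
  finally have "card S \<le> k" .
  moreover have "induced_colored_paths (delete_edges G S) 3 L = {}"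
  proof (rule ccontr)
    assume "\<not> ?thesis"
    then obtain P where P: "P \<in> colored_paths (delete_edges G S) 3 L" "induced_in (delete_edges G S) P"
      unfolding induced_colored_paths_def by blast
    have "{x, y} \<notin> S" if "chord N m x y" for x y
      using that H(1) unfolding S_def chord_def by (fastforce simp: doubleton_eq_iff)
    then obtain i where i: "i < m" "P = path_graph (row_path N M i)"
      using induced_after_deletion[OF _ P] by blast
    obtain u where u: "u \<in> H" "entry M i u" using H(3)[OF i(1)] by blast
    then have e: "{3 * u, 3 * u + 1} \<in> path_edges (row_path N M i)" using H(1) shared_in_row by auto
    then have "{3 * u, 3 * u + 1} \<in> S" using u(1) i(1) unfolding S_def edges_G by blast
    then show False using P(2) e unfolding i(2) induced_in_def path_graph_def delete_edges_def by auto
  qed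
  ultimately show ?thesis unfolding path_deletion_solvable_def S_def by blast
qed

text \<open>
  With more than \<open>k\<close> copies of every row, private edges cannot destroy the paths of all copies.
\<close>

lemma solvable_iff_hitting_set:
  assumes copies: "\<And>r. r \<in> set M \<Longrightarrow> k < length (filter ((=) r) M)"
  shows "path_deletion_solvable G 3 L k \<longleftrightarrow>
    (\<exists>H \<subseteq> {..<N}. card H \<le> k \<and> (\<forall>r \<in> set M. \<exists>u \<in> H. nth_or False r u))"
proof
  assume "path_deletion_solvable G 3 L k"
  then obtain S where S: "finite S" "card S \<le> k" "\<And>i. i < m \<Longrightarrow> S \<inter> path_edges (row_path N M i) \<noteq> {}"
    using solvable_hits_rows by blast
  define H where "H = {u. u < N \<and> {3 * u, 3 * u + 1} \<in> S}"
  have "inj_on (\<lambda>u. {3 * u, 3 * u + 1}) H"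
    by (rule inj_onI) (auto simp: doubleton_eq_iff)
  then have "card H \<le> card S"
    by (rule card_inj_on_le) (auto simp: H_def S(1))
  moreover have "\<exists>u \<in> H. nth_or False r u" if r: "r \<in> set M" for r
  proof (rule ccontr)
    assume no: "\<not> ?thesis"
    \<comment> \<open>If no column of \<open>H\<close> hits \<open>r\<close>, each copy of
      \<open>r\<close> must lose an edge with a private end. That end reveals the copy, so different
      copies lose different edges, and there are more than \<open>k\<close> copies.\<close>
    define I where "I = {i. i < m \<and> r = M ! i}"
    have "\<exists>e \<in> S. e \<in> path_edges (row_path N M i) \<and> (\<exists>x \<in> e. L \<le> x \<and> x div L = Suc i)" if "i \<in> I" for i
    proof -
      have i: "i < m" "entry M i = nth_or False r" using that by (auto simp: I_def entry_def nth_or)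
      obtain e where e: "e \<in> S" "e \<in> path_edges (row_path N M i)" using S(3)[OF i(1)] by blast
      then show ?thesis using row_edge_shared_or_private[OF e(2)] no i(2) by (auto simp: H_def)
    qed
    then obtain e where e: "\<And>i. i \<in> I \<Longrightarrow> e i \<in> S \<and> e i \<in> path_edges (row_path N M i) \<and>
      (\<exists>x \<in> e i. L \<le> x \<and> x div L = Suc i)" by metis
    have "inj_on e I"
    proof (rule inj_onI)
      fix i j assume ij: "i \<in> I" "j \<in> I" "e i = e j"
      obtain x where x: "x \<in> e j" "L \<le> x" "x div L = Suc i" using e[OF ij(1)] ij(3) by auto
      obtain q where "Suc q < L" "e j = {rv j q, rv j (Suc q)}" using e[OF ij(2)] unfolding path_edges_row by blast
      then have "x div L = Suc j" using x rv_private[of q j] rv_private[of "Suc q" j] by auto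
      then show "i = j" using x(3) by simp
    qed
    then have "card I \<le> card S" by (rule card_inj_on_le) (use e S(1) in auto)
    then show False using copies[OF r] S(2) unfolding I_def length_filter_conv_card by simp
  qed
  ultimately show "\<exists>H \<subseteq> {..<N}. card H \<le> k \<and> (\<forall>r \<in> set M. \<exists>u \<in> H. nth_or False r u)"
    using S(2) by (intro exI[of _ H]) (auto simp: H_def)
next
  assume "\<exists>H \<subseteq> {..<N}. card H \<le> k \<and> (\<forall>r \<in> set M. \<exists>u \<in> H. nth_or False r u)"
  then obtain H where H: "H \<subseteq> {..<N}" "card H \<le> k" "\<And>r. r \<in> set M \<Longrightarrow> \<exists>u \<in> H. nth_or False r u" by blast
  then have "\<exists>u \<in> H. entry M i u" if "i < m" for i
    using that by (auto simp: entry_def nth_or)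
  then show "path_deletion_solvable G 3 L k" using H by (intro solvableI)
qed

end

section \<open>Encoding and enumeration\<close>

lemma pt_product [pt_intros]:
  assumes a: "polytime a" and b: "polytime b"
  shows "polytime (\<lambda>x. List.product (a x) (b x))"
  unfolding product_concat_map by (intro pt_intros a pt_comp[OF b])

text \<open>Exhaustive search, with the quantifiers ranging over lists so that \<open>pt_bex\<close>
  applies; since numbers are unary this stays polynomial.\<close>

definition adjacent :: "nat \<Rightarrow> bool list list \<Rightarrow> nat \<Rightarrow> nat \<Rightarrow> bool" where
  "adjacent N M x y \<longleftrightarrow> chord N (length M) x y \<or>
     (\<exists>i \<in> set [0..<length M]. \<exists>q \<in> set [0..<3 * N - 1].
        x = row_vertex N M i q \<and> y = row_vertex N M i (Suc q) \<or>
        y = row_vertex N M i q \<and> x = row_vertex N M i (Suc q))"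

definition edge_list :: "nat \<Rightarrow> bool list list \<Rightarrow> (nat \<times> nat \<times> nat) list" where
  "edge_list N M =
     map (\<lambda>p. (fst p, snd p,
         (if fst p mod (3 * N) \<le> snd p mod (3 * N) then fst p mod (3 * N) else snd p mod (3 * N)) mod 3 + 1))
       (filter (\<lambda>p. fst p < snd p \<and> adjacent N M (fst p) (snd p))
         (List.product [0..<3 * N * Suc (length M)] [0..<3 * N * Suc (length M)]))"

definition matrix_instance :: "nat \<Rightarrow> bool list list \<Rightarrow> nat \<times> (nat \<times> nat \<times> nat) list \<times> nat \<times> nat" where
  "matrix_instance N M = (3 * N * Suc (length M), edge_list N M, 3, 3 * N)"

lemma pt_matrix_instance [pt_intros]:
  assumes a: "polytime a" and b: "polytime b"
  shows "polytime (\<lambda>x. matrix_instance (a x) (b x))"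
  unfolding matrix_instance_def edge_list_def adjacent_def chord_def row_vertex_def entry_def
  by (intro pt_intros pt_comp[OF a] pt_comp[OF b])

lemma enc_eq_iff: "enc x = enc y \<longleftrightarrow> x = y"
  using enc_inject by blast

lemma encodes_enc:
  fixes n :: nat and es :: "(nat \<times> nat \<times> nat) list"
  shows "encodes (enc (n, es, c, l)) G c' l' \<longleftrightarrow>
     c' = c \<and> l' = l \<and> verts G = {..<n} \<and> distinct (map (\<lambda>(u, v, i). {u, v}) es) \<and>
     edges G = (\<lambda>(u, v, i). {u, v}) ` set es \<and> (\<forall>(u, v, i) \<in> set es. color G {u, v} = i)"
  unfolding encodes_def enc_nat_eq enc_edge_eq enc_list_eq
  by (auto simp: enc_eq_iff)

lemma encodes_form:
  "encodes x G c l \<Longrightarrow> \<exists>(n :: nat) (es :: (nat \<times> nat \<times> nat) list). x = enc (n, es, c, l)"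
  unfolding encodes_def enc_nat_eq enc_edge_eq enc_list_eq by auto

text \<open>An encoding fixes colors of edges only, while \<open>color\<close> is defined on all
  sets, so one tree encodes many records. Membership in \<open>CPD\<close> speaks of some record
  with that encoding and must not depend on which.\<close>

lemma solvable_cong:
  assumes "verts G = verts G'" "edges G = edges G'" "\<And>e. e \<in> edges G \<Longrightarrow> color G e = color G' e"
  shows "path_deletion_solvable G c l k \<longleftrightarrow> path_deletion_solvable G' c l k"
proof -
  have "color G ` path_edges p = color G' ` path_edges p" if "path_edges p \<subseteq> edges G' - S" for p S
    using that assms by (intro image_cong) auto
  then have "colored_paths (delete_edges G S) c l = colored_paths (delete_edges G' S) c l" for S
    unfolding colored_paths_def delete_edges_def using assms(1,2) by (auto 4 4)
  moreover have "induced_in (delete_edges G S) = induced_in (delete_edges G' S)" for S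
    unfolding induced_in_def delete_edges_def using assms(1,2) by auto
  ultimately show ?thesis
    unfolding path_deletion_solvable_def induced_colored_paths_def using assms(2) by simp
qed

lemma CPD_iff:
  assumes x: "encodes x G c l" and G: "colored_graph c G"
  shows "(x, k) \<in> CPD \<longleftrightarrow> path_deletion_solvable G c l k"
proof
  assume "(x, k) \<in> CPD"
  then obtain G' c' l' where G': "path_deletion_solvable G' c' l' k" "encodes x G' c' l'"
    unfolding CPD_def CPD_encodings_def by blast
  obtain n :: nat and es :: "(nat \<times> nat \<times> nat) list" where x_eq: "x = enc (n, es, c, l)" using encodes_form[OF x] by blast
  from x G'(2) show "path_deletion_solvable G c l k"
    unfolding x_eq encodes_enc using G'(1) by (subst solvable_cong[of G G']) auto
next
  assume "path_deletion_solvable G c l k"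
  then show "(x, k) \<in> CPD" unfolding CPD_def CPD_encodings_def using x G by auto
qed

text \<open>The program sees only the edge list and has to recover the matrix. Row \<open>i\<close>
  has a one in column \<open>u\<close> iff the shared vertex \<open>3 * u + 1\<close> is joined to
  the private vertex of row \<open>i\<close> at position \<open>3 * u + 2\<close>; the number of
  rows is read off from \<open>n\<close>.\<close>

definition enumerate_paths :: "nat \<times> (nat \<times> nat \<times> nat) list \<times> nat \<times> nat \<Rightarrow> nat list list" where
  "enumerate_paths = (\<lambda>(n, es, c, l).
     map (\<lambda>i. map (\<lambda>q.
         if q mod 3 \<noteq> 2 \<and>
           (\<exists>e \<in> set es. fst e = 3 * (q div 3) + 1 \<and> fst (snd e) = l * Suc i + (3 * (q div 3) + 2) \<or>
              fst (snd e) = 3 * (q div 3) + 1 \<and> fst e = l * Suc i + (3 * (q div 3) + 2))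
         then q else l * Suc i + q) [0..<l])
       (filter (\<lambda>i. l * Suc i < n) [0..<n]))"

lemma pt_enumerate_paths: "polytime enumerate_paths"
  unfolding enumerate_paths_def by (intro pt_intros)

context large_matrix
begin

lemma adjacent_iff: "x \<noteq> y \<Longrightarrow> adjacent N M x y \<longleftrightarrow> {x, y} \<in> edges G"
proof
  assume "adjacent N M x y"
  then show "{x, y} \<in> edges G"
    unfolding adjacent_def edges_G path_edges_row by (fastforce simp: insert_commute)
next
  assume "{x, y} \<in> edges G"
  then show "adjacent N M x y"
  proof (cases rule: edge_cases)
    case (1 i)
    from 1(2) obtain q where "Suc q < L" "x = rv i q \<and> y = rv i (Suc q) \<or> y = rv i q \<and> x = rv i (Suc q)"
      by (elim row_edge_cases) auto
    then have "\<exists>q \<in> set [0..<L - 1]. x = rv i q \<and> y = rv i (Suc q) \<or> y = rv i q \<and> x = rv i (Suc q)"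
      by (intro bexI[of _ q]) auto
    moreover have "i \<in> set [0..<m]" using 1(1) by simp
    ultimately show ?thesis unfolding adjacent_def by blast
  qed (simp add: adjacent_def)
qed

lemma matrix_encodes: "encodes (enc (matrix_instance N M)) G 3 L"
proof -
  let ?P = "List.product [0..<L * Suc m] [0..<L * Suc m]"
  let ?f = "filter (\<lambda>p. fst p < snd p \<and> adjacent N M (fst p) (snd p)) ?P"
  let ?D = "\<lambda>p. {fst p, snd p :: nat}"
  have map: "map (\<lambda>(u, v, i). {u, v}) (edge_list N M) = map ?D ?f"
    by (simp add: edge_list_def)
  have set: "(\<lambda>(u, v, i). {u, v}) ` set (edge_list N M) = ?D ` set ?f"
    unfolding set_map[symmetric] map ..
  have "inj_on ?D (set ?f)"
    by (rule inj_onI) (auto simp: doubleton_eq_iff)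
  then have "distinct (map ?D ?f)"
    by (simp add: distinct_map distinct_product)
  moreover have "edges G = ?D ` set ?f"
  proof
    show "?D ` set ?f \<subseteq> edges G" using adjacent_iff by auto
    show "edges G \<subseteq> ?D ` set ?f"
    proof
      fix e assume e: "e \<in> edges G"
      obtain a b where ab: "e = {a, b}" "a \<noteq> b" using edge_wf[OF e] by (meson card_2_iff)
      define x y where "x = min a b" and "y = max a b"
      have xy: "e = {x, y}" "x < y" using ab by (auto simp: x_def y_def min_def max_def insert_commute)
      then have "x < L * Suc m" "y < L * Suc m" "adjacent N M x y"
        using e edge_wf[OF e] adjacent_iff[of x y] unfolding verts_G by blast+
      then have "(x, y) \<in> set ?f" using xy(2) by simp
      then show "e \<in> ?D ` set ?f" using xy(1) by (intro image_eqI[of _ _ "(x, y)"]) simp_all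
    qed
  qed
  moreover have "color G {u, v} = i" if "(u, v, i) \<in> set (edge_list N M)" for u v i
    using that by (auto simp: edge_list_def matrix_graph_def min_def)
  ultimately show ?thesis
    unfolding matrix_instance_def encodes_enc map set by (auto simp: verts_G)
qed

text \<open>Position \<open>3 * u + 2\<close> is private, so only row \<open>i\<close> can join this
  vertex to a shared one, and it does so exactly when it visits the shared vertex at the preceding
  position.\<close>

lemma entry_iff_edge:
  assumes "i < m" "u < N"
  shows "entry M i u \<longleftrightarrow> {3 * u + 1, L * Suc i + (3 * u + 2)} \<in> edges G"
proof
  have "(3 * u + 2) mod 3 = 2" by presburger
  then have rv2: "rv i (3 * u + 2) = L * Suc i + (3 * u + 2)" by (simp add: row_vertex_def)
  assume "entry M i u"
  then have "rv i (3 * u + 1) = 3 * u + 1" by (simp add: row_vertex_def Suc_times_mod_eq div_Suc)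
  then have "{3 * u + 1, L * Suc i + (3 * u + 2)} = {rv i (3 * u + 1), rv i (Suc (3 * u + 1))}"
    using rv2 by simp
  then have "{3 * u + 1, L * Suc i + (3 * u + 2)} \<in> path_edges (row_path N M i)"
    unfolding path_edges_row using assms(2) by (intro CollectI exI[of _ "3 * u + 1"]) simp
  then show "{3 * u + 1, L * Suc i + (3 * u + 2)} \<in> edges G" using assms(1) by (auto simp: edges_G)
next
  assume "{3 * u + 1, L * Suc i + (3 * u + 2)} \<in> edges G"
  then show "entry M i u"
  proof (cases rule: edge_cases)
    case (1 j)
    let ?y = "L * Suc i + (3 * u + 2)"
    have "(3 * u + 2) mod 3 = 2" by presburger
    then have "rv i (3 * u + 2) = ?y" "3 * u + 2 < L" using assms(2) by (auto simp: row_vertex_def)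
    then have y: "?y div L = Suc i" "L \<le> ?y"
      using rv_div[of "3 * u + 2" i] \<open>(3 * u + 2) mod 3 = 2\<close> by auto
    have "?y \<in> set (row_path N M j)" using 1(2) row_edge_in_path by (metis insert_commute)
    then obtain q where q: "q < L" "?y = rv j q" unfolding set_row_path by auto
    then have "Suc i = Suc j" using rv_private[OF q(1), of j] y by metis
    then have "3 * u + 1 \<in> set (row_path N M i)" using 1(2) row_edge_in_path by auto
    moreover have xL: "3 * u + 1 < L" using assms(2) by simp
    ultimately have "rv i (3 * u + 1) < L" using row_path_eq[of "3 * u + 1" i] by simp
    then show ?thesis using rv_less[OF xL] by (simp add: div_Suc Suc_times_mod_eq)
  next
    case 2
    then show ?thesis using assms(2) by (simp add: chord_def)
  qed
qed

lemma enumerate_paths_encoding: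
  assumes "encodes (enc (n, es, c, l)) G 3 L"
  shows "enumerate_paths (n, es, c, l) = map (row_path N M) [0..<m]"
proof -
  have x: "l = L" "n = L * Suc m" "edges G = (\<lambda>(u, v, i). {u, v}) ` set es"
    using assms unfolding encodes_enc by (auto simp: verts_G)
  have mem: "(\<exists>e \<in> set es. fst e = a \<and> fst (snd e) = b \<or> fst (snd e) = a \<and> fst e = b) \<longleftrightarrow> {a, b} \<in> edges G" for a b
    unfolding x(3) by (force simp: doubleton_eq_iff)
  have "m \<le> n" using N unfolding x(2) by (simp add: trans_le_add2)
  then have "[0..<n] = [0..<m] @ [m..<n]" by (metis le_add_diff_inverse upt_add_eq_append zero_le)
  moreover have "L * Suc i < n \<longleftrightarrow> i < m" for i
    unfolding x(2) using N by (simp only: mult_less_cancel1) simp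
  ultimately have rows: "filter (\<lambda>i. l * Suc i < n) [0..<n] = [0..<m]"
    unfolding x(1) by simp
  have "map (\<lambda>q. if q mod 3 \<noteq> 2 \<and> {3 * (q div 3) + 1, L * Suc i + (3 * (q div 3) + 2)} \<in> edges G
      then q else L * Suc i + q) [0..<L] = row_path N M i" if "i < m" for i
    unfolding row_path_def
  proof (rule map_cong[OF refl])
    fix q assume "q \<in> set [0..<L]"
    then have "q div 3 < N" by auto
    then show "(if q mod 3 \<noteq> 2 \<and> {3 * (q div 3) + 1, L * Suc i + (3 * (q div 3) + 2)} \<in> edges G
      then q else L * Suc i + q) = rv i q"
      using entry_iff_edge[OF that] by (simp add: row_vertex_def)
  qed
  then show ?thesis
    unfolding enumerate_paths_def prod.case rows unfolding mem x(1) by (intro map_cong[OF refl]) auto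
qed

end

definition matrix_instances :: "cpd_instance set" where
  "matrix_instances = {(matrix_graph N M, 3, 3 * N, k) | N M k. large_matrix N M}"

lemma matrix_instances_enumerable: "paths_enumerable_in_poly_time matrix_instances"
proof -
  obtain P a where P: "\<And>x. \<exists>t. run P (enc x) t (enc (enumerate_paths x)) \<and> t \<le> (tsize (enc x) + 2) ^ a"
    using polytime_run[OF pt_enumerate_paths] by blast
  have "\<exists>t ps. run P x t (enc_list (enc_list enc_nat) ps) \<and> t \<le> 3 ^ a * tsize x ^ a \<and>
      distinct (map path_graph ps) \<and> path_graph ` set ps = induced_colored_paths G c l \<and>
      (\<forall>p \<in> set ps. distinct p)"
    if I: "(G, c, l, k) \<in> matrix_instances" and x: "encodes x G c l" for G c l k x
  proof -
    obtain N M where NM: "large_matrix N M" "G = matrix_graph N M" "c = 3" "l = 3 * N"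
      using I unfolding matrix_instances_def by blast
    interpret large_matrix N M by fact
    obtain n :: nat and es :: "(nat \<times> nat \<times> nat) list" where x_eq: "x = enc (n, es, c, l)" using encodes_form[OF x] by blast
    then have ps: "enumerate_paths (n, es, c, l) = map (row_path N M) [0..<m]"
      using x NM by (intro enumerate_paths_encoding) simp
    obtain t where t: "run P x t (enc (map (row_path N M) [0..<m]))" "t \<le> (tsize x + 2) ^ a"
      using P[of "(n, es, c, l)"] unfolding ps x_eq by blast
    have "(tsize x + 2) ^ a \<le> (3 * tsize x) ^ a"
      using tsize_pos[of x] by (intro power_mono) auto
    then have "t \<le> 3 ^ a * tsize x ^ a" using t(2) by (simp add: power_mult_distrib)
    moreover have "distinct (map path_graph (map (row_path N M) [0..<m]))"
      using inj_row_graph by (simp add: distinct_map comp_def atLeast0LessThan)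
    moreover have "path_graph ` set (map (row_path N M) [0..<m]) = induced_colored_paths G c l"
      unfolding NM induced_colored_paths_G by (auto simp: atLeast0LessThan)
    ultimately show ?thesis
      using t(1) distinct_row_path unfolding enc_nat_eq enc_list_eq
      by (intro exI[of _ t] exI[of _ "map (row_path N M) [0..<m]"]) auto
  qed
  then show ?thesis unfolding paths_enumerable_in_poly_time_def by blast
qed

section \<open>Normal form of circuits of weft two\<close>

type_synonym literal = "nat \<times> bool"

text \<open>
  The fuel \<open>n\<close> and the polarity are known in advance, so the recursion over the circuit unfolds into a
  fixed program.
\<close>

primrec nf :: "(literal \<Rightarrow> 'r) \<Rightarrow> ('r \<Rightarrow> 'r \<Rightarrow> 'r) \<Rightarrow> ('r \<Rightarrow> 'r \<Rightarrow> 'r) \<Rightarrow>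
    (nat \<Rightarrow> bool \<Rightarrow> bool \<Rightarrow> circuit \<Rightarrow> nat list \<Rightarrow> 'r) \<Rightarrow> nat \<Rightarrow> bool \<Rightarrow> circuit \<Rightarrow> nat \<Rightarrow> 'r" where
  "nf lit con dis big 0 pol C g = lit (g, pol)"
| "nf lit con dis big (Suc n) pol C g =
     (case nth_or GInput C g of
        GInput \<Rightarrow> lit (g, pol)
      | GNot h \<Rightarrow> nf lit con dis big n (\<not> pol) C h
      | GAnd hs \<Rightarrow>
          if 2 < length hs then big n pol pol C hs
          else (if pol then con else dis)
            (nf lit con dis big n pol C (nth_or 0 hs 0)) (nf lit con dis big n pol C (nth_or 0 hs 1))
      | GOr hs \<Rightarrow>
          if 2 < length hs then big n (\<not> pol) pol C hs
          else (if pol then dis else con)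
            (nf lit con dis big n pol C (nth_or 0 hs 0)) (nf lit con dis big n pol C (nth_or 0 hs 1)))"

text \<open>Along every way down from \<open>g\<close> an input is reached within \<open>n\<close>
  steps and after at most \<open>j\<close> large gates; the recursion follows that of
  \<open>nf\<close>.\<close>

primrec fits :: "circuit \<Rightarrow> nat \<Rightarrow> nat \<Rightarrow> nat \<Rightarrow> bool" where
  "fits C 0 j g \<longleftrightarrow> C ! g = GInput"
| "fits C (Suc n) j g \<longleftrightarrow>
     (if large (C ! g) then 0 < j \<and> (\<forall>h \<in> set (in_nbrs (C ! g)). fits C n (j - 1) h)
      else \<forall>h \<in> set (in_nbrs (C ! g)). fits C n j h)"

lemma circuit_nbrs: "is_circuit C \<Longrightarrow> g < length C \<Longrightarrow> h \<in> set (in_nbrs (C ! g)) \<Longrightarrow> h < g"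
  unfolding is_circuit_def by blast

lemma circuit_fan_in: "is_circuit C \<Longrightarrow> g < length C \<Longrightarrow> fan_in_ok (C ! g)"
  unfolding is_circuit_def by blast

lemma nth_or_pair: "length hs = 2 \<Longrightarrow> set hs = {nth_or d hs 0, nth_or d hs 1}"
  by (auto simp: nth_or numeral_2_eq_2 length_Suc_conv)

text \<open>The target type and its semantics \<open>s\<close> are arbitrary, so one induction
  serves all three levels of the normal form. The budget \<open>j\<close> stays fixed because the
  recursion stops at a large gate and hands over to \<open>big\<close>; for \<open>j = 0\<close> the
  condition on \<open>big\<close> is void.\<close>

lemma nf_correct:
  assumes C: "is_circuit C" and v: "\<And>i. i < length C \<Longrightarrow> v i = gate_value (i \<in> A) v (C ! i)"
    and lit: "\<And>i b. s (lit (i, b)) \<longleftrightarrow> (i \<in> A) = b"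
    and con: "\<And>x y. s (con x y) \<longleftrightarrow> s x \<and> s y"
    and dis: "\<And>x y. s (dis x y) \<longleftrightarrow> s x \<or> s y"
    and big: "\<And>n b pol hs j'. j = Suc j' \<Longrightarrow> \<forall>h \<in> set hs. h < length C \<and> fits C n j' h \<Longrightarrow>
      s (big n b pol C hs) \<longleftrightarrow> (if b then \<forall>h \<in> set hs. v h = pol else \<exists>h \<in> set hs. v h = pol)"
  shows "g < length C \<Longrightarrow> fits C n j g \<Longrightarrow> s (nf lit con dis big n pol C g) \<longleftrightarrow> v g = pol"
proof (induction n arbitrary: g pol)
  case 0
  then show ?case using v[of g] lit by simp
next
  case (Suc n)
  have g: "nth_or GInput C g = C ! g" using Suc.prems(1) by (simp add: nth_or)
  have nbrs: "h < length C" if "h \<in> set (in_nbrs (C ! g))" for h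
    using circuit_nbrs[OF C Suc.prems(1) that] Suc.prems(1) by simp
  note vg = v[OF Suc.prems(1)]
  show ?case
  proof (cases "C ! g")
    case GInput
    then show ?thesis using vg lit by (simp add: g)
  next
    case (GNot h)
    then have "s (nf lit con dis big n (\<not> pol) C h) \<longleftrightarrow> v h = (\<not> pol)"
      using Suc.prems nbrs by (intro Suc.IH) (auto simp: large_def)
    then show ?thesis using vg GNot by (auto simp: g)
  next
    case (GAnd hs)
    show ?thesis
    proof (cases "2 < length hs")
      case True
      then have "large (C ! g)" using GAnd by (simp add: large_def)
      then have *: "j = Suc (j - 1)" "\<forall>h \<in> set hs. h < length C \<and> fits C n (j - 1) h"
        using Suc.prems(2) nbrs GAnd by simp_all
      have "s (big n pol pol C hs) \<longleftrightarrow> (if pol then \<forall>h \<in> set hs. v h = pol else \<exists>h \<in> set hs. v h = pol)"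
        by (rule big[OF *])
      then show ?thesis using True vg GAnd by (auto simp: g)
    next
      case False
      then have "length hs = 2" using circuit_fan_in[OF C Suc.prems(1)] GAnd by simp
      then obtain h1 h2 where hs: "hs = [h1, h2]" by (auto simp: numeral_2_eq_2 length_Suc_conv)
      have IH: "s (nf lit con dis big n pol C h) \<longleftrightarrow> v h = pol" if "h \<in> set hs" for h
        using Suc.prems(2) nbrs that GAnd False by (intro Suc.IH) (auto simp: large_def)
      have "v g \<longleftrightarrow> v h1 \<and> v h2" using vg GAnd hs by simp
      then show ?thesis using IH[of h1] IH[of h2] hs Suc.prems(1) by (cases pol) (simp_all add: g GAnd con dis nth_or)
    qed
  next
    case (GOr hs)
    show ?thesis
    proof (cases "2 < length hs")
      case True
      then have "large (C ! g)" using GOr by (simp add: large_def)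
      then have *: "j = Suc (j - 1)" "\<forall>h \<in> set hs. h < length C \<and> fits C n (j - 1) h"
        using Suc.prems(2) nbrs GOr by simp_all
      have "s (big n (\<not> pol) pol C hs) \<longleftrightarrow> (if \<not> pol then \<forall>h \<in> set hs. v h = pol else \<exists>h \<in> set hs. v h = pol)"
        by (rule big[OF *])
      then show ?thesis using True vg GOr by (auto simp: g)
    next
      case False
      then have "length hs = 2" using circuit_fan_in[OF C Suc.prems(1)] GOr by simp
      then obtain h1 h2 where hs: "hs = [h1, h2]" by (auto simp: numeral_2_eq_2 length_Suc_conv)
      have IH: "s (nf lit con dis big n pol C h) \<longleftrightarrow> v h = pol" if "h \<in> set hs" for h
        using Suc.prems(2) nbrs that GOr False by (intro Suc.IH) (auto simp: large_def)
      have "v g \<longleftrightarrow> v h1 \<or> v h2" using vg GOr hs by simp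
      then show ?thesis using IH[of h1] IH[of h2] hs Suc.prems(1) by (cases pol) (simp_all add: g GOr con dis nth_or)
    qed
  qed
qed

text \<open>The counterpart of \<open>nf_correct\<close> for syntactic properties that may weaken
  with each level of unfolding; it yields the bound on the width of terms.\<close>

lemma nf_invariant:
  assumes C: "is_circuit C"
    and lit: "\<And>n i b. i < length C \<Longrightarrow> Q n (lit (i, b))"
    and step: "\<And>n x. Q n x \<Longrightarrow> Q (Suc n) x"
    and con: "\<And>n x y. Q n x \<Longrightarrow> Q n y \<Longrightarrow> Q (Suc n) (con x y)"
    and dis: "\<And>n x y. Q n x \<Longrightarrow> Q n y \<Longrightarrow> Q (Suc n) (dis x y)"
    and big: "\<And>n b pol hs. \<forall>h \<in> set hs. h < length C \<Longrightarrow> Q (Suc n) (big n b pol C hs)"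
  shows "g < length C \<Longrightarrow> Q n (nf lit con dis big n pol C g)"
proof (induction n arbitrary: g pol)
  case 0
  then show ?case using lit by simp
next
  case (Suc n)
  have g: "nth_or GInput C g = C ! g" using Suc.prems by (simp add: nth_or)
  have nbrs: "h < length C" if "h \<in> set (in_nbrs (C ! g))" for h
    using circuit_nbrs[OF C Suc.prems(1) that] Suc.prems(1) by simp
  have two: "Q n (nf lit con dis big n pol C (nth_or 0 hs 0)) \<and> Q n (nf lit con dis big n pol C (nth_or 0 hs 1))"
    if "length hs = 2" "set hs \<subseteq> {..<length C}" for hs
    using that nth_or_pair[OF that(1), of 0] by (auto intro!: Suc.IH)
  show ?case
  proof (cases "C ! g")
    case GInput
    then show ?thesis using lit Suc.prems by (simp add: g)
  next
    case (GNot h)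
    then show ?thesis using step Suc.IH nbrs by (simp add: g)
  next
    case (GAnd hs)
    then show ?thesis
      using big[of hs] nbrs two[of hs] con dis circuit_fan_in[OF C Suc.prems(1)] by (auto simp: g subset_eq)
  next
    case (GOr hs)
    then show ?thesis
      using big[of hs] nbrs two[of hs] con dis circuit_fan_in[OF C Suc.prems(1)] by (auto simp: g subset_eq)
  qed
qed

lemma pt_comp2:
  assumes "polytime (\<lambda>z. f (fst z) (snd z))" "polytime a" "polytime b"
  shows "polytime (\<lambda>x. f (a x) (b x))"
  using pt_comp[OF assms(1) pt_Pair[OF assms(2,3)]] by simp

lemma pt_nf:
  assumes lit: "polytime lit"
    and con: "polytime (\<lambda>z. con (fst z) (snd z))"
    and dis: "polytime (\<lambda>z. dis (fst z) (snd z))"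
    and big: "\<And>n b pol. polytime (\<lambda>z. big n b pol (fst z) (snd z))"
  shows "polytime (\<lambda>z. nf lit con dis big n pol (fst z) (snd z))"
proof (induction n arbitrary: pol)
  case 0
  show ?case by (simp, intro pt_intros pt_comp[OF lit])
next
  case (Suc n)
  have op: "polytime (\<lambda>z. (if pol then con else dis) (fst z) (snd z))" for pol
    using con dis by simp
  have op': "polytime (\<lambda>z. (if pol then dis else con) (fst z) (snd z))" for pol
    using con dis by simp
  show ?case
    unfolding nf.simps
    by (intro pt_case_gate pt_if pt_less pt_length pt_nth_or pt_const pt_fst pt_snd pt_id pt_Pair
      pt_comp[OF lit] pt_comp2[OF big] pt_comp2[OF op] pt_comp2[OF op'] pt_comp2[OF Suc.IH])
qed

text \<open>Distributes one connective over the other. The same operation works at every nesting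
  depth, with the roles of conjunction and disjunction alternating.\<close>

definition append_all :: "'a list list \<Rightarrow> 'a list list \<Rightarrow> 'a list list" where
  "append_all xs ys = concat (map (\<lambda>x. map (\<lambda>y. x @ y) ys) xs)"

lemma set_append_all: "set (append_all xs ys) = {x @ y | x y. x \<in> set xs \<and> y \<in> set ys}"
  by (auto simp: append_all_def)

lemma pt_append_all [pt_intros]:
  assumes a: "polytime a" and b: "polytime b"
  shows "polytime (\<lambda>x. append_all (a x) (b x))"
  unfolding append_all_def by (intro pt_intros a pt_comp[OF b])

text \<open>Meant for gates without large gates on the way to the inputs, so the empty list for a
  large gate is a dummy value.\<close>

definition dnf :: "nat \<Rightarrow> bool \<Rightarrow> circuit \<Rightarrow> nat \<Rightarrow> literal list list" where
  "dnf = nf (\<lambda>l. [[l]]) append_all (@) (\<lambda>n b pol C hs. [])"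

text \<open>For one large gate on each way: a large conjunction collects the DNFs of its children, a
  large disjunction merges them into a single DNF. In \<open>or_and_dnf\<close>, for two large
  gates, the roles are exchanged one level up.\<close>

definition and_dnf :: "nat \<Rightarrow> bool \<Rightarrow> circuit \<Rightarrow> nat \<Rightarrow> literal list list list" where
  "and_dnf = nf (\<lambda>l. [[[l]]]) (@) append_all
     (\<lambda>n b pol C hs. if b then map (dnf n pol C) hs else [concat (map (dnf n pol C) hs)])"

definition or_and_dnf :: "nat \<Rightarrow> bool \<Rightarrow> circuit \<Rightarrow> nat \<Rightarrow> literal list list list list" where
  "or_and_dnf = nf (\<lambda>l. [[[[l]]]]) append_all (@)
     (\<lambda>n b pol C hs. if b then [concat (map (and_dnf n pol C) hs)] else map (and_dnf n pol C) hs)"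

lemma pt_or_and_dnf: "polytime (\<lambda>z. or_and_dnf n pol (fst z) (snd z))"
proof -
  have 0: "polytime (\<lambda>z. dnf n pol (fst z) (snd z))" for n pol
    unfolding dnf_def by (rule pt_nf) (intro pt_intros)+
  have 1: "polytime (\<lambda>z. and_dnf n pol (fst z) (snd z))" for n pol
    unfolding and_dnf_def by (rule pt_nf) (intro pt_intros pt_comp2[OF 0])+
  show ?thesis
    unfolding or_and_dnf_def by (rule pt_nf) (intro pt_intros pt_comp2[OF 1])+
qed

definition holds_dnf :: "nat set \<Rightarrow> literal list list \<Rightarrow> bool" where
  "holds_dnf A D \<longleftrightarrow> (\<exists>T \<in> set D. \<forall>l \<in> set T. (fst l \<in> A) = snd l)"

definition holds_and :: "nat set \<Rightarrow> literal list list list \<Rightarrow> bool" where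
  "holds_and A R \<longleftrightarrow> (\<forall>D \<in> set R. holds_dnf A D)"

definition holds_or :: "nat set \<Rightarrow> literal list list list list \<Rightarrow> bool" where
  "holds_or A J \<longleftrightarrow> (\<exists>R \<in> set J. holds_and A R)"

lemma holds_dnf_simps:
  "holds_dnf A [[(i, b)]] \<longleftrightarrow> (i \<in> A) = b"
  "holds_dnf A (append_all D E) \<longleftrightarrow> holds_dnf A D \<and> holds_dnf A E"
  "holds_dnf A (D @ E) \<longleftrightarrow> holds_dnf A D \<or> holds_dnf A E"
  "holds_dnf A (concat Ds) \<longleftrightarrow> (\<exists>D \<in> set Ds. holds_dnf A D)"
  by (fastforce simp: holds_dnf_def set_append_all)+

lemma holds_and_simps:
  "holds_and A [D] \<longleftrightarrow> holds_dnf A D"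
  "holds_and A (R @ S) \<longleftrightarrow> holds_and A R \<and> holds_and A S"
  "holds_and A (append_all R S) \<longleftrightarrow> holds_and A R \<or> holds_and A S"
  "holds_and A (concat Rs) \<longleftrightarrow> (\<forall>R \<in> set Rs. holds_and A R)"
  by (auto simp: holds_and_def set_append_all holds_dnf_simps) (metis holds_dnf_simps(3))+

lemma holds_or_simps:
  "holds_or A [R] \<longleftrightarrow> holds_and A R"
  "holds_or A (append_all J K) \<longleftrightarrow> holds_or A J \<and> holds_or A K"
  "holds_or A (J @ K) \<longleftrightarrow> holds_or A J \<or> holds_or A K"
  by (fastforce simp: holds_or_def set_append_all holds_and_simps)+

lemma holds_or_and_dnf:
  assumes C: "is_circuit C" and v: "\<And>i. i < length C \<Longrightarrow> v i = gate_value (i \<in> A) v (C ! i)"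
    and g: "g < length C" "fits C n 2 g"
  shows "holds_or A (or_and_dnf n pol C g) \<longleftrightarrow> v g = pol"
proof -
  have 0: "holds_dnf A (dnf n pol C g) \<longleftrightarrow> v g = pol" if "g < length C" "fits C n 0 g" for n pol g
    unfolding dnf_def by (rule nf_correct[OF C v]) (use that in \<open>auto simp: holds_dnf_simps\<close>)
  have 1: "holds_and A (and_dnf n pol C g) \<longleftrightarrow> v g = pol" if "g < length C" "fits C n 1 g" for n pol g
    unfolding and_dnf_def
  proof (rule nf_correct[OF C v, where j = 1])
    fix n b pol hs j'
    assume *: "1 = Suc j'" "\<forall>h \<in> set hs. h < length C \<and> fits C n j' h"
    then have "holds_dnf A (dnf n pol C h) \<longleftrightarrow> v h = pol" if "h \<in> set hs" for h
      using that by (intro 0) auto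
    then show "holds_and A (if b then map (dnf n pol C) hs else [concat (map (dnf n pol C) hs)]) \<longleftrightarrow>
      (if b then \<forall>h \<in> set hs. v h = pol else \<exists>h \<in> set hs. v h = pol)"
      by (auto simp: holds_and_simps holds_dnf_simps) (auto simp: holds_and_def)
  qed (use that in \<open>auto simp: holds_and_simps holds_dnf_simps\<close>)
  show ?thesis
    unfolding or_and_dnf_def
  proof (rule nf_correct[OF C v, where j = 2])
    fix n b pol hs j'
    assume *: "2 = Suc j'" "\<forall>h \<in> set hs. h < length C \<and> fits C n j' h"
    then have "holds_and A (and_dnf n pol C h) \<longleftrightarrow> v h = pol" if "h \<in> set hs" for h
      using that by (intro 1) (auto simp: numeral_2_eq_2)
    then show "holds_or A (if b then [concat (map (and_dnf n pol C) hs)] else map (and_dnf n pol C) hs) \<longleftrightarrow>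
      (if b then \<forall>h \<in> set hs. v h = pol else \<exists>h \<in> set hs. v h = pol)"
      by (auto simp: holds_and_simps holds_or_simps) (auto simp: holds_or_def)
  qed (use g in \<open>auto simp: holds_or_simps holds_and_simps holds_dnf_simps\<close>)
qed

definition narrow :: "nat \<Rightarrow> nat \<Rightarrow> literal list list \<Rightarrow> bool" where
  "narrow m w D \<longleftrightarrow> (\<forall>T \<in> set D. length T \<le> w \<and> (\<forall>l \<in> set T. fst l < m))"

lemma narrow_mono: "narrow m w D \<Longrightarrow> w \<le> w' \<Longrightarrow> narrow m w' D"
  unfolding narrow_def by (meson order_trans)

lemma narrow_append: "narrow m w D \<Longrightarrow> narrow m w E \<Longrightarrow> narrow m w (D @ E)"
  unfolding narrow_def by auto

text \<open>Only the conjunction of two DNFs concatenates terms, at most doubling the width per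
  level. Large gates, and all operations on the outer levels, merely regroup terms.\<close>

lemma or_and_dnf_narrow:
  assumes C: "is_circuit C" and g: "g < length C"
  shows "\<forall>R \<in> set (or_and_dnf n pol C g). \<forall>D \<in> set R. narrow (length C) (2 ^ n) D"
proof -
  have Suc: "narrow m (2 ^ n) D \<Longrightarrow> narrow m (2 ^ Suc n) D" for m n D
    by (erule narrow_mono) simp
  have 0: "narrow (length C) (2 ^ n) (dnf n pol C g)" if "g < length C" for n pol g
    unfolding dnf_def
  proof (rule nf_invariant[OF C, where Q = "\<lambda>n D. narrow (length C) (2 ^ n) D"])
    show "narrow (length C) (2 ^ Suc n) (append_all D E)"
      if "narrow (length C) (2 ^ n) D" "narrow (length C) (2 ^ n) E" for n D E
      using that unfolding narrow_def by (fastforce simp: set_append_all)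
    show "narrow (length C) (2 ^ Suc n) (D @ E)"
      if "narrow (length C) (2 ^ n) D" "narrow (length C) (2 ^ n) E" for n D E
      using that by (intro narrow_append Suc)
  qed (use that Suc in \<open>auto simp: narrow_def\<close>)
  have 1: "\<forall>D \<in> set (and_dnf n pol C g). narrow (length C) (2 ^ n) D" if "g < length C" for n pol g
    unfolding and_dnf_def
  proof (rule nf_invariant[OF C, where Q = "\<lambda>n R. \<forall>D \<in> set R. narrow (length C) (2 ^ n) D"])
    show "\<forall>D \<in> set (append_all R S). narrow (length C) (2 ^ Suc n) D"
      if "\<forall>D \<in> set R. narrow (length C) (2 ^ n) D" "\<forall>D \<in> set S. narrow (length C) (2 ^ n) D" for n R S
      using that by (auto simp: set_append_all intro!: narrow_append Suc simp del: power_Suc)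
    show "\<forall>D \<in> set (if b then map (dnf n pol C) hs else [concat (map (dnf n pol C) hs)]).
        narrow (length C) (2 ^ Suc n) D" if "\<forall>h \<in> set hs. h < length C" for n b pol hs
    proof -
      have "narrow (length C) (2 ^ Suc n) (dnf n pol C h)" if "h \<in> set hs" for h
        using Suc[OF 0] that \<open>\<forall>h \<in> set hs. h < length C\<close> by blast
      then show ?thesis by (auto simp: narrow_def)
    qed
  qed (use that Suc in \<open>auto simp: narrow_def[of _ _ "[[_]]"]\<close>)
  show ?thesis
    unfolding or_and_dnf_def
  proof (rule nf_invariant[OF C, where Q = "\<lambda>n J. \<forall>R \<in> set J. \<forall>D \<in> set R. narrow (length C) (2 ^ n) D"])
    show "\<forall>R \<in> set (append_all J K). \<forall>D \<in> set R. narrow (length C) (2 ^ Suc n) D"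
      if "\<forall>R \<in> set J. \<forall>D \<in> set R. narrow (length C) (2 ^ n) D"
        "\<forall>R \<in> set K. \<forall>D \<in> set R. narrow (length C) (2 ^ n) D" for n J K
      using that by (auto simp: set_append_all intro!: Suc simp del: power_Suc)
    show "\<forall>R \<in> set (if b then [concat (map (and_dnf n pol C) hs)] else map (and_dnf n pol C) hs).
        \<forall>D \<in> set R. narrow (length C) (2 ^ Suc n) D" if "\<forall>h \<in> set hs. h < length C" for n b pol hs
    proof -
      have "\<forall>D \<in> set (and_dnf n pol C h). narrow (length C) (2 ^ Suc n) D" if "h \<in> set hs" for h
        using Suc 1 that \<open>\<forall>h \<in> set hs. h < length C\<close> by blast
      then show ?thesis by auto
    qed
  qed (use g Suc in \<open>auto simp: narrow_def[of _ _ "[[_]]"]\<close>)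
qed

section \<open>Evaluation of circuits; depth and weft along paths\<close>

lemma gate_value_cong:
  "(\<And>j. j \<in> set (in_nbrs g) \<Longrightarrow> v j = w j) \<Longrightarrow> gate_value b v g = gate_value b w g"
  by (cases g) auto

text \<open>\<open>circuit_satisfied\<close> asks for some evaluation, so a true normal form implies
  satisfaction only if one exists. It is built in topological order, where a new value does not
  affect earlier gates.\<close>

lemma circuit_values_exist:
  assumes C: "is_circuit C"
  shows "\<exists>v. \<forall>i < length C. v i = gate_value (i \<in> A) v (C ! i)"
proof -
  have "\<exists>v. \<forall>i < n. v i = gate_value (i \<in> A) v (C ! i)" if "n \<le> length C" for n
    using that
  proof (induction n)
    case (Suc n)
    then obtain v where v: "\<And>i. i < n \<Longrightarrow> v i = gate_value (i \<in> A) v (C ! i)" by auto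
    let ?w = "v(n := gate_value (n \<in> A) v (C ! n))"
    have "gate_value (i \<in> A) ?w (C ! i) = gate_value (i \<in> A) v (C ! i)" if "i < Suc n" for i
      using circuit_nbrs[OF C, of i] that Suc.prems by (intro gate_value_cong) fastforce
    then have "?w i = gate_value (i \<in> A) ?w (C ! i)" if "i < Suc n" for i
      using that v[of i] by (cases "i = n") (simp_all del: fun_upd_apply, simp_all)
    then show ?case by blast
  qed simp
  then show ?thesis by blast
qed

text \<open>Depth and weft count paths starting at inputs, whereas the unfolding starts at the
  output. A tail path is the part walked so far; it extends to a full path because every gate other
  than an input has an in-neighbour.\<close>

definition tail_path :: "circuit \<Rightarrow> nat list \<Rightarrow> bool" where
  "tail_path C p \<longleftrightarrow> p \<noteq> [] \<and> set p \<subseteq> {..<length C} \<and> last p = circuit_output C \<and>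
     (\<forall>i. Suc i < length p \<longrightarrow> p ! i \<in> set (in_nbrs (C ! (p ! Suc i))))"

lemma tail_path_hd: "tail_path C p \<Longrightarrow> hd p < length C"
  unfolding tail_path_def by (meson hd_in_set lessThan_iff subsetD)

lemma tail_path_Cons:
  assumes C: "is_circuit C" and p: "tail_path C p" and h: "h \<in> set (in_nbrs (C ! hd p))"
  shows "tail_path C (h # p)"
proof -
  have "hd p < length C" using tail_path_hd[OF p] .
  then have "h < length C" using circuit_nbrs[OF C _ h] by simp
  moreover have "(h # p) ! i \<in> set (in_nbrs (C ! ((h # p) ! Suc i)))" if "Suc i < length (h # p)" for i
    using that p h by (cases i) (auto simp: tail_path_def hd_conv_nth)
  ultimately show ?thesis using p by (auto simp: tail_path_def)
qed

lemma tail_path_extend: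
  assumes C: "is_circuit C"
  shows "tail_path C p \<Longrightarrow> \<exists>q. q @ p \<in> circuit_paths C"
proof (induction "hd p" arbitrary: p rule: less_induct)
  case less
  have hd: "hd p < length C" using tail_path_hd[OF less.prems] .
  show ?case
  proof (cases "C ! hd p = GInput")
    case True
    then have "[] @ p \<in> circuit_paths C"
      using less.prems hd by (auto simp: circuit_paths_def tail_path_def circuit_inputs_def)
    then show ?thesis by blast
  next
    case False
    then have "in_nbrs (C ! hd p) \<noteq> []" using circuit_fan_in[OF C hd] by (cases "C ! hd p") auto
    then obtain h where h: "h \<in> set (in_nbrs (C ! hd p))" by (meson list.set_sel(1))
    then obtain q where "q @ h # p \<in> circuit_paths C"
      using less.hyps[of "h # p"] tail_path_Cons[OF C less.prems h] circuit_nbrs[OF C hd h] by auto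
    then have "(q @ [h]) @ p \<in> circuit_paths C" by simp
    then show ?thesis by blast
  qed
qed

text \<open>Needed for \<open>Max\<close> in \<open>depth\<close> and \<open>weft\<close> to be an
  upper bound. Positions increase strictly along a path, so no node repeats.\<close>

lemma finite_circuit_paths:
  assumes C: "is_circuit C"
  shows "finite (circuit_paths C)"
proof (rule finite_subset)
  show "circuit_paths C \<subseteq> {p. set p \<subseteq> {..<length C} \<and> distinct p}"
  proof
    fix p assume p: "p \<in> circuit_paths C"
    have "p ! i < p ! Suc i" if i: "Suc i < length p" for i
    proof (rule circuit_nbrs[OF C])
      show "p ! Suc i < length C" using p nth_mem[OF i] by (auto simp: circuit_paths_def)
      show "p ! i \<in> set (in_nbrs (C ! (p ! Suc i)))" using p i by (simp add: circuit_paths_def)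
    qed
    then have "sorted_wrt (<) p" by (subst sorted_wrt_iff_nth_Suc_transp) auto
    then have "distinct p" by (simp add: strict_sorted_iff)
    then show "p \<in> {p. set p \<subseteq> {..<length C} \<and> distinct p}" using p by (simp add: circuit_paths_def)
  qed
qed (rule finite_subset_distinct, simp)

lemma output_fits:
  assumes C: "is_circuit C" and d: "depth C \<le> d" and w: "weft C \<le> w"
  shows "fits C d w (circuit_output C)"
proof -
  let ?large = "\<lambda>p. length (filter (\<lambda>i. large (C ! i)) p)"
  have depth: "length p - 1 \<le> d" if p: "tail_path C p" for p
  proof -
    obtain q where "q @ p \<in> circuit_paths C" using tail_path_extend[OF C p] by blast
    then have "length (q @ p) - 1 \<le> depth C"
      unfolding depth_def
      by (intro Max_ge[OF finite_imageI[OF finite_circuit_paths[OF C]]] image_eqI[OF refl])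
    then show ?thesis using d by simp
  qed
  have weft: "?large p \<le> w" if p: "tail_path C p" for p
  proof -
    obtain q where "q @ p \<in> circuit_paths C" using tail_path_extend[OF C p] by blast
    then have "?large (q @ p) \<le> weft C"
      unfolding weft_def
      by (intro Max_ge[OF finite_imageI[OF finite_circuit_paths[OF C]]] image_eqI[OF refl])
    then show ?thesis using w by simp
  qed
  \<comment> \<open>\<open>p\<close> has been walked back from the output to \<open>hd p\<close>.
    Its head is left out of the count of large gates because \<open>fits\<close> charges for it now.
    Running out of fuel or budget would give a tail path longer than \<open>d\<close> or with more
    than \<open>w\<close> large gates.\<close>
  have "fits C n j (hd p)"
    if "tail_path C p" "d \<le> length p - 1 + n" "w \<le> ?large (tl p) + j" for n j p
    using that
  proof (induction n arbitrary: j p)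
    case 0
    have hd: "hd p < length C" using tail_path_hd[OF 0(1)] .
    show ?case
    proof (rule ccontr)
      assume "\<not> ?case"
      then have "in_nbrs (C ! hd p) \<noteq> []" using circuit_fan_in[OF C hd] by (cases "C ! hd p") auto
      then obtain h where h: "h \<in> set (in_nbrs (C ! hd p))" by (meson list.set_sel(1))
      have "length p - 1 < length (h # p) - 1" using 0(1) by (cases p) (auto simp: tail_path_def)
      then show False using depth[OF tail_path_Cons[OF C 0(1) h]] 0(2) by simp
    qed
  next
    case (Suc n)
    obtain g r where p: "p = g # r" using Suc.prems(1) by (cases p) (auto simp: tail_path_def)
    have "?large p \<le> w" using weft[OF Suc.prems(1)] .
    then have j: "0 < j" if "large (C ! g)" using that Suc.prems(3) by (simp add: p)
    have "fits C n j' h" if h: "h \<in> set (in_nbrs (C ! g))" and j': "w \<le> ?large p + j'" for h j'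
      using Suc.IH[of "h # p" j'] tail_path_Cons[OF C Suc.prems(1)] h j' Suc.prems(2) by (simp add: p)
    then show ?case using j Suc.prems(3) by (auto simp: p)
  qed
  from this[of "[circuit_output C]" d w] show ?thesis
    using C by (auto simp: tail_path_def circuit_output_def is_circuit_def)
qed

lemma circuit_satisfied_iff:
  assumes C: "is_circuit C" and d: "depth C \<le> d" and w: "weft C \<le> 2"
  shows "circuit_satisfied C A \<longleftrightarrow> holds_or A (or_and_dnf d True C (circuit_output C))"
proof -
  have out: "circuit_output C < length C" using C by (auto simp: is_circuit_def circuit_output_def)
  have "holds_or A (or_and_dnf d True C (circuit_output C)) \<longleftrightarrow> v (circuit_output C)"
    if "\<forall>i < length C. v i = gate_value (i \<in> A) v (C ! i)" for v
    using holds_or_and_dnf[OF C _ out output_fits[OF C d w], of v A True] that by simp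
  then show ?thesis
    unfolding circuit_satisfied_def using circuit_values_exist[OF C, of A] by blast
qed

section \<open>From normal forms to hitting sets\<close>

text \<open>
  A set \<open>x\<^sub>1 < \<dots> < x\<^sub>k\<close> of inputs is coded by its gaps: gap \<open>p\<close> is the triple \<open>(p, a, b)\<close> with
  \<open>a = x\<^sub>p + 1\<close> and \<open>b = x\<^sub>p\<^sub>+\<^sub>1 + 1\<close>, where \<open>0\<close> and \<open>m + 1\<close> bound the first and the last gap. Both a
  positive and a negative literal then hold iff some single gap witnesses them.
\<close>

definition gap_triples :: "nat \<Rightarrow> nat \<Rightarrow> nat list \<Rightarrow> (nat \<times> nat \<times> nat) list" where
  "gap_triples k m I =
     filter (\<lambda>x. fst (snd x) < snd (snd x) \<and> (fst x = 0 \<longrightarrow> fst (snd x) = 0) \<and>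
         (fst x = k \<longrightarrow> snd (snd x) = Suc m))
       (List.product [0..<Suc k] (List.product (0 # map Suc I) (map Suc I @ [Suc m])))"

text \<open>A chosen input is the upper end of the gap before it, so looking at upper ends suffices
  for positive literals; the upper end \<open>m + 1\<close> of the last gap belongs to no
  input.\<close>

definition witnesses :: "nat \<times> nat \<times> nat \<Rightarrow> literal \<Rightarrow> bool" where
  "witnesses x l =
     (if snd l then snd (snd x) = Suc (fst l) else fst (snd x) < Suc (fst l) \<and> Suc (fst l) < snd (snd x))"

text \<open>
  A term of width at most \<open>w\<close> is witnessed by \<open>w\<close> gaps at once, hence the elements: a disjunct \<open>j\<close> of
  the normal form with a \<open>w\<close>-tuple of gaps. One element is to be chosen for each tuple of gap numbers.
\<close>

type_synonym element = "nat \<times> (nat \<times> nat \<times> nat) list"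

definition slot :: "element \<Rightarrow> nat list" where
  "slot e = map fst (snd e)"

definition compatible :: "element \<Rightarrow> element \<Rightarrow> bool" where
  "compatible e f \<longleftrightarrow> fst e = fst f \<and> (\<forall>x \<in> set (snd e). \<forall>y \<in> set (snd f).
     (fst x = fst y \<longrightarrow> fst (snd x) = fst (snd y) \<and> snd (snd x) = snd (snd y)) \<and>
     (Suc (fst x) = fst y \<longrightarrow> fst (snd y) = snd (snd x)))"

text \<open>A tuple may mention the same or adjacent gap numbers several times;
  \<open>compatible e e\<close> keeps only the tuples that do not contradict themselves.\<close>

definition elements :: "nat \<Rightarrow> nat \<Rightarrow> nat \<Rightarrow> nat list \<Rightarrow> nat \<Rightarrow> element list" where
  "elements w k m I J =
     filter (\<lambda>e. compatible e e) (List.product [0..<J] (List.n_lists w (gap_triples k m I)))"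

definition slots :: "nat \<Rightarrow> nat \<Rightarrow> nat list list" where
  "slots w k = List.n_lists w [0..<Suc k]"

text \<open>The positive form of: if \<open>e\<close> is chosen, the choice in slot \<open>s\<close>
  is compatible with \<open>e\<close>. With one choice per slot, a choice in the slot of
  \<open>e\<close> that is incompatible with \<open>e\<close> shows that \<open>e\<close> is not
  chosen.\<close>

definition follows :: "element \<Rightarrow> nat list \<Rightarrow> element \<Rightarrow> bool" where
  "follows e s f \<longleftrightarrow> slot f = slot e \<and> \<not> compatible e f \<or> slot f = s \<and> compatible e f"

text \<open>An element of another disjunct meets the demand for free; once all choices agree on a
  disjunct, only its own DNFs constrain them.\<close>

definition satisfies :: "nat \<Rightarrow> literal list list \<Rightarrow> element \<Rightarrow> bool" where
  "satisfies j D f \<longleftrightarrow> fst f \<noteq> j \<or> (\<exists>T \<in> set D. \<forall>l \<in> set T. \<exists>x \<in> set (snd f). witnesses x l)"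

definition hitting_rows :: "nat list list \<Rightarrow> literal list list list list \<Rightarrow> element list \<Rightarrow> bool list list" where
  "hitting_rows Ss J U =
     map (\<lambda>s. map (\<lambda>f. slot f = s) U) Ss @
     map (\<lambda>p. map (\<lambda>f. follows (fst p) (snd p) f) U) (List.product U Ss) @
     concat (map (\<lambda>j. map (\<lambda>D. map (\<lambda>f. satisfies j D f) U) (nth_or [] J j)) [0..<length J])"

lemma pt_n_lists [pt_intros]:
  assumes a: "polytime a"
  shows "polytime (\<lambda>x. List.n_lists n (a x))"
  by (induction n) (simp_all, intro pt_intros, intro pt_intros pt_comp[OF a])

lemma pt_elements [pt_intros]:
  assumes k: "polytime k" and m: "polytime m" and I: "polytime I" and J: "polytime J"
  shows "polytime (\<lambda>x. elements w (k x) (m x) (I x) (J x))"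
  unfolding elements_def gap_triples_def compatible_def
  by (intro pt_intros pt_comp[OF k] pt_comp[OF m] pt_comp[OF I] pt_comp[OF J])

lemma pt_slots [pt_intros]: "polytime k \<Longrightarrow> polytime (\<lambda>x. slots w (k x))"
  unfolding slots_def by (intro pt_intros)

lemma pt_hitting_rows [pt_intros]:
  assumes S: "polytime S" and J: "polytime J" and U: "polytime U"
  shows "polytime (\<lambda>x. hitting_rows (S x) (J x) (U x))"
  unfolding hitting_rows_def follows_def satisfies_def slot_def compatible_def witnesses_def
  by (intro pt_intros pt_comp[OF S] pt_comp[OF J] pt_comp[OF U])

text \<open>Columns beyond \<open>length U\<close> are empty, since \<open>nth_or\<close> returns
  False there; they allow padding to the five columns that the graph requires.\<close>

lemma hitting_set_columns_iff:
  assumes N: "length U \<le> N" and rows: "set rows = (\<lambda>P. map P U) ` \<P>"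
  shows "(\<exists>H \<subseteq> {..<N}. card H \<le> K \<and> (\<forall>r \<in> set rows. \<exists>u \<in> H. nth_or False r u)) \<longleftrightarrow>
    (\<exists>H \<subseteq> set U. card H \<le> K \<and> (\<forall>P \<in> \<P>. \<exists>f \<in> H. P f))"
proof
  assume "\<exists>H \<subseteq> {..<N}. card H \<le> K \<and> (\<forall>r \<in> set rows. \<exists>u \<in> H. nth_or False r u)"
  then obtain H where H: "H \<subseteq> {..<N}" "card H \<le> K" "\<And>r. r \<in> set rows \<Longrightarrow> \<exists>u \<in> H. nth_or False r u"
    by blast
  let ?H = "(!) U ` (H \<inter> {..<length U})"
  have "finite H" using H(1) finite_subset by blast
  then have "card ?H \<le> card (H \<inter> {..<length U})" by (intro card_image_le) simp
  also have "\<dots> \<le> K" using card_mono[OF \<open>finite H\<close>, of "H \<inter> {..<length U}"] H(2) by simp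
  finally have "card ?H \<le> K" .
  moreover have "\<exists>f \<in> ?H. P f" if P: "P \<in> \<P>" for P
  proof -
    have "map P U \<in> set rows" unfolding rows using P by (rule imageI)
    from H(3)[OF this] obtain u where "u \<in> H" "nth_or False (map P U) u" by (elim bexE)
    then show ?thesis by (auto simp: nth_or split: if_splits)
  qed
  ultimately show "\<exists>H \<subseteq> set U. card H \<le> K \<and> (\<forall>P \<in> \<P>. \<exists>f \<in> H. P f)"
    by (intro exI[of _ ?H]) auto
next
  assume "\<exists>H \<subseteq> set U. card H \<le> K \<and> (\<forall>P \<in> \<P>. \<exists>f \<in> H. P f)"
  then obtain H where H: "H \<subseteq> set U" "card H \<le> K" "\<And>P. P \<in> \<P> \<Longrightarrow> \<exists>f \<in> H. P f" by blast
  have "\<forall>f \<in> set U. \<exists>u < length U. U ! u = f" by (simp add: in_set_conv_nth)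
  then obtain g where g: "\<And>f. f \<in> set U \<Longrightarrow> g f < length U \<and> U ! g f = f" by metis
  have "finite H" using H(1) finite_subset by blast
  then have "card (g ` H) \<le> K" using card_image_le[of H g] H(2) by linarith
  moreover have "g ` H \<subseteq> {..<N}" using g H(1) N by fastforce
  moreover have "\<exists>u \<in> g ` H. nth_or False r u" if r: "r \<in> set rows" for r
  proof -
    obtain P where P: "P \<in> \<P>" "r = map P U" using r rows by auto
    then obtain f where "f \<in> H" "P f" using H(3) by blast
    then show ?thesis using g[of f] H(1) P(2) by (intro bexI[of _ "g f"]) (auto simp: nth_or)
  qed
  ultimately show "\<exists>H \<subseteq> {..<N}. card H \<le> K \<and> (\<forall>r \<in> set rows. \<exists>u \<in> H. nth_or False r u)"
    by (intro exI[of _ "g ` H"] conjI ballI)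
qed

lemma set_hitting_rows:
  "set (hitting_rows Ss J U) = (\<lambda>P. map P U) `
     ((\<lambda>s f. slot f = s) ` set Ss \<union> (\<lambda>(e, s). follows e s) ` (set U \<times> set Ss) \<union>
      (\<lambda>(j, D). satisfies j D) ` (SIGMA j:{..<length J}. set (J ! j)))"
proof -
  have "set (concat (map (\<lambda>j. map (\<lambda>D. map (satisfies j D) U) (nth_or [] J j)) [0..<length J])) =
    (\<lambda>P. map P U) ` (\<lambda>(j, D). satisfies j D) ` (SIGMA j:{..<length J}. set (J ! j))"
    by (force simp: nth_or)
  then show ?thesis
    unfolding hitting_rows_def set_append image_Un set_map set_product image_image
    by (auto simp: case_prod_beta)
qed

lemma set_elements:
  "set (elements w k m I J) = {e. compatible e e \<and> fst e < J \<and> length (snd e) = w \<and>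
     set (snd e) \<subseteq> set (gap_triples k m I)}"
  by (force simp: elements_def set_n_lists)

lemma set_gap_triples:
  "x \<in> set (gap_triples k m I) \<longleftrightarrow> fst x \<le> k \<and> fst (snd x) \<in> insert 0 (Suc ` set I) \<and>
     snd (snd x) \<in> insert (Suc m) (Suc ` set I) \<and> fst (snd x) < snd (snd x) \<and>
     (fst x = 0 \<longrightarrow> fst (snd x) = 0) \<and> (fst x = k \<longrightarrow> snd (snd x) = Suc m)"
  by (cases x) (auto simp: gap_triples_def)

lemma set_slots: "set (slots w k) = {s. length s = w \<and> set s \<subseteq> {..k}}"
  by (auto simp: slots_def set_n_lists simp del: upt_Suc)

lemma length_slots: "length (slots w k) = Suc k ^ w"
  by (simp add: slots_def length_n_lists del: upt_Suc)

lemma card_slots: "card (set (slots w k)) = Suc k ^ w"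
  using distinct_card[of "slots w k"] by (simp add: slots_def distinct_n_lists length_n_lists del: upt_Suc)

lemma slot_element: "e \<in> set (elements w k m I J) \<Longrightarrow> slot e \<in> set (slots w k)"
  unfolding set_elements set_slots slot_def by (auto simp: set_gap_triples subset_eq)

section \<open>Selections of elements and sets of inputs\<close>

lemma discrete_crossing:
  fixes f :: "nat \<Rightarrow> nat"
  assumes "f 0 < c" "c < f (Suc n)" "\<And>p. p \<le> n \<Longrightarrow> f p \<noteq> c"
  shows "\<exists>p \<le> n. f p < c \<and> c < f (Suc p)"
  using assms
proof (induction n)
  case (Suc n)
  show ?case
  proof (cases "c < f (Suc n)")
    case True
    then show ?thesis using Suc by (meson le_SucI)
  next
    case False
    then show ?thesis using Suc.prems(2) Suc.prems(3)[of "Suc n"] by (intro exI[of _ "Suc n"]) auto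
  qed
qed auto

locale gap_code =
  fixes w k m :: nat and I :: "nat list" and J :: "literal list list list list"
  assumes w: "1 \<le> w" and I: "set I \<subseteq> {..<m}"
    and J: "\<And>R D. R \<in> set J \<Longrightarrow> D \<in> set R \<Longrightarrow> narrow m w D"
begin

abbreviation "U \<equiv> elements w k m I (length J)"

text \<open>There are as many slots as the budget allows elements and each slot is hit, so each has
  exactly one element. \<open>follows\<close> makes these pairwise compatible, so together they
  describe a single chain of \<open>k + 1\<close> gaps.\<close>

lemma selection_sound:
  assumes H: "H \<subseteq> set U" "card H \<le> Suc k ^ w"
    and slots: "\<And>s. s \<in> set (slots w k) \<Longrightarrow> \<exists>f \<in> H. slot f = s"
    and follows: "\<And>e s. e \<in> set U \<Longrightarrow> s \<in> set (slots w k) \<Longrightarrow> \<exists>f \<in> H. follows e s f"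
    and satisfies: "\<And>j D. j < length J \<Longrightarrow> D \<in> set (J ! j) \<Longrightarrow> \<exists>f \<in> H. satisfies j D f"
  shows "\<exists>A \<subseteq> set I. card A = k \<and> holds_or A J"
proof -
  have fin: "finite H" using H(1) finite_subset by blast
  have slot_H: "slot f \<in> set (slots w k)" if "f \<in> H" for f
    using that H(1) slot_element by blast
  have "set (slots w k) \<subseteq> slot ` H" using slots by blast
  then have "Suc k ^ w \<le> card (slot ` H)" using fin card_mono[of "slot ` H"] card_slots by (metis finite_imageI)
  then have inj: "inj_on slot H"
    using H(2) card_image_le[OF fin, of slot] by (intro eq_card_imp_inj_on[OF fin]) linarith
  have compat: "compatible e f" if ef: "e \<in> H" "f \<in> H" for e f
  proof -
    obtain f' where f': "f' \<in> H" "follows e (slot f) f'"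
      using follows[of e "slot f"] ef H(1) slot_H by blast
    have "compatible e e" using ef(1) H(1) by (auto simp: set_elements)
    then show ?thesis using f' ef inj unfolding follows_def by (metis inj_onD)
  qed
  \<comment> \<open>Gap \<open>p\<close> occurs in the element of the constant slot, which is a
    non-empty tuple because \<open>w\<close> is positive.\<close>
  have "\<exists>x. fst x = p \<and> (\<exists>e \<in> H. x \<in> set (snd e))" if p: "p \<le> k" for p
  proof -
    have "replicate w p \<in> set (slots w k)" using p by (auto simp: set_slots)
    then obtain e where e: "e \<in> H" "slot e = replicate w p" using slots by blast
    then have "p \<in> fst ` set (snd e)" using w unfolding slot_def
      by (metis One_nat_def Suc_le_D in_set_replicate list.set_map nat.simps(3))
    then show ?thesis using e(1) by blast
  qed
  then obtain gap where gap: "\<And>p. p \<le> k \<Longrightarrow> fst (gap p) = p \<and> (\<exists>e \<in> H. gap p \<in> set (snd e))"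
    by metis
  define a b where "a p = fst (snd (gap p))" and "b p = snd (snd (gap p))" for p
  have triple: "fst x \<le> k" "x = (fst x, a (fst x), b (fst x))" if x: "e \<in> H" "x \<in> set (snd e)" for e x
  proof -
    show "fst x \<le> k" using x H(1) by (auto simp: set_elements set_gap_triples subset_eq)
    then obtain e' where "e' \<in> H" "gap (fst x) \<in> set (snd e')" "fst (gap (fst x)) = fst x"
      using gap by blast
    then show "x = (fst x, a (fst x), b (fst x))"
      using compat[of e e'] x unfolding compatible_def a_def b_def by (auto simp: prod_eq_iff)
  qed
  have valid: "gap p \<in> set (gap_triples k m I)" if "p \<le> k" for p
    using gap[OF that] H(1) by (auto simp: set_elements)
  have chain: "a (Suc p) = b p" if p: "Suc p \<le> k" for p
  proof -
    obtain e e' where "e \<in> H" "gap p \<in> set (snd e)" "e' \<in> H" "gap (Suc p) \<in> set (snd e')"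
      using gap[of p] gap[of "Suc p"] p by auto
    then show ?thesis using compat[of e e'] gap[of p] gap[of "Suc p"] p
      unfolding compatible_def a_def b_def by auto
  qed
  have ab: "a p < b p" "a p \<in> insert 0 (Suc ` set I)" if "p \<le> k" for p
    using valid[OF that] unfolding set_gap_triples a_def b_def by auto
  have bk: "b k = Suc m"
    using valid[of k] gap[of k] unfolding set_gap_triples b_def by auto
  have mono: "b p \<le> a p'" if "p < p'" "p' \<le> k" for p p'
    using that
  proof (induction p')
    case (Suc p')
    show ?case
    proof (cases "p = p'")
      case True
      then show ?thesis using chain[of p'] Suc.prems by simp
    next
      case False
      then show ?thesis using Suc ab(1)[of p'] chain[of p'] by simp
    qed
  qed simp
  define A where "A = {v. \<exists>p < k. b p = Suc v}"
  \<comment> \<open>The upper end of a gap other than the last is also the lower end of the next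
    one. Lower ends are never the bound \<open>m + 1\<close>, and this one exceeds
    \<open>a p\<close> and so is not 0; hence it stems from an input.\<close>
  have b_input: "b p \<in> Suc ` set I" if "p < k" for p
    using chain[of p] ab(2)[of "Suc p"] ab(1)[of p] that by auto
  have "A \<subseteq> set I" using b_input by (force simp: A_def)
  moreover have "card A = k"
  proof -
    have "inj_on (\<lambda>p. b p - 1) {..<k}"
    proof (rule linorder_inj_onI)
      fix p p' assume "p < p'" "p \<in> {..<k}" "p' \<in> {..<k}"
      then have "b p < b p'" "0 < b p" using mono[of p p'] ab(1)[of p'] ab(1)[of p] by auto
      then show "b p - 1 \<noteq> b p' - 1" by linarith
    qed auto
    moreover have "A = (\<lambda>p. b p - 1) ` {..<k}"
    proof -
      have "b p = Suc (b p - 1)" if "p < k" for p using ab(1)[of p] that by simp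
      then show ?thesis unfolding A_def by force
    qed
    ultimately show ?thesis by (simp add: card_image)
  qed
  moreover have wit: "(fst l \<in> A) = snd l"
    if x: "e \<in> H" "x \<in> set (snd e)" "witnesses x l" and l: "fst l < m" for e x l
  proof -
    obtain p where p: "p \<le> k" "x = (p, a p, b p)" using triple[OF x(1,2)] by blast
    show ?thesis
    proof (cases "snd l")
      case True
      then have b: "b p = Suc (fst l)" using x(3) p(2) by (simp add: witnesses_def)
      then have "p < k" using bk l p(1) by (cases "p = k") auto
      then show ?thesis using b True by (auto simp: A_def)
    next
      case False
      then have bet: "a p < Suc (fst l)" "Suc (fst l) < b p" using x(3) p(2) by (auto simp: witnesses_def)
      have "fst l \<notin> A"
      proof
        assume "fst l \<in> A"
        then obtain p' where p': "p' < k" "b p' = Suc (fst l)" by (auto simp: A_def)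
        consider "p' < p" | "p' = p" | "p < p'" by linarith
        then show False
        proof cases
          case 1
          then show False using mono[of p' p] p(1) p' bet by simp
        next
          case 2
          then show False using p' bet by simp
        next
          case 3
          then show False using mono[of p p'] ab(1)[of p'] p' bet by simp
        qed
      qed
      then show ?thesis using False by simp
    qed
  qed
  moreover have "holds_or A J"
  proof -
    have "replicate w 0 \<in> set (slots w k)" by (auto simp: set_slots)
    then obtain e where e: "e \<in> H" using slots by blast
    define j where "j = fst e"
    have same: "fst f = j" if "f \<in> H" for f
      using compat[OF e that] by (simp add: compatible_def j_def)
    have j: "j < length J" using e H(1) by (auto simp: j_def set_elements)
    have "holds_dnf A D" if D: "D \<in> set (J ! j)" for D
    proof -
      obtain f where f: "f \<in> H" "satisfies j D f" using satisfies[OF j D] by blast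
      then obtain T where T: "T \<in> set D" "\<forall>l \<in> set T. \<exists>x \<in> set (snd f). witnesses x l"
        using same[OF f(1)] unfolding satisfies_def by blast
      have "narrow m w D" using J[OF nth_mem[OF j] D] .
      then have "fst l < m" if "l \<in> set T" for l using T(1) that by (auto simp: narrow_def)
      then show ?thesis using T wit f(1) unfolding holds_dnf_def by blast
    qed
    then show ?thesis using j nth_mem unfolding holds_or_def holds_and_def by blast
  qed
  ultimately show ?thesis by blast
qed

text \<open>The chain of gaps of \<open>A\<close> fills every slot, with the same disjunct
  throughout.\<close>

lemma selection_complete:
  assumes A: "A \<subseteq> set I" "card A = k" "holds_or A J"
  shows "\<exists>H \<subseteq> set U. card H \<le> Suc k ^ w \<and> (\<forall>s \<in> set (slots w k). \<exists>f \<in> H. slot f = s) \<and>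
    (\<forall>e \<in> set U. \<forall>s \<in> set (slots w k). \<exists>f \<in> H. follows e s f) \<and>
    (\<forall>j < length J. \<forall>D \<in> set (J ! j). \<exists>f \<in> H. satisfies j D f)"
proof -
  obtain j where j: "j < length J" "holds_and A (J ! j)"
    using A(3) unfolding holds_or_def by (metis in_set_conv_nth)
  have fin: "finite A" using A(1) finite_subset by blast
  define xs where "xs = sorted_list_of_set A"
  have xs: "set xs = A" "length xs = k" "sorted_wrt (<) xs"
    using fin A(2) by (auto simp: xs_def)
  define ys where "ys = 0 # map Suc xs @ [Suc m]"
  have ys_len: "length ys = Suc (Suc k)" by (simp add: ys_def xs(2))
  have ys0: "ys ! 0 = 0" and ysk: "ys ! Suc k = Suc m" and ysp: "p < k \<Longrightarrow> ys ! Suc p = Suc (xs ! p)" for p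
    using xs(2) by (auto simp: ys_def nth_append)
  have Am: "\<forall>v \<in> A. v < m" using A(1) I by blast
  have "sorted_wrt (<) ys"
    unfolding ys_def using xs(1,3) Am by (auto simp: sorted_wrt_append sorted_wrt_map)
  then have ys_less: "ys ! p < ys ! Suc p" if "p \<le> k" for p
    using that ys_len by (simp add: sorted_wrt_nth_less)
  define gap where "gap p = (p, ys ! p, ys ! Suc p)" for p
  have ys_input: "ys ! Suc p \<in> Suc ` set I" if "p < k" for p
    using that A(1) xs(1,2) nth_mem[of p xs] by (auto simp: ysp)
  have gap: "gap p \<in> set (gap_triples k m I)" if p: "p \<le> k" for p
  proof -
    have "ys ! p \<in> insert 0 (Suc ` set I)" using p ys_input[of "p - 1"] ys0 by (cases p) auto
    moreover have "ys ! Suc p \<in> insert (Suc m) (Suc ` set I)"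
      using p ys_input[of p] ysk by (cases "p = k") auto
    ultimately show ?thesis
      unfolding set_gap_triples gap_def using p ys_less[OF p] ys0 ysk by auto
  qed
  define el where "el s = (j, map gap s)" for s
  have slot_el: "slot (el s) = s" for s
    by (simp add: slot_def el_def gap_def comp_def)
  have compat_el: "compatible (el s) (el t)" for s t
    by (auto simp: compatible_def el_def gap_def)
  have el_U: "el s \<in> set U" if "s \<in> set (slots w k)" for s
    using that gap j(1) compat_el[of s s] by (auto simp: set_elements set_slots el_def)
  let ?H = "el ` set (slots w k)"
  have "card ?H \<le> Suc k ^ w"
    using card_image_le[of "set (slots w k)" el] card_slots[of w k] by simp
  \<comment> \<open>Compatibility with the choice in its own slot forces \<open>e\<close> to equal
    that choice; otherwise that choice is the incompatible element sought.\<close>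
  moreover have "\<exists>f \<in> ?H. follows e s f" if e: "e \<in> set U" and s: "s \<in> set (slots w k)" for e s
  proof (cases "compatible e (el (slot e))")
    case False
    then show ?thesis using slot_element[OF e] slot_el unfolding follows_def by blast
  next
    case True
    have "gap (fst x) = x" if "x \<in> set (snd e)" for x
    proof -
      have "gap (fst x) \<in> set (snd (el (slot e)))" using that by (auto simp: el_def slot_def)
      then show ?thesis using True that unfolding compatible_def by (auto simp: gap_def prod_eq_iff)
    qed
    then have "map gap (slot e) = snd e" by (simp add: slot_def map_idI)
    moreover have "fst e = j" using True by (simp add: compatible_def el_def)
    ultimately have "e = el (slot e)" by (simp add: el_def prod_eq_iff)
    then have "compatible e (el s)" using compat_el by metis
    then show ?thesis using s slot_el unfolding follows_def by blast
  qed
  moreover have "\<exists>f \<in> ?H. satisfies i D f" if i: "i < length J" "D \<in> set (J ! i)" for i D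
  proof (cases "i = j")
    case False
    have "replicate w 0 \<in> set (slots w k)" by (auto simp: set_slots)
    then show ?thesis using False unfolding satisfies_def el_def by force
  next
    case True
    then have "holds_dnf A D" using i(2) j(2) by (simp add: holds_and_def)
    then obtain T where T: "T \<in> set D" "\<And>l. l \<in> set T \<Longrightarrow> (fst l \<in> A) = snd l"
      unfolding holds_dnf_def by blast
    have "narrow m w D" using J[OF nth_mem[OF i(1)] i(2)] .
    then have Tw: "length T \<le> w" "\<And>l. l \<in> set T \<Longrightarrow> fst l < m" using T(1) by (auto simp: narrow_def)
    have "\<exists>p \<le> k. witnesses (gap p) l" if l: "l \<in> set T" for l
    proof (cases "snd l")
      case True
      then obtain p where p: "p < k" "xs ! p = fst l" using T(2)[OF l] xs by (metis in_set_conv_nth)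
      then show ?thesis using True by (intro exI[of _ p]) (simp add: witnesses_def gap_def ysp)
    next
      case False
      then have notA: "fst l \<notin> A" using T(2)[OF l] by simp
      have "ys ! p \<noteq> Suc (fst l)" if "p \<le> k" for p
        using that notA xs(1,2) ys0 ysp[of "p - 1"] nth_mem[of "p - 1" xs] by (cases p) auto
      then have "\<exists>p \<le> k. ys ! p < Suc (fst l) \<and> Suc (fst l) < ys ! Suc p"
        using Tw(2)[OF l] ys0 ysk by (intro discrete_crossing) auto
      then show ?thesis using False by (simp add: witnesses_def gap_def)
    qed
    then obtain \<pi> where \<pi>: "\<And>l. l \<in> set T \<Longrightarrow> \<pi> l \<le> k \<and> witnesses (gap (\<pi> l)) l" by metis
    \<comment> \<open>One witnessing gap number per literal, padded to length \<open>w\<close> with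
      gap number 0, which always exists.\<close>
    define s where "s = map \<pi> T @ replicate (w - length T) 0"
    have "s \<in> set (slots w k)" using \<pi> Tw(1) by (auto simp: s_def set_slots)
    moreover have "satisfies i D (el s)"
      unfolding satisfies_def using T(1) \<pi> by (auto simp: el_def s_def intro!: bexI[of _ T])
    ultimately show ?thesis by blast
  qed
  ultimately show ?thesis using el_U slot_el by (intro exI[of _ ?H]) auto
qed

lemma hitting_rows_iff:
  assumes "length U \<le> N"
  shows "(\<exists>H \<subseteq> {..<N}. card H \<le> Suc k ^ w \<and>
      (\<forall>r \<in> set (hitting_rows (slots w k) J U). \<exists>u \<in> H. nth_or False r u)) \<longleftrightarrow>
    (\<exists>A \<subseteq> set I. card A = k \<and> holds_or A J)"
proof -
  let ?\<P> = "(\<lambda>s f. slot f = s) ` set (slots w k) \<union> (\<lambda>(e, s). follows e s) ` (set U \<times> set (slots w k)) \<union>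
      (\<lambda>(j, D). satisfies j D) ` (SIGMA j:{..<length J}. set (J ! j))"
  have split: "(\<forall>P \<in> ?\<P>. \<exists>f \<in> H. P f) \<longleftrightarrow>
    (\<forall>s \<in> set (slots w k). \<exists>f \<in> H. slot f = s) \<and>
    (\<forall>e \<in> set U. \<forall>s \<in> set (slots w k). \<exists>f \<in> H. follows e s f) \<and>
    (\<forall>j < length J. \<forall>D \<in> set (J ! j). \<exists>f \<in> H. satisfies j D f)" for H
    by (simp add: ball_Un) blast
  have "(\<exists>H \<subseteq> set U. card H \<le> Suc k ^ w \<and> (\<forall>P \<in> ?\<P>. \<exists>f \<in> H. P f)) \<longleftrightarrow>
    (\<exists>A \<subseteq> set I. card A = k \<and> holds_or A J)"
    unfolding split
  proof
    assume "\<exists>H \<subseteq> set U. card H \<le> Suc k ^ w \<and>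
      (\<forall>s \<in> set (slots w k). \<exists>f \<in> H. slot f = s) \<and>
      (\<forall>e \<in> set U. \<forall>s \<in> set (slots w k). \<exists>f \<in> H. follows e s f) \<and>
      (\<forall>j < length J. \<forall>D \<in> set (J ! j). \<exists>f \<in> H. satisfies j D f)"
    then obtain H where H: "H \<subseteq> set U" "card H \<le> Suc k ^ w"
      "\<forall>s \<in> set (slots w k). \<exists>f \<in> H. slot f = s"
      "\<forall>e \<in> set U. \<forall>s \<in> set (slots w k). \<exists>f \<in> H. follows e s f"
      "\<forall>j < length J. \<forall>D \<in> set (J ! j). \<exists>f \<in> H. satisfies j D f" by (elim exE conjE)
    show "\<exists>A \<subseteq> set I. card A = k \<and> holds_or A J"
      by (rule selection_sound[OF H(1,2)]) (use H(3-5) in simp_all)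
  qed (elim exE conjE, rule selection_complete)
  then show ?thesis unfolding hitting_set_columns_iff[OF assms set_hitting_rows] .
qed

end

section \<open>The reduction\<close>

definition inputs_list :: "circuit \<Rightarrow> nat list" where
  "inputs_list C = filter (\<lambda>i. case nth_or GInput C i of GInput \<Rightarrow> True | GNot _ \<Rightarrow> False | GAnd _ \<Rightarrow> False | GOr _ \<Rightarrow> False)
     [0..<length C]"

lemma set_inputs_list: "set (inputs_list C) = circuit_inputs C"
proof -
  have "(case g of GInput \<Rightarrow> True | GNot _ \<Rightarrow> False | GAnd _ \<Rightarrow> False | GOr _ \<Rightarrow> False) \<longleftrightarrow> g = GInput" for g
    by (cases g) auto
  then show ?thesis by (auto simp: inputs_list_def circuit_inputs_def nth_or)
qed

definition circuit_elements :: "nat \<Rightarrow> circuit \<Rightarrow> nat \<Rightarrow> element list" where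
  "circuit_elements d C k =
     elements (2 ^ d) k (length C) (inputs_list C) (length (or_and_dnf d True C (length C - 1)))"

definition circuit_rows :: "nat \<Rightarrow> circuit \<Rightarrow> nat \<Rightarrow> bool list list" where
  "circuit_rows d C k =
     hitting_rows (slots (2 ^ d) k) (or_and_dnf d True C (length C - 1)) (circuit_elements d C k)"

text \<open>Five extra empty columns make the matrix large enough for any circuit, and each row
  appears one time more than the new parameter.\<close>

definition reduction :: "nat \<Rightarrow> circuit \<times> nat \<Rightarrow> (nat \<times> (nat \<times> nat \<times> nat) list \<times> nat \<times> nat) \<times> nat" where
  "reduction d z =
     (matrix_instance (length (circuit_elements d (fst z) (snd z)) + 5)
        (concat (map (\<lambda>_. circuit_rows d (fst z) (snd z)) [0..<Suc (Suc (snd z) ^ 2 ^ d)])),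
      Suc (snd z) ^ 2 ^ d)"

lemma pt_reduction: "polytime (reduction d)"
  unfolding reduction_def circuit_elements_def circuit_rows_def inputs_list_def
  by (intro pt_intros pt_comp2[OF pt_or_and_dnf])

lemma reduction_correct:
  assumes C: "is_circuit C" "weft C \<le> 2" "depth C \<le> d"
  shows "(enc (fst (reduction d (C, k))), snd (reduction d (C, k))) \<in> CPD_encodings matrix_instances"
    and "(enc (fst (reduction d (C, k))), snd (reduction d (C, k))) \<in> CPD \<longleftrightarrow>
      (\<exists>A \<subseteq> circuit_inputs C. card A = k \<and> circuit_satisfied C A)"
proof -
  let ?J = "or_and_dnf d True C (length C - 1)"
  let ?U = "circuit_elements d C k"
  let ?K = "Suc k ^ 2 ^ d"
  let ?N = "length ?U + 5"
  define M where "M = concat (map (\<lambda>_. circuit_rows d C k) [0..<Suc ?K])"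
  have red: "reduction d (C, k) = (matrix_instance ?N M, ?K)"
    by (simp add: reduction_def M_def del: upt_Suc)
  have set_M: "set M = set (circuit_rows d C k)"
    by (auto simp: M_def)
  have "slots (2 ^ d) k \<noteq> []" using length_slots[of "2 ^ d" k] by auto
  then have "circuit_rows d C k \<noteq> []" by (simp add: circuit_rows_def hitting_rows_def)
  then have "M \<noteq> []" using set_M by auto
  then interpret large_matrix ?N M by unfold_locales auto
  have out: "length C - 1 < length C" using C(1) by (auto simp: is_circuit_def)
  interpret gap_code "2 ^ d" k "length C" "inputs_list C" ?J
    by unfold_locales (use or_and_dnf_narrow[OF C(1) out] in \<open>auto simp: inputs_list_def\<close>)
  have copies: "?K < length (filter ((=) r) M)" if r: "r \<in> set M" for r
  proof -
    have "length (filter ((=) r) (concat (map (\<lambda>_. xs) is))) = length is * length (filter ((=) r) xs)" for xs and "is" :: "nat list"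
      by (induction "is") auto
    then have "length (filter ((=) r) M) = Suc ?K * length (filter ((=) r) (circuit_rows d C k))"
      by (simp add: M_def del: upt_Suc)
    moreover have "filter ((=) r) (circuit_rows d C k) \<noteq> []"
      using r set_M by (simp add: filter_empty_conv)
    then have "Suc ?K * 1 \<le> Suc ?K * length (filter ((=) r) (circuit_rows d C k))"
      by (intro mult_le_mono2) (simp add: Suc_le_eq)
    ultimately show ?thesis by simp
  qed
  show "(enc (fst (reduction d (C, k))), snd (reduction d (C, k))) \<in> CPD_encodings matrix_instances"
  proof -
    have "(matrix_graph ?N M, 3, 3 * ?N, ?K) \<in> matrix_instances"
      unfolding matrix_instances_def using large_matrix_axioms by blast
    then show ?thesis
      unfolding red CPD_encodings_def fst_conv snd_conv mem_Collect_eq prod.case using matrix_encodes by blast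
  qed
  have "(enc (fst (reduction d (C, k))), snd (reduction d (C, k))) \<in> CPD \<longleftrightarrow>
      path_deletion_solvable (matrix_graph ?N M) 3 (3 * ?N) ?K"
    unfolding red using CPD_iff[OF matrix_encodes colored_graph] by simp
  also have "\<dots> \<longleftrightarrow> (\<exists>H \<subseteq> {..<?N}. card H \<le> ?K \<and> (\<forall>r \<in> set M. \<exists>u \<in> H. nth_or False r u))"
    by (rule solvable_iff_hitting_set) (rule copies)
  also have "\<dots> \<longleftrightarrow> (\<exists>A \<subseteq> set (inputs_list C). card A = k \<and> holds_or A ?J)"
    unfolding set_M circuit_rows_def circuit_elements_def
    by (rule hitting_rows_iff) simp
  also have "\<dots> \<longleftrightarrow> (\<exists>A \<subseteq> circuit_inputs C. card A = k \<and> circuit_satisfied C A)"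
    unfolding set_inputs_list circuit_satisfied_iff[OF C(1,3,2)] circuit_output_def ..
  finally show "(enc (fst (reduction d (C, k))), snd (reduction d (C, k))) \<in> CPD \<longleftrightarrow>
      (\<exists>A \<subseteq> circuit_inputs C. card A = k \<and> circuit_satisfied C A)" .
qed

text \<open>The depth bound \<open>d\<close> comes with \<open>Q\<close>, so the program may depend
  on it; the width \<open>2 ^ d\<close> is then a constant and the new parameter a function of
  \<open>k\<close> alone.\<close>

lemma matrix_instances_W2_hard: "W_hard_on 2 (CPD_encodings matrix_instances) CPD"
  unfolding W_hard_on_def
proof
  fix Q assume "Q \<in> W_class 2"
  then obtain d where Q: "fpt_reducible Q (WCS_instances 2 d) WCS" unfolding W_class_def by blast
  show "fpt_reducible Q (CPD_encodings matrix_instances) CPD"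
  proof (rule fpt_reducible_trans_polytime[OF Q pt_reduction])
    show "polytime (\<lambda>k. Suc k ^ 2 ^ d)" by (intro pt_intros)
    show "mono (\<lambda>k. Suc k ^ 2 ^ d)" by (intro monoI power_mono) auto
    fix x k assume "(x, k) \<in> WCS_instances 2 d"
    then obtain C where C: "x = enc C" "is_circuit C" "weft C \<le> 2" "depth C \<le> d"
      unfolding WCS_instances_def enc_gate_eq enc_list_eq by blast
    have "(x, k) \<in> WCS \<longleftrightarrow> (\<exists>A \<subseteq> circuit_inputs C. card A = k \<and> circuit_satisfied C A)"
      unfolding WCS_def enc_gate_eq enc_list_eq using C(1,2) by (auto simp: enc_eq_iff)
    then show "\<exists>y. x = enc y \<and> snd (reduction d (y, k)) \<le> Suc k ^ 2 ^ d \<and>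
        (enc (fst (reduction d (y, k))), snd (reduction d (y, k))) \<in> CPD_encodings matrix_instances \<and>
        ((x, k) \<in> WCS \<longleftrightarrow> (enc (fst (reduction d (y, k))), snd (reduction d (y, k))) \<in> CPD)"
      using C(1) reduction_correct[OF C(2,3,4), of k] by (intro exI[of _ C]) (simp add: reduction_def)
  qed
qed

theorem theorem19:
  shows "\<exists>R :: cpd_instance set.
    (\<forall>(G, c, l, k) \<in> R. colored_graph c G \<and> c = 3 \<and> non_cascading G c l) \<and>
    (\<exists>a. \<forall>(G, c, l, k) \<in> R. card (induced_colored_paths G c l) \<le> card (verts G) ^ a) \<and>
    paths_enumerable_in_poly_time R \<and>
    W_hard_on 2 (CPD_encodings R) CPD"
proof (intro exI[of _ matrix_instances] conjI)
  show "\<forall>(G, c, l, k) \<in> matrix_instances. colored_graph c G \<and> c = 3 \<and> non_cascading G c l"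
    unfolding matrix_instances_def using large_matrix.colored_graph large_matrix.non_cascading by blast
  have "\<forall>(G, c, l, k) \<in> matrix_instances. card (induced_colored_paths G c l) \<le> card (verts G) ^ 1"
    unfolding matrix_instances_def power_one_right using large_matrix.card_induced by blast
  then show "\<exists>a. \<forall>(G, c, l, k) \<in> matrix_instances. card (induced_colored_paths G c l) \<le> card (verts G) ^ a"
    by blast
qed (rule matrix_instances_enumerable matrix_instances_W2_hard)+

end
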